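(* Let $n\ge 2$, let $\Omega\subset\mathbb R^n$ be open, let $0<d<n$ and $a>0$, and let $f\in W^{2,q}(\Omega,\mathbb R^n)$ with $|J_f|^{-a}\in L^1(\Omega)$. (i) If $q>n$ and $\bigl(1-\frac{n-d}{q}\bigr)a\ge n-d$, then $\mathcal H^d(\{x\in\Omega: J_f(x)=0\})=0$. (ii) If $\frac{n^2}{2n-1}<q\le n$ and $\bigl(n-d+\frac{d}{n}-\frac{n}{q}(n-d)\bigr)a\ge n-d$, then $\mathcal H^d(\{x\in\Omega: J_f(x)=0\})=0$.
   Context: $J_f=\det Df$. $\mathcal H^d$ is the $d$-dimensional Hausdorff measure on $\mathbb R^n$. For $q>n$, $Df$ is continuous by Sobolev embedding and $J_f$ denotes its continuous representative. For $q\le n$, $J_f$ denotes its precise (quasicontinuous) representative: $J_f(x)$ is defined as the Lebesgue value $\lim_{r\to0}\frac{1}{|B(x,r)|}\int_{B(x,r)}J_f$ at points where this limit exists and $\lim_{r\to 0}\frac{1}{|B(x,r)|}\int_{B(x,r)}|J_f(y)-J_f(x)|\,dy=0$. Under the hypotheses of (ii), the set of points where this fails is $\mathcal H^d$-null, so the zero set is well defined up to an $\mathcal H^d$-null set. *)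

theory Defs
  imports "HOL-Analysis.Analysis"
begin

definition partial_deriv :: "'n::finite \<Rightarrow> (real^'n \<Rightarrow> real) \<Rightarrow> real^'n \<Rightarrow> real" where
  "partial_deriv i g x = frechet_derivative g (at x) (axis i 1)"

fun Ck :: "nat \<Rightarrow> (real^'n::finite \<Rightarrow> real) \<Rightarrow> bool" where
  "Ck 0 g = continuous_on UNIV g"
| "Ck (Suc k) g = (g differentiable_on UNIV \<and> (\<forall>i. Ck k (partial_deriv i g)))"

definition smooth :: "(real^'n::finite \<Rightarrow> real) \<Rightarrow> bool" where
  "smooth g \<longleftrightarrow> (\<forall>k. Ck k g)"

definition tsupp :: "(real^'n::finite \<Rightarrow> real) \<Rightarrow> (real^'n) set" where
  "tsupp g = closure {x. g x \<noteq> 0}"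

definition test_function :: "(real^'n::finite) set \<Rightarrow> (real^'n \<Rightarrow> real) \<Rightarrow> bool" where
  "test_function \<Omega> \<phi> \<longleftrightarrow> smooth \<phi> \<and> compact (tsupp \<phi>) \<and> tsupp \<phi> \<subseteq> \<Omega>"

definition loc_integrable :: "(real^'n::finite) set \<Rightarrow> (real^'n \<Rightarrow> real) \<Rightarrow> bool" where
  "loc_integrable \<Omega> u \<longleftrightarrow> (\<forall>K. compact K \<and> K \<subseteq> \<Omega> \<longrightarrow> set_integrable lebesgue K u)"

definition weak_partial :: "(real^'n::finite) set \<Rightarrow> (real^'n \<Rightarrow> real) \<Rightarrow> 'n \<Rightarrow> (real^'n \<Rightarrow> real) \<Rightarrow> bool" where
  "weak_partial \<Omega> u i g \<longleftrightarrow> loc_integrable \<Omega> u \<and> loc_integrable \<Omega> g \<and>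
     (\<forall>\<phi>. test_function \<Omega> \<phi> \<longrightarrow>
        set_lebesgue_integral lebesgue \<Omega> (\<lambda>x. u x * partial_deriv i \<phi> x)
        = - set_lebesgue_integral lebesgue \<Omega> (\<lambda>x. g x * \<phi> x))"

definition Lp :: "real \<Rightarrow> (real^'n::finite) set \<Rightarrow> (real^'n \<Rightarrow> real) \<Rightarrow> bool" where
  "Lp q \<Omega> u \<longleftrightarrow> set_borel_measurable lebesgue \<Omega> u \<and> set_integrable lebesgue \<Omega> (\<lambda>x. \<bar>u x\<bar> powr q)"

definition W2 :: "real \<Rightarrow> (real^'n::finite) set \<Rightarrow> (real^'n \<Rightarrow> real) \<Rightarrow> bool" where
  "W2 q \<Omega> u \<longleftrightarrow> Lp q \<Omega> u \<and>
     (\<exists>g1 g2. \<forall>i. weak_partial \<Omega> u i (g1 i) \<and> Lp q \<Omega> (g1 i) \<and>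
        (\<forall>j. weak_partial \<Omega> (g1 i) j (g2 i j) \<and> Lp q \<Omega> (g2 i j)))"

definition W2_vec :: "real \<Rightarrow> (real^'n::finite) set \<Rightarrow> (real^'n \<Rightarrow> real^'m::finite) \<Rightarrow> bool" where
  "W2_vec q \<Omega> f \<longleftrightarrow> (\<forall>j. W2 q \<Omega> (\<lambda>x. f x $ j))"

definition ball_avg :: "(real^'n::finite \<Rightarrow> real) \<Rightarrow> real^'n \<Rightarrow> real \<Rightarrow> real" where
  "ball_avg u x r = set_lebesgue_integral lebesgue (ball x r) u / measure lebesgue (ball x r)"

definition precise_value :: "(real^'n::finite \<Rightarrow> real) \<Rightarrow> real^'n \<Rightarrow> real \<Rightarrow> bool" where
  "precise_value u x c \<longleftrightarrow>
     ((\<lambda>r. ball_avg u x r) \<longlongrightarrow> c) (at_right 0) \<and>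
     ((\<lambda>r. ball_avg (\<lambda>y. \<bar>u y - c\<bar>) x r) \<longlongrightarrow> 0) (at_right 0)"

definition hausdorff_const :: "real \<Rightarrow> real" where
  "hausdorff_const d = pi powr (d / 2) / Gamma (d / 2 + 1)"

definition hausdorff_pre :: "real \<Rightarrow> real \<Rightarrow> 'a::metric_space set \<Rightarrow> ennreal" where
  "hausdorff_pre d \<delta> E = (INF C \<in> {C :: nat \<Rightarrow> 'a set. E \<subseteq> (\<Union>i. C i) \<and>
        (\<forall>i. bounded (C i) \<and> diameter (C i) \<le> \<delta>)}.
      (\<Sum>i. ennreal (hausdorff_const d * (diameter (C i) / 2) powr d)))"

definition hausdorff_measure :: "real \<Rightarrow> 'a::metric_space set \<Rightarrow> ennreal" where
  "hausdorff_measure d E = (SUP \<delta> \<in> {0<..}. hausdorff_pre d \<delta> E)"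

definition neg_pow :: "real \<Rightarrow> real \<Rightarrow> ennreal" where
  "neg_pow a t = (if t = 0 then \<infinity> else ennreal (\<bar>t\<bar> powr (- a)))"

end

theory Submission
  imports Defs "HOL-Computational_Algebra.Polynomial"
begin

text \<open>
  Put \<open>\<beta> = 1 - (n - d) / q\<close>; both hypotheses give \<open>\<beta> > 0\<close> and \<open>\<beta> * a \<ge> n - d\<close>.
  For \<open>d < n\<close> and \<open>h\<close> integrable, the integral of \<open>h\<close> over the ball of radius \<open>r\<close> about \<open>x\<close>
  is \<open>o(r^d)\<close> for \<open>x\<close> outside an \<open>H^d\<close>-null set, by a Vitali covering; apply this to
  \<open>\<bar>D\<^sup>2f\<bar> powr q + \<bar>J\<bar> powr (- a)\<close>. At such a point \<open>x\<close>, the Poincare inequality on dyadic cubes shows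
  that \<open>Df\<close> has a limit value \<open>A\<close>, with mean oscillation \<open>O(r powr \<beta>)\<close> about it. If \<open>J\<close>
  vanishes at \<open>x\<close>, then \<open>det A = 0\<close>, so by Markov's inequality \<open>\<bar>J\<bar> \<le> C * r powr \<beta>\<close> on most of a cube
  of side \<open>r\<close>. Hence \<open>\<bar>J\<bar> powr (- a)\<close> has integral at least
  \<open>c * r powr (n - \<beta> * a) \<ge> c * r powr d\<close> there, contradicting the choice of \<open>x\<close>.
\<close>

section \<open>Hausdorff null sets and densities\<close>

text \<open>Hoelder's inequality turns energy at most \<open>r powr d\<close> on a cube into a bound
  \<open>2 * r powr (n - 1 + \<beta>)\<close> for the integral of the second derivatives. This is a
  Morrey growth condition, and it is how \<beta> arises. The borderline case \<beta> a = n - d is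
  covered because the density at a typical point is little-o of \<open>r powr d\<close>, while the
  constant in the lower bound may depend on the point but not on the radius. All facts about Sobolev
  functions come from one identity: for each fixed v and almost every y, u(y + v) - u(y) is the
  integral of the weak gradient along the segment. It is obtained by testing and Fubini, without
  mollification. A zero of the Jacobian enters only as the statement that the mean of the absolute
  value of \<open>det Df\<close> over cubes at x tends to 0. The continuous representative gives
  this directly. For the precise value there is an obstacle: the integral of a non-integrable
  function is 0 by convention, so local integrability of \<open>det Df\<close> must come first. It
  follows from a Sobolev embedding into L^n, and the lower bound on q in (ii) enters only through
  \<open>q > n / 2\<close>.\<close>

lemma hausdorff_measure_nullI:
  fixes E :: "'a::metric_space set"
  assumes "\<And>\<delta> e. 0 < \<delta> \<Longrightarrow> 0 < e \<Longrightarrow> \<exists>C :: nat \<Rightarrow> 'a set. E \<subseteq> (\<Union>i. C i) \<and>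
      (\<forall>i. bounded (C i) \<and> diameter (C i) \<le> \<delta>) \<and>
      (\<Sum>i. ennreal (hausdorff_const d * (diameter (C i) / 2) powr d)) \<le> ennreal e"
  shows "hausdorff_measure d E = 0"
proof -
  have "hausdorff_pre d \<delta> E = 0" if "\<delta> > 0" for \<delta>
  proof -
    have "hausdorff_pre d \<delta> E \<le> 0 + ennreal e" if "e > 0" for e
    proof -
      obtain C :: "nat \<Rightarrow> 'a set" where "E \<subseteq> (\<Union>i. C i)"
        "\<forall>i. bounded (C i) \<and> diameter (C i) \<le> \<delta>"
        "(\<Sum>i. ennreal (hausdorff_const d * (diameter (C i) / 2) powr d)) \<le> ennreal e"
        using assms[OF \<open>\<delta> > 0\<close> \<open>e > 0\<close>] by blast
      then show ?thesis unfolding hausdorff_pre_def by (auto intro: INF_lower2)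
    qed
    then show ?thesis using ennreal_le_epsilon[of 0 "hausdorff_pre d \<delta> E"] by auto
  qed
  then show ?thesis by (auto simp: hausdorff_measure_def)
qed

lemma hausdorff_measure_nullD:
  fixes E :: "'a::metric_space set"
  assumes "hausdorff_measure d E = 0" "0 < \<delta>" "0 < e"
  obtains C :: "nat \<Rightarrow> 'a set" where "E \<subseteq> (\<Union>i. C i)"
      "\<And>i. bounded (C i) \<and> diameter (C i) \<le> \<delta>"
      "(\<Sum>i. ennreal (hausdorff_const d * (diameter (C i) / 2) powr d)) \<le> ennreal e"
proof -
  have "hausdorff_pre d \<delta> E \<le> hausdorff_measure d E"
    unfolding hausdorff_measure_def by (rule SUP_upper) (use assms in auto)
  then have "hausdorff_pre d \<delta> E < ennreal e" using assms by auto
  then show ?thesis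
    unfolding hausdorff_pre_def INF_less_iff using that by (auto intro: less_imp_le)
qed

lemma hausdorff_measure_null_subset:
  assumes "hausdorff_measure d B = 0" "A \<subseteq> B"
  shows "hausdorff_measure d A = 0"
proof (rule hausdorff_measure_nullI)
  fix \<delta> e :: real assume "0 < \<delta>" "0 < e"
  from hausdorff_measure_nullD[OF assms(1) this] obtain C :: "nat \<Rightarrow> 'a set" where
    "B \<subseteq> (\<Union>i. C i)" "\<And>i. bounded (C i) \<and> diameter (C i) \<le> \<delta>"
    "(\<Sum>i. ennreal (hausdorff_const d * (diameter (C i) / 2) powr d)) \<le> ennreal e" by blast
  then show "\<exists>C :: nat \<Rightarrow> 'a set. A \<subseteq> (\<Union>i. C i) \<and>
      (\<forall>i. bounded (C i) \<and> diameter (C i) \<le> \<delta>) \<and>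
      (\<Sum>i. ennreal (hausdorff_const d * (diameter (C i) / 2) powr d)) \<le> ennreal e"
    using assms(2) by (intro exI[of _ C]) auto
qed

lemma hausdorff_measure_null_UN:
  fixes A :: "nat \<Rightarrow> 'a::metric_space set"
  assumes "\<And>m. hausdorff_measure d (A m) = 0"
  shows "hausdorff_measure d (\<Union>m. A m) = 0"
proof (rule hausdorff_measure_nullI)
  fix \<delta> e :: real assume \<delta>: "0 < \<delta>" and e: "0 < e"
  let ?w = "\<lambda>S :: 'a set. ennreal (hausdorff_const d * (diameter S / 2) powr d)"
  have "\<exists>C :: nat \<Rightarrow> 'a set. A m \<subseteq> (\<Union>i. C i) \<and>
      (\<forall>i. bounded (C i) \<and> diameter (C i) \<le> \<delta>) \<and> (\<Sum>i. ?w (C i)) \<le> ennreal (e * (1/2)^Suc m)" for m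
    using hausdorff_measure_nullD[OF assms \<delta>, of "e * (1/2)^Suc m" m] e by (metis mult_pos_pos zero_less_power half_gt_zero_iff zero_less_one)
  then obtain C :: "nat \<Rightarrow> nat \<Rightarrow> 'a set" where C: "\<And>m. A m \<subseteq> (\<Union>i. C m i)"
      "\<And>m i. bounded (C m i) \<and> diameter (C m i) \<le> \<delta>"
      "\<And>m. (\<Sum>i. ?w (C m i)) \<le> ennreal (e * (1/2)^Suc m)"
    by metis
  define D where "D i = (case prod_decode i of (m, j) \<Rightarrow> C m j)" for i
  have "(\<Sum>i. ?w (D i)) = (\<Sum>m. \<Sum>i. ?w (C m i))"
    using suminf_ennreal_2dimen[of "\<lambda>m. \<Sum>i. ?w (C m i)" "\<lambda>(m,i). ?w (C m i)"]
    by (simp add: D_def comp_def split_def)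
  also have "\<dots> \<le> (\<Sum>m. ennreal (e * (1/2)^Suc m))"
    by (intro suminf_le C) auto
  also have "\<dots> = ennreal e"
    using sums_mult[OF power_half_series, of e] e
    by (intro suminf_ennreal_eq) auto
  finally have "(\<Sum>i. ?w (D i)) \<le> ennreal e" .
  moreover have "(\<Union>m. A m) \<subseteq> (\<Union>i. D i)"
  proof
    fix x assume "x \<in> (\<Union>m. A m)"
    then obtain m i where "x \<in> C m i" using C(1) by blast
    then have "x \<in> D (prod_encode (m, i))" by (simp add: D_def)
    then show "x \<in> (\<Union>i. D i)" by blast
  qed
  moreover have "bounded (D i) \<and> diameter (D i) \<le> \<delta>" for i
    using C(2) by (auto simp: D_def split: prod.split)
  ultimately show "\<exists>C :: nat \<Rightarrow> 'a set. (\<Union>m. A m) \<subseteq> (\<Union>i. C i) \<and>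
      (\<forall>i. bounded (C i) \<and> diameter (C i) \<le> \<delta>) \<and> (\<Sum>i. ?w (C i)) \<le> ennreal e"
    by blast
qed

lemma Vitali_cover_density:
  fixes E :: "'a::euclidean_space set"
  assumes M: "sets M = sets borel" and U: "U \<in> sets borel"
    and cov: "\<And>x. x \<in> E \<Longrightarrow> \<exists>r. 0 < r \<and> r \<le> \<delta> \<and> cball x r \<subseteq> U \<and>
                 ennreal (c * r powr d) \<le> emeasure M (cball x r)"
  obtains x r :: "nat \<Rightarrow> _" where "\<And>i. 0 \<le> r i \<and> r i \<le> max \<delta> 0"
    "E \<subseteq> (\<Union>i. if r i = 0 then {} else cball (x i) (5 * r i))"
    "(\<Sum>i. ennreal (c * r i powr d)) \<le> emeasure M U"
proof -
  obtain r where r: "\<And>x. x \<in> E \<Longrightarrow> 0 < r x \<and> r x \<le> \<delta> \<and> cball x (r x) \<subseteq> U \<and>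
                 ennreal (c * r x powr d) \<le> emeasure M (cball x (r x))"
    using cov by metis
  have "E \<subseteq> (\<Union>x\<in>E. cball x (r x))" 
  proof
    fix x assume "x \<in> E"
    moreover from r[OF this] have "x \<in> cball x (r x)" by simp
    ultimately show "x \<in> (\<Union>x\<in>E. cball x (r x))" by blast
  qed
  then obtain C where C: "countable C" "C \<subseteq> E"
     "pairwise (\<lambda>i j. disjnt (cball i (r i)) (cball j (r j))) C"
     "E \<subseteq> (\<Union>i\<in>C. cball i (5 * r i))"
    by (rule Vitali_covering_lemma_cballs[of E "\<lambda>x. x" r E \<delta>]) (use r in auto)
  let ?T = "to_nat_on C ` C"
  let ?x = "from_nat_into C"
  define R where "R i = (if i \<in> ?T then r (?x i) else 0)" for i
  define D where "D i = (if i \<in> ?T then cball (?x i) (R i) else {})" for i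
  have xT: "?x i \<in> C" if "i \<in> ?T" for i using that C(1) by auto
  have disj: "disjoint_family D"
    unfolding disjoint_family_on_def
  proof (intro ballI impI)
    fix i j :: nat assume "i \<noteq> j"
    show "D i \<inter> D j = {}"
    proof (cases "i \<in> ?T \<and> j \<in> ?T")
      case True
      then have "?x i \<noteq> ?x j" using \<open>i \<noteq> j\<close> C(1) by auto
      then show ?thesis using C(3) xT True unfolding pairwise_def D_def R_def disjnt_def by auto
    qed (auto simp: D_def)
  qed
  have "(\<Sum>i. ennreal (c * R i powr d)) \<le> (\<Sum>i. emeasure M (D i))"
    by (intro suminf_le) (use r xT C(2) in \<open>auto simp: R_def D_def\<close>)
  also have "\<dots> = emeasure M (\<Union>i. D i)"
    by (rule suminf_emeasure[OF _ disj]) (auto simp: D_def M)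
  also have "\<dots> \<le> emeasure M U"
    by (intro emeasure_mono) (use r xT C(2) in \<open>auto simp: D_def R_def M U\<close>)
  finally have 1: "(\<Sum>i. ennreal (c * R i powr d)) \<le> emeasure M U" .
  have 2: "0 \<le> R i \<and> R i \<le> max \<delta> 0" for i
    using r xT[of i] C(2) by (auto simp: R_def intro: less_imp_le max.coboundedI1)
  have 3: "E \<subseteq> (\<Union>i. if R i = 0 then {} else cball (?x i) (5 * R i))"
  proof
    fix y assume "y \<in> E"
    then obtain x where x: "x \<in> C" "y \<in> cball x (5 * r x)" using C(4) by blast
    then have "to_nat_on C x \<in> ?T" "?x (to_nat_on C x) = x" using C(1) by auto
    moreover have "r x \<noteq> 0" using r[of x] x(1) C(2) by auto
    ultimately have "y \<in> (if R (to_nat_on C x) = 0 then {} else cball (?x (to_nat_on C x)) (5 * R (to_nat_on C x)))"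
      using x(2) by (simp add: R_def)
    then show "y \<in> (\<Union>i. if R i = 0 then {} else cball (?x i) (5 * R i))" by blast
  qed
  show ?thesis using that[OF 2 3 1] .
qed

lemma hausdorff_const_pos: "0 < d \<Longrightarrow> 0 < hausdorff_const d"
  unfolding hausdorff_const_def by (intro divide_pos_pos) auto

text \<open>Two coverings are used. In the first,
  \<open>r^n \<le> \<delta> powr (n - d) * r powr d\<close> shows that \<open>E\<close> is Lebesgue
  null, hence contained in an \<open>M\<close>-null set by absolute continuity. Outer regularity
  then gives an open superset of small mass, and a second covering inside it makes the
  \<open>d\<close>-dimensional sums small.\<close>

lemma positive_upper_density_null:
  fixes M :: "'a::euclidean_space measure" and d :: real
  assumes M: "sets M = sets borel" and fin: "emeasure M (space M) \<noteq> \<infinity>"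
    and ac: "absolutely_continuous lborel M"
    and d: "0 < d" "d < DIM('a)" and c: "0 < c"
    and E: "\<And>x \<delta>. x \<in> E \<Longrightarrow> 0 < \<delta> \<Longrightarrow> \<exists>r. 0 < r \<and> r \<le> \<delta> \<and> ennreal (c * r powr d) \<le> emeasure M (cball x r)"
  shows "hausdorff_measure d E = 0"
proof -
  interpret finite_measure M by (rule finite_measureI) (use fin in auto)
  have spM: "space M = UNIV" using M sets_eq_imp_space_eq by fastforce
  define m where "m = measure M (space M)"
  let ?n = "real DIM('a)"
  let ?v = "unit_ball_vol ?n"
  have null: "\<exists>N. N \<in> null_sets lborel \<and> E \<subseteq> N"
  proof -
    have step: "\<exists>T\<in>sets lborel. E \<subseteq> T \<and> emeasure lborel T \<le> ennreal (?v * 5^DIM('a) * \<delta> powr (?n - d) / c * m)"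
      if \<delta>: "0 < \<delta>" for \<delta>
    proof -
      obtain x r :: "nat \<Rightarrow> _" where xr: "\<And>i. 0 \<le> r i \<and> r i \<le> max \<delta> 0"
        "E \<subseteq> (\<Union>i. if r i = 0 then {} else cball (x i) (5 * r i))"
        "(\<Sum>i. ennreal (c * r i powr d)) \<le> emeasure M UNIV"
        by (rule Vitali_cover_density[OF M, of UNIV E \<delta> c d]) (use E[OF _ \<delta>] in auto)
      let ?D = "\<lambda>i. if r i = 0 then {} else cball (x i) (5 * r i)"
      have "emeasure lborel (\<Union>i. ?D i) \<le> (\<Sum>i. emeasure lborel (?D i))"
        by (intro emeasure_subadditive_countably) auto
      also have "\<dots> \<le> (\<Sum>i. ennreal (?v * 5^DIM('a) * \<delta> powr (?n - d) / c) * ennreal (c * r i powr d))"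
      proof (intro suminf_le)
        fix i
        show "emeasure lborel (?D i) \<le> ennreal (?v * 5^DIM('a) * \<delta> powr (?n - d) / c) * ennreal (c * r i powr d)"
        proof (cases "r i = 0")
          case False
          then have ri: "0 < r i" "r i \<le> \<delta>" using xr(1)[of i] \<delta> by auto
          have "r i ^ DIM('a) = r i powr (?n - d) * r i powr d"
            using ri by (simp add: powr_realpow flip: powr_add)
          also have "\<dots> \<le> \<delta> powr (?n - d) * r i powr d"
            using ri d by (intro mult_right_mono powr_mono2) auto
          finally have "?v * (5 * r i) ^ DIM('a) \<le> ?v * 5^DIM('a) * \<delta> powr (?n - d) / c * (c * r i powr d)"
            using c by (simp add: power_mult_distrib mult_left_mono)
          then show ?thesis using False ri c
            by (simp add: emeasure_cball ennreal_mult[symmetric] ennreal_leI)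
        qed simp
      qed auto
      also have "\<dots> = ennreal (?v * 5^DIM('a) * \<delta> powr (?n - d) / c) * (\<Sum>i. ennreal (c * r i powr d))"
        by simp
      also have "\<dots> \<le> ennreal (?v * 5^DIM('a) * \<delta> powr (?n - d) / c) * ennreal m"
        using xr(3) by (intro mult_left_mono) (auto simp: m_def emeasure_eq_measure spM)
      also have "\<dots> = ennreal (?v * 5^DIM('a) * \<delta> powr (?n - d) / c * m)"
        using c by (subst ennreal_mult) (auto simp: m_def)
      finally show ?thesis using xr(2) by (intro bexI[of _ "\<Union>i. ?D i"]) auto
    qed
    have "E \<in> null_sets lebesgue"
    proof -
      have "\<exists>T. E \<subseteq> T \<and> T \<in> lmeasurable \<and> measure lebesgue T \<le> e" if e: "0 < e" for e
      proof -
        \<comment> \<open>The part of the bound in \<open>step\<close> that does not depend on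
          \<delta>; the remaining factor \<open>\<delta> powr (n - d)\<close> tends to 0 because
          \<open>d < n\<close>.\<close>
        let ?K = "?v * 5^DIM('a) / c * m"
        have "((\<lambda>\<delta>::real. \<delta> powr (?n - d)) \<longlongrightarrow> 0 powr (?n - d)) (at_right 0)"
          by (rule tendsto_powr') (use d in \<open>auto intro: tendsto_intros eventually_at_rightI[of 0 1]\<close>)
        then have "((\<lambda>\<delta>. ?K * \<delta> powr (?n - d)) \<longlongrightarrow> ?K * 0 powr (?n - d)) (at_right 0)"
          by (rule tendsto_mult_left)
        then have "\<forall>\<^sub>F \<delta> in at_right 0. ?K * \<delta> powr (?n - d) < e"
          using e by (intro order_tendstoD) auto
        moreover have "\<forall>\<^sub>F \<delta> in at_right 0. (0::real) < \<delta>" by (simp add: eventually_at_right_less)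
        ultimately have "\<forall>\<^sub>F \<delta> in at_right 0. ?K * \<delta> powr (?n - d) < e \<and> 0 < \<delta>" by (rule eventually_conj)
        then obtain \<delta> where \<delta>: "0 < \<delta>" "?K * \<delta> powr (?n - d) < e"
          using eventually_happens'[OF trivial_limit_at_right_real] by blast
        from step[OF \<delta>(1)] obtain T where T: "T \<in> sets lborel" "E \<subseteq> T"
          "emeasure lborel T \<le> ennreal (?v * 5^DIM('a) * \<delta> powr (?n - d) / c * m)" by blast
        have le: "emeasure lborel T \<le> ennreal e"
          using T(3) \<delta>(2) by (elim order_trans) (auto intro!: ennreal_leI simp: field_simps)
        then have "emeasure lebesgue T \<le> ennreal e" using T(1) by simp
        moreover then have "T \<in> lmeasurable" using T(1) by (intro fmeasurableI) (auto simp: less_top[symmetric] top_unique)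
        ultimately show ?thesis using T(2) e
          by (intro exI[of _ T]) (auto simp: measure_def intro!: enn2real_leI)
      qed
      then show ?thesis using negligible_outer_le negligible_iff_null_sets by blast
    qed
    then show ?thesis by (auto simp: null_sets_completion_iff2)
  qed
  \<comment> \<open>\<open>E\<close> need not be Borel, so outer regularity is applied to a Borel
    null set around it.\<close>
  then obtain N where N: "N \<in> null_sets lborel" "E \<subseteq> N" by blast
  then have MN: "N \<in> null_sets M" using ac by (auto simp: absolutely_continuous_def)
  show ?thesis
  proof (rule hausdorff_measure_nullI)
    fix \<delta> e :: real assume \<delta>: "0 < \<delta>" and e: "0 < e"
    \<comment> \<open>An enlarged ball has half diameter \<open>5 * r\<close>, whence
      \<open>5 powr d\<close>; dividing by \<open>c\<close> passes from \<open>c * r powr d\<close>,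
      which the mass controls, to \<open>r powr d\<close>.\<close>
    let ?k = "hausdorff_const d * 5 powr d / c"
    have k: "0 < ?k" using hausdorff_const_pos[OF d(1)] c by simp
    have "(INF U \<in> {U. N \<subseteq> U \<and> open U}. emeasure M U) < ennreal (e / ?k)"
    proof -
      have "N \<in> sets borel" "emeasure M N = 0" using MN M by auto
      then have "(INF U \<in> {U. N \<subseteq> U \<and> open U}. emeasure M U) = 0"
        using outer_regular[OF M fin, of N] by simp
      then show ?thesis using divide_pos_pos[OF e k] by simp
    qed
    then obtain U where U: "N \<subseteq> U" "open U" "emeasure M U < ennreal (e / ?k)"
      unfolding INF_less_iff by blast
    \<comment> \<open>Radii up to \<open>\<delta>/10\<close> keep the diameters
      \<open>10 * r\<close> of the enlarged balls below \<delta>.\<close>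
    have "\<exists>r. 0 < r \<and> r \<le> \<delta>/10 \<and> cball x r \<subseteq> U \<and> ennreal (c * r powr d) \<le> emeasure M (cball x r)"
      if xE: "x \<in> E" for x
    proof -
      have "x \<in> U" using xE N(2) U(1) by auto
      with U(2) obtain s where s: "s > 0" "cball x s \<subseteq> U" unfolding open_contains_cball by blast
      have "0 < min s (\<delta>/10)" using s \<delta> by simp
      from E[OF xE this] obtain r where r: "0 < r" "r \<le> min s (\<delta>/10)"
        "ennreal (c * r powr d) \<le> emeasure M (cball x r)" by blast
      have "cball x r \<subseteq> U" using r(2) by (intro order_trans[OF subset_cball s(2)]) auto
      then show ?thesis using r by (intro exI[of _ r]) simp
    qed
    note small = this
    obtain x r :: "nat \<Rightarrow> _" where xr: "\<And>i. 0 \<le> r i \<and> r i \<le> max (\<delta>/10) 0"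
        "E \<subseteq> (\<Union>i. if r i = 0 then {} else cball (x i) (5 * r i))"
        "(\<Sum>i. ennreal (c * r i powr d)) \<le> emeasure M U"
      by (rule Vitali_cover_density[OF M borel_open[OF U(2)], of E "\<delta>/10" c d], rule small, assumption)
         (rule that, assumption+)
    let ?D = "\<lambda>i. if r i = 0 then {} else cball (x i) (5 * r i)"
    have "(\<Sum>i. ennreal (hausdorff_const d * (diameter (?D i) / 2) powr d))
        \<le> (\<Sum>i. ennreal ?k * ennreal (c * r i powr d))"
    proof (intro suminf_le)
      fix i
      have "diameter (?D i) / 2 = 5 * r i" using xr(1)[of i] by auto
      then have "ennreal (hausdorff_const d * (diameter (?D i) / 2) powr d) = ennreal (?k * (c * r i powr d))"
        using xr(1)[of i] c by (simp add: powr_mult)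
      then show "ennreal (hausdorff_const d * (diameter (?D i) / 2) powr d) \<le> ennreal ?k * ennreal (c * r i powr d)"
        using k c by (simp add: ennreal_mult[symmetric])
    qed auto
    also have "\<dots> = ennreal ?k * (\<Sum>i. ennreal (c * r i powr d))" by simp
    also have "\<dots> \<le> ennreal ?k * ennreal (e / ?k)"
      using xr(3) U(3) by (intro mult_left_mono) auto
    also have "\<dots> = ennreal (?k * (e / ?k))"
      by (rule ennreal_mult[symmetric, OF less_imp_le[OF k] less_imp_le[OF divide_pos_pos[OF e k]]])
    also have "?k * (e / ?k) = e"
      using k by (metis less_irrefl nonzero_mult_div_cancel_left times_divide_eq_right)
    finally show "\<exists>C :: nat \<Rightarrow> 'a set. E \<subseteq> (\<Union>i. C i) \<and>
      (\<forall>i. bounded (C i) \<and> diameter (C i) \<le> \<delta>) \<and>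
      (\<Sum>i. ennreal (hausdorff_const d * (diameter (C i) / 2) powr d)) \<le> ennreal e"
    proof (intro exI[of _ ?D] conjI allI)
      show "diameter (?D i) \<le> \<delta>" for i using xr(1)[of i] \<delta> by auto
    qed (use xr(2) in auto)
  qed
qed

text \<open>Failure for some \<open>c\<close> means positive upper density at some level
  \<open>1 / Suc k\<close>, so the exceptional set is a countable union of null sets.\<close>

lemma ae_vanishing_upper_density:
  fixes M :: "'a::euclidean_space measure" and d :: real
  assumes M: "sets M = sets borel" and fin: "emeasure M (space M) \<noteq> \<infinity>"
    and ac: "absolutely_continuous lborel M"
    and d: "0 < d" "d < DIM('a)"
  shows "hausdorff_measure d
    {x. \<not> (\<forall>c>0. \<exists>\<delta>>0. \<forall>r. 0 < r \<and> r \<le> \<delta> \<longrightarrow> emeasure M (cball x r) < ennreal (c * r powr d))} = 0"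
proof -
  define A where "A k = {x. \<forall>\<delta>>0. \<exists>r. 0 < r \<and> r \<le> \<delta> \<and>
      ennreal (1 / Suc k * r powr d) \<le> emeasure M (cball x r)}" for k :: nat
  have "hausdorff_measure d (\<Union>k. A k) = 0"
  proof (rule hausdorff_measure_null_UN)
    fix k
    show "hausdorff_measure d (A k) = 0"
      by (rule positive_upper_density_null[OF M fin ac d, of "1 / Suc k"]) (auto simp: A_def)
  qed
  then show ?thesis
  proof (rule hausdorff_measure_null_subset, intro subsetI)
    fix x assume "x \<in> {x. \<not> (\<forall>c>0. \<exists>\<delta>>0. \<forall>r. 0 < r \<and> r \<le> \<delta> \<longrightarrow>
        emeasure M (cball x r) < ennreal (c * r powr d))}"
    then obtain c where c: "0 < (c::real)"
      "\<forall>\<delta>>0. \<exists>r. (0 < r \<and> r \<le> \<delta>) \<and> ennreal (c * r powr d) \<le> emeasure M (cball x r)"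
      unfolding not_less mem_Collect_eq not_all not_ex not_imp by (metis not_le)
    obtain k where k: "1 / Suc k < c" using c(1) nat_approx_posE by metis
    have "x \<in> A k" unfolding A_def
    proof (intro CollectI allI impI)
      fix \<delta> :: real assume "\<delta> > 0"
      with c(2) obtain r where r: "0 < r" "r \<le> \<delta>" "ennreal (c * r powr d) \<le> emeasure M (cball x r)" by blast
      have "ennreal (1 / Suc k * r powr d) \<le> ennreal (c * r powr d)"
        using k by (intro ennreal_leI mult_right_mono) auto
      then show "\<exists>r. 0 < r \<and> r \<le> \<delta> \<and> ennreal (1 / Suc k * r powr d) \<le> emeasure M (cball x r)"
        using r by (intro exI[of _ r]) auto
    qed
    then show "x \<in> (\<Union>k. A k)" by blast
  qed
qed

section \<open>Smooth bump functions\<close>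

text \<open>The class of these functions is closed under differentiation, so smoothness, also at 0,
  is one induction over all \<open>p\<close> at once; \<open>p = 1\<close> gives the classical
  function \<open>exp (- 1 / x)\<close>.\<close>

definition exp_cutoff :: "real poly \<Rightarrow> real \<Rightarrow> real" where
  "exp_cutoff p x = (if 0 < x then poly p (1 / x) * exp (- (1 / x)) else 0)"

lemma tendsto_poly_exp_minus: "((\<lambda>y. poly p y * exp (- y)) \<longlongrightarrow> 0) (at_top :: real filter)"
proof -
  have "((\<lambda>y. \<Sum>i\<le>degree p. coeff p i * (y ^ i / exp y)) \<longlongrightarrow> (\<Sum>i\<le>degree p. coeff p i * 0)) (at_top :: real filter)"
    by (intro tendsto_intros tendsto_power_div_exp_0)
  then show ?thesis by (simp add: poly_altdef sum_distrib_right exp_minus divide_inverse mult.assoc)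
qed

text \<open>The factor \<open>[:0, 0, 1:]\<close> is the square of \<open>1 / x\<close> coming from
  the inner derivative. At 0 the right difference quotient belongs to the same class, with
  \<open>pCons 0 p\<close> in place of \<open>p\<close>, and therefore tends to 0.\<close>

lemma exp_cutoff_has_derivative:
  "(exp_cutoff p has_real_derivative exp_cutoff ([:0, 0, 1:] * (p - pderiv p)) x) (at x)"
proof -
  consider "x < 0" | "0 < x" | "x = 0" by linarith
  then show ?thesis
  proof cases
    case 1
    have "((\<lambda>_. 0) has_real_derivative 0) (at x)" by simp
    then have "(exp_cutoff p has_real_derivative 0) (at x)"
      by (rule has_field_derivative_transform_within_open[where S="{..<0}"])
         (use 1 in \<open>auto simp: exp_cutoff_def\<close>)
    then show ?thesis using 1 by (simp add: exp_cutoff_def)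
  next
    case 2
    have "((\<lambda>x. poly p (1 / x) * exp (- (1 / x))) has_real_derivative
        poly ([:0, 0, 1:] * (p - pderiv p)) (1 / x) * exp (- (1 / x))) (at x)"
      using 2 by (auto intro!: derivative_eq_intros simp: field_simps power2_eq_square)
    then have "(exp_cutoff p has_real_derivative
        poly ([:0, 0, 1:] * (p - pderiv p)) (1 / x) * exp (- (1 / x))) (at x)"
      by (rule has_field_derivative_transform_within_open[where S="{0<..}"])
         (use 2 in \<open>auto simp: exp_cutoff_def\<close>)
    then show ?thesis using 2 by (simp add: exp_cutoff_def)
  next
    case 3
    have "((\<lambda>h. exp_cutoff p h / h) \<longlongrightarrow> 0) (at_right 0)"
    proof (rule Lim_transform_eventually)
      show "((\<lambda>h::real. poly (pCons 0 p) (inverse h) * exp (- inverse h)) \<longlongrightarrow> 0) (at_right 0)"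
        by (rule filterlim_compose[OF tendsto_poly_exp_minus filterlim_inverse_at_top_right])
      show "\<forall>\<^sub>F h in at_right 0. poly (pCons 0 p) (inverse h) * exp (- inverse h) = exp_cutoff p h / h"
        by (rule eventually_at_rightI[of 0 1]) (auto simp: exp_cutoff_def field_simps)
    qed
    moreover have "((\<lambda>h. exp_cutoff p h / h) \<longlongrightarrow> 0) (at_left 0)"
      by (rule Lim_transform_eventually[OF tendsto_const])
         (auto simp: exp_cutoff_def intro: eventually_at_leftI[of "-1" 0])
    ultimately have "((\<lambda>h. exp_cutoff p h / h) \<longlongrightarrow> 0) (at 0)" by (simp add: filterlim_split_at)
    then show ?thesis using 3 by (simp add: has_field_derivative_iff exp_cutoff_def)
  qed
qed

section \<open>Calculus of the classes \<open>Ck\<close>\<close>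

lemma partial_deriv_eq:
  "(g has_derivative g') (at x) \<Longrightarrow> partial_deriv i g x = g' (axis i 1)"
  unfolding partial_deriv_def by (simp add: frechet_derivative_at[symmetric])

lemma Ck_SucI:
  assumes "\<And>x. (g has_derivative g' x) (at x)" "\<And>i. Ck k (\<lambda>x. g' x (axis i 1))"
  shows "Ck (Suc k) g"
proof -
  have "partial_deriv i g = (\<lambda>x. g' x (axis i 1))" for i
    using partial_deriv_eq[OF assms(1)] by blast
  then show ?thesis using assms
    by (auto simp: differentiable_on_def differentiable_def)
qed

text \<open>\<open>Ck\<close> treats the partial derivatives one at a time; expressing the total
  derivative through them lets the rules for sums, products and compositions feed
  \<open>Ck_SucI\<close>.\<close>

lemma Ck_Suc_has_derivative:
  assumes "Ck (Suc k) g"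
  shows "(g has_derivative (\<lambda>v. \<Sum>i\<in>UNIV. v $ i * partial_deriv i g x)) (at x)"
proof -
  from assms have D: "(g has_derivative frechet_derivative g (at x)) (at x)"
    by (auto simp: differentiable_on_def frechet_derivative_works)
  have "frechet_derivative g (at x) v = (\<Sum>i\<in>UNIV. v $ i * partial_deriv i g x)" for v
  proof -
    have lin: "linear (frechet_derivative g (at x))" using D by (rule has_derivative_linear)
    have "v = (\<Sum>i\<in>UNIV. v $ i *\<^sub>R axis i 1)"
      by (simp add: basis_expansion scalar_mult_eq_scaleR[symmetric])
    then have "frechet_derivative g (at x) v = frechet_derivative g (at x) (\<Sum>i\<in>UNIV. v $ i *\<^sub>R axis i 1)"
      by simp
    also have "\<dots> = (\<Sum>i\<in>UNIV. v $ i * partial_deriv i g x)"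
      by (simp add: linear_sum[OF lin] linear_scale[OF lin] partial_deriv_def)
    finally show ?thesis .
  qed
  then have "frechet_derivative g (at x) = (\<lambda>v. \<Sum>i\<in>UNIV. v $ i * partial_deriv i g x)" by blast
  with D show ?thesis by simp
qed

lemma Ck_Suc_imp_Ck: "Ck (Suc k) g \<Longrightarrow> Ck k g"
proof (induction k arbitrary: g)
  case 0
  then show ?case by (simp add: differentiable_imp_continuous_on)
next
  case (Suc k)
  then show ?case by (metis Ck.simps(2))
qed

lemma Ck_const: "Ck k (\<lambda>_. c)"
proof (induction k arbitrary: c)
  case (Suc k)
  show ?case by (rule Ck_SucI[where g'="\<lambda>_ _. 0"]) (auto intro: Suc.IH)
qed simp

lemma Ck_add: "Ck k f \<Longrightarrow> Ck k g \<Longrightarrow> Ck k (\<lambda>x. f x + g x)"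
proof (induction k arbitrary: f g)
  case (Suc k)
  show ?case
    by (rule Ck_SucI, rule has_derivative_add[OF Ck_Suc_has_derivative[OF Suc.prems(1)] Ck_Suc_has_derivative[OF Suc.prems(2)]])
       (use Suc in \<open>auto simp: axis_def if_distrib[of "\<lambda>x. x * _"] cong: if_cong\<close>)
qed (auto intro: continuous_intros)

lemma Ck_mult: "Ck k f \<Longrightarrow> Ck k g \<Longrightarrow> Ck k (\<lambda>x. f x * g x)"
proof (induction k arbitrary: f g)
  case (Suc k)
  have "Ck k f" "Ck k g" using Suc.prems by (blast intro: Ck_Suc_imp_Ck)+
  moreover have "Ck k (partial_deriv i f)" "Ck k (partial_deriv i g)" for i using Suc.prems by auto
  ultimately have *: "Ck k (\<lambda>x. f x * partial_deriv i g x + partial_deriv i f x * g x)" for i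
    by (intro Ck_add Suc.IH)
  show ?case
    by (rule Ck_SucI, rule has_derivative_mult[OF Ck_Suc_has_derivative[OF Suc.prems(1)] Ck_Suc_has_derivative[OF Suc.prems(2)]])
       (use * in \<open>auto simp: axis_def if_distrib[of "\<lambda>x. x * _"] cong: if_cong\<close>)
qed (auto intro: continuous_intros)

lemma Ck_prod: "finite S \<Longrightarrow> (\<And>i. i \<in> S \<Longrightarrow> Ck k (f i)) \<Longrightarrow> Ck k (\<lambda>x. \<Prod>i\<in>S. f i x)"
  by (induction S rule: finite_induct) (auto intro: Ck_const Ck_mult)

lemma Ck_translate: "Ck k g \<Longrightarrow> Ck k (\<lambda>x. g (x - w))"
proof (induction k arbitrary: g)
  case 0
  then show ?case
    by (auto intro!: continuous_on_compose2[of UNIV g] continuous_intros)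
next
  case (Suc k)
  have D: "((\<lambda>x. g (x - w)) has_derivative (\<lambda>v. \<Sum>i\<in>UNIV. v $ i * partial_deriv i g (x - w))) (at x)" for x
    by (rule has_derivative_compose[OF _ Ck_Suc_has_derivative[OF Suc.prems]])
       (auto intro!: derivative_eq_intros)
  show ?case
    by (rule Ck_SucI[OF D]) (use Suc in \<open>auto simp: axis_def if_distrib[of "\<lambda>x. x * _"] cong: if_cong\<close>)
qed

lemma partial_deriv_translate:
  assumes "smooth g" shows "partial_deriv i (\<lambda>x. g (x - w)) x = partial_deriv i g (x - w)"
proof -
  have "Ck (Suc 0) g" using assms unfolding smooth_def by blast
  note D = Ck_Suc_has_derivative[OF this]
  have "((\<lambda>x. g (x - w)) has_derivative (\<lambda>v. \<Sum>i\<in>UNIV. v $ i * partial_deriv i g (x - w))) (at x)"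
    by (rule has_derivative_compose[OF _ D]) (auto intro!: derivative_eq_intros)
  from partial_deriv_eq[OF this] show ?thesis
    by (simp add: axis_def if_distrib[of "\<lambda>x. x * _"] cong: if_cong)
qed

lemma Ck_exp_cutoff: "Ck k (\<lambda>y. exp_cutoff p (\<alpha> * y $ i + \<gamma>))"
proof (induction k arbitrary: p)
  case 0
  have "continuous_on UNIV (exp_cutoff p)"
    using exp_cutoff_has_derivative[of p] by (meson DERIV_continuous continuous_at_imp_continuous_on)
  then show ?case by (auto intro!: continuous_on_compose2[of UNIV "exp_cutoff p"] continuous_intros)
next
  case (Suc k)
  let ?q = "[:0, 0, 1:] * (p - pderiv p)"
  have D: "((\<lambda>y. exp_cutoff p (\<alpha> * y $ i + \<gamma>)) has_derivative
      (\<lambda>v. exp_cutoff ?q (\<alpha> * y $ i + \<gamma>) * (\<alpha> * v $ i))) (at y)" for y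
    by (rule has_derivative_compose[OF _ exp_cutoff_has_derivative[unfolded has_field_derivative_def]])
       (auto intro!: derivative_eq_intros bounded_linear_imp_has_derivative bounded_linear_vec_nth)
  show ?case
    by (rule Ck_SucI[OF D]) (intro Ck_mult Suc.IH Ck_const)
qed

text \<open>Off its support a test function vanishes on a neighbourhood, so its derivative vanishes
  too. This makes partial derivatives bounded, as Fubini requires, and admissible as test functions
  for second weak derivatives.\<close>

lemma test_function_partial_deriv:
  assumes "test_function \<Omega> \<phi>" shows "test_function \<Omega> (partial_deriv i \<phi>)"
proof -
  have sm: "smooth \<phi>" and K: "compact (tsupp \<phi>)" "tsupp \<phi> \<subseteq> \<Omega>" using assms by (auto simp: test_function_def)
  have "partial_deriv i \<phi> x = 0" if "x \<notin> tsupp \<phi>" for x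
  proof -
    have "((\<lambda>_. 0) has_derivative (\<lambda>_. 0)) (at x)" by simp
    then have "(\<phi> has_derivative (\<lambda>_. 0)) (at x)"
    proof (rule has_derivative_transform_within_open[where s="- tsupp \<phi>"])
      show "open (- tsupp \<phi>)" by (simp add: tsupp_def open_Compl)
      show "0 = \<phi> y" if "y \<in> - tsupp \<phi>" for y
        using that closure_subset[of "{x. \<phi> x \<noteq> 0}"] unfolding tsupp_def by auto
    qed (use that in auto)
    then show ?thesis using partial_deriv_eq by fastforce
  qed
  then have sub: "tsupp (partial_deriv i \<phi>) \<subseteq> tsupp \<phi>"
    unfolding tsupp_def[of "partial_deriv i \<phi>"] by (intro closure_minimal) (auto simp: tsupp_def)
  moreover have "compact (tsupp (partial_deriv i \<phi>))"
    using sub by (metis closed_closure inf.absorb_iff2 compact_Int_closed K(1) tsupp_def)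
  moreover have "smooth (partial_deriv i \<phi>)" using sm unfolding smooth_def by (metis Ck.simps(2))
  ultimately show ?thesis using K(2) by (auto simp: test_function_def)
qed

lemma test_function_bounded:
  assumes "test_function \<Omega> \<phi>" obtains B where "0 \<le> B" "\<And>x. \<bar>\<phi> x\<bar> \<le> B"
proof -
  have c: "continuous_on UNIV \<phi>" using assms by (metis Ck.simps(1) smooth_def test_function_def)
  have "compact (\<phi> ` tsupp \<phi>)" using assms c
    by (intro compact_continuous_image) (auto simp: test_function_def intro: continuous_on_subset)
  then obtain B where B: "0 < B" "\<And>x. x \<in> tsupp \<phi> \<Longrightarrow> \<bar>\<phi> x\<bar> \<le> B"
    by (metis bounded_pos compact_imp_bounded imageI real_norm_def)
  have "\<bar>\<phi> x\<bar> \<le> B" for x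
  proof (cases "x \<in> tsupp \<phi>")
    case False
    then have "\<phi> x = 0" using closure_subset[of "{x. \<phi> x \<noteq> 0}"] by (auto simp: tsupp_def)
    then show ?thesis using B by simp
  qed (use B in auto)
  then show ?thesis using that[of B] B(1) by auto
qed

text \<open>\<^term>\<open>exp_cutoff 1 (k * t)\<close> increases to the indicator of \<open>t > 0\<close> as \<open>k\<close> grows.\<close>

definition box_bump :: "real^'n::finite \<Rightarrow> real^'n \<Rightarrow> nat \<Rightarrow> real^'n \<Rightarrow> real" where
  "box_bump a b k y = (\<Prod>i\<in>UNIV. exp_cutoff 1 (real k * (y $ i - a $ i)) * exp_cutoff 1 (real k * (b $ i - y $ i)))"

lemma smooth_box_bump: "smooth (box_bump a b k)"
  unfolding smooth_def
proof
  fix m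
  have 1: "Ck m (\<lambda>y. exp_cutoff 1 (real k * y $ i + (- real k * a $ i)))"
    and 2: "Ck m (\<lambda>y. exp_cutoff 1 ((- real k) * y $ i + real k * b $ i))" for i
    by (rule Ck_exp_cutoff)+
  have "Ck m (\<lambda>y. \<Prod>i\<in>UNIV. exp_cutoff 1 (real k * y $ i + (- real k * a $ i)) * exp_cutoff 1 ((- real k) * y $ i + real k * b $ i))"
    by (intro Ck_prod Ck_mult 1 2) auto
  then show "Ck m (box_bump a b k)"
    unfolding box_bump_def[abs_def] by (simp add: algebra_simps)
qed

lemma exp_cutoff_1_bounds: "0 \<le> exp_cutoff 1 t" "exp_cutoff 1 t \<le> 1"
  by (auto simp: exp_cutoff_def)

lemma box_bump_bounds: "0 \<le> box_bump a b k y" "box_bump a b k y \<le> 1"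
  unfolding box_bump_def
  by (auto intro!: prod_nonneg prod_le_1 mult_nonneg_nonneg mult_le_one simp: exp_cutoff_1_bounds)

lemma box_bump_eq_0: "y \<notin> box a b \<Longrightarrow> box_bump a b k y = 0"
proof -
  assume "y \<notin> box a b"
  then obtain i where "y $ i \<le> a $ i \<or> b $ i \<le> y $ i" by (auto simp: mem_box_cart not_less)
  then have "exp_cutoff 1 (real k * (y $ i - a $ i)) * exp_cutoff 1 (real k * (b $ i - y $ i)) = 0"
    by (auto simp: exp_cutoff_def zero_less_mult_iff)
  then show ?thesis unfolding box_bump_def by (intro prod_zero) auto
qed

lemma test_function_box_bump:
  assumes "cbox a b \<subseteq> \<Omega>" shows "test_function \<Omega> (box_bump a b k)"
proof -
  have "{y. box_bump a b k y \<noteq> 0} \<subseteq> cbox a b"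
    using box_bump_eq_0[of _ a b k] box_subset_cbox by blast
  then have sub: "tsupp (box_bump a b k) \<subseteq> cbox a b"
    unfolding tsupp_def by (intro closure_minimal) auto
  moreover have "compact (tsupp (box_bump a b k))"
    using sub by (metis bounded_cbox bounded_subset closed_closure compact_eq_bounded_closed tsupp_def)
  ultimately show ?thesis using assms smooth_box_bump by (auto simp: test_function_def)
qed

lemma box_bump_tendsto_indicator:
  "(\<lambda>k. box_bump a b k y) \<longlonglongrightarrow> indicator (box a b) y"
proof (cases "y \<in> box a b")
  case True
  have *: "(\<lambda>k. exp_cutoff 1 (real k * t)) \<longlonglongrightarrow> 1" if "0 < t" for t
  proof (rule Lim_transform_eventually)
    have "(\<lambda>k. exp (- (1 / t * (1 / real k)))) \<longlonglongrightarrow> exp (- (1 / t * 0))"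
      by (intro tendsto_intros lim_1_over_n)
    then show "(\<lambda>k. exp (- (1 / t * (1 / real k)))) \<longlonglongrightarrow> 1" by simp
    show "\<forall>\<^sub>F k in sequentially. exp (- (1 / t * (1 / real k))) = exp_cutoff 1 (real k * t)"
      using eventually_gt_at_top[of 0] by eventually_elim (use that in \<open>auto simp: exp_cutoff_def mult.commute\<close>)
  qed
  have "(\<lambda>k. box_bump a b k y) \<longlonglongrightarrow> (\<Prod>i\<in>(UNIV::'a set). 1 * 1)"
    unfolding box_bump_def by (intro tendsto_intros *) (use True in \<open>auto simp: mem_box_cart\<close>)
  then show ?thesis using True by simp
qed (simp add: box_bump_eq_0)

section \<open>Weak derivatives and line integrals\<close>

lemma test_function_continuous: "test_function \<Omega> \<phi> \<Longrightarrow> continuous_on A \<phi>"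
  by (metis Ck.simps(1) smooth_def test_function_def continuous_on_subset subset_UNIV)

lemma test_function_borel [measurable_dest]: "test_function \<Omega> \<phi> \<Longrightarrow> \<phi> \<in> borel_measurable borel"
  by (intro borel_measurable_continuous_onI test_function_continuous)

lemma integrable_mult_bounded:
  fixes f \<psi> :: "'a \<Rightarrow> real"
  assumes "integrable M f" "\<psi> \<in> borel_measurable M" "\<And>x. \<bar>\<psi> x\<bar> \<le> B"
  shows "integrable M (\<lambda>x. f x * \<psi> x)"
proof (rule Bochner_Integration.integrable_bound[of _ "\<lambda>x. B * f x"])
  have "\<bar>f x\<bar> * \<bar>\<psi> x\<bar> \<le> \<bar>B\<bar> * \<bar>f x\<bar>" for x
    using assms(3)[of x] by (subst mult.commute) (intro mult_right_mono, auto)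
  then show "AE x in M. norm (f x * \<psi> x) \<le> norm (B * f x)" by (auto simp: abs_mult)
qed (use assms in auto)

lemma integrable_mult_test_function:
  assumes "integrable lborel W" "test_function \<Omega> \<phi>"
  shows "integrable lborel (\<lambda>x. W x * \<phi> x)"
proof -
  obtain B where B: "0 \<le> B" "\<And>x. \<bar>\<phi> x\<bar> \<le> B" using test_function_bounded[OF assms(2)] by blast
  show ?thesis by (rule integrable_mult_bounded[OF assms(1) _ B(2)]) (use test_function_borel[OF assms(2)] in simp)
qed

text \<open>The fundamental lemma of the calculus of variations: bumps converge dominatedly to the
  indicator of any subbox, so \<open>W\<close> has integral 0 over all of them, and Lebesgue
  differentiation recovers \<open>W\<close>.\<close>

lemma ae_zero_of_test_functions:
  fixes W :: "real^'n::finite \<Rightarrow> real"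
  assumes W: "integrable lborel W"
    and test: "\<And>\<phi>. test_function (box a b) \<phi> \<Longrightarrow> (\<integral>x. W x * \<phi> x \<partial>lborel) = 0"
  shows "AE x in lborel. x \<in> box a b \<longrightarrow> W x = 0"
proof -
  have [measurable]: "W \<in> borel_measurable borel" using W by auto
  have sint: "set_integrable lborel S W" if "S \<in> sets borel" for S
    unfolding set_integrable_def using that W by (intro integrable_mult_indicator) auto
  have box0: "integral (cbox c e) W = 0" if ce: "cbox c e \<subseteq> box a b" for c e
  proof -
    have [measurable]: "box_bump c e k \<in> borel_measurable borel" for k
      using test_function_borel[OF test_function_box_bump[OF ce]] .
    have "(\<lambda>k. \<integral>x. W x * box_bump c e k x \<partial>lborel) \<longlonglongrightarrow> (\<integral>x. W x * indicator (box c e) x \<partial>lborel)"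
    proof (rule integral_dominated_convergence[where w = "\<lambda>x. \<bar>W x\<bar>"])
      show "AE x in lborel. (\<lambda>k. W x * box_bump c e k x) \<longlonglongrightarrow> W x * indicator (box c e) x"
        by (intro AE_I2 tendsto_intros box_bump_tendsto_indicator)
      show "AE x in lborel. norm (W x * box_bump c e k x) \<le> \<bar>W x\<bar>" for k
        by (intro AE_I2) (simp add: abs_mult mult_left_le box_bump_bounds)
    qed (use W in auto)
    moreover have "(\<integral>x. W x * box_bump c e k x \<partial>lborel) = 0" for k
      by (rule test[OF test_function_box_bump[OF ce]])
    ultimately have "(\<integral>x. W x * indicator (box c e) x \<partial>lborel) = 0"
      by (simp add: LIMSEQ_const_iff)
    then have "(LINT x:box c e|lborel. W x) = 0" by (simp add: set_lebesgue_integral_def mult.commute)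
    then have "integral (box c e) W = 0"
      using set_borel_integral_eq_integral(2)[OF sint[of "box c e"]] by simp
    then show ?thesis by (simp add: integral_open_interval)
  qed
  have "W integrable_on cbox c e" for c e
    using set_borel_integral_eq_integral(1)[OF sint[of "cbox c e"]] by simp
  \<comment> \<open>Lebesgue differentiation along cubes with lower corner \<open>x\<close>; for
    small \<open>h\<close> they lie in the open box.\<close>
  from integrable_ccontinuous_explicit[of W, OF this] obtain N where N: "negligible N"
       "\<And>x e. x \<notin> N \<Longrightarrow> 0 < e \<Longrightarrow> \<exists>d>0. \<forall>h. 0 < h \<and> h < d \<longrightarrow>
           norm (integral (cbox x (x + h *\<^sub>R One)) W /\<^sub>R h ^ DIM(real^'n) - W x) < e"
    by blast
  have zero: "W x = 0" if x: "x \<in> box a b" "x \<notin> N" for x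
  proof (rule ccontr)
    assume "W x \<noteq> 0"
    then obtain d where d: "d > 0" "\<And>h. 0 < h \<Longrightarrow> h < d \<Longrightarrow>
       norm (integral (cbox x (x + h *\<^sub>R One)) W /\<^sub>R h ^ DIM(real^'n) - W x) < \<bar>W x\<bar>"
      using N(2)[OF x(2), of "\<bar>W x\<bar>"] by auto
    have "((\<lambda>h. x + h *\<^sub>R One) \<longlongrightarrow> x + 0 *\<^sub>R One) (at_right 0)"
      by (intro tendsto_intros)
    then have "\<forall>\<^sub>F h in at_right 0. x + h *\<^sub>R One \<in> box a b"
      using x(1) by (intro topological_tendstoD) auto
    moreover have "\<forall>\<^sub>F h in at_right 0. 0 < h \<and> h < d"
      using d(1) by (intro eventually_at_rightI[of 0 d]) auto
    ultimately obtain h where h: "x + h *\<^sub>R One \<in> box a b" "0 < h" "h < d"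
      using eventually_happens'[OF trivial_limit_at_right_real eventually_conj] by blast
    have "cbox x (x + h *\<^sub>R One) \<subseteq> box a b"
      using x(1) h(1) by (force simp: mem_box)
    from box0[OF this] d(2)[OF h(2,3)] show False by simp
  qed
  have "AE x in lebesgue. x \<notin> N" using N(1) by (intro AE_not_in) (simp add: negligible_iff_null_sets)
  then have "AE x in lborel. x \<notin> N" by (simp add: AE_completion_iff)
  then show ?thesis by eventually_elim (use zero in auto)
qed

section \<open>Translations and Fubini\<close>

lemma lborel_integral_translate:
  fixes f :: "'a::euclidean_space \<Rightarrow> real"
  assumes [measurable]: "f \<in> borel_measurable borel"
  shows "(\<integral>x. f (x + v) \<partial>lborel) = (\<integral>x. f x \<partial>lborel)"
proof -
  have "(\<integral>x. f x \<partial>lborel) = (\<integral>x. f x \<partial>distr lborel borel ((+) v))" by (simp add: lborel_distr_plus)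
  also have "\<dots> = (\<integral>x. f (v + x) \<partial>lborel)" by (rule integral_distr) auto
  finally show ?thesis by (simp add: add.commute)
qed

lemma lborel_integrable_translate:
  fixes f :: "'a::euclidean_space \<Rightarrow> real"
  assumes "integrable lborel f"
  shows "integrable lborel (\<lambda>x. f (x + v))"
proof -
  have [measurable]: "f \<in> borel_measurable borel" using assms by auto
  have "integrable (distr lborel borel ((+) v)) f" using assms by (simp add: lborel_distr_plus)
  then have "integrable lborel (\<lambda>x. f (v + x))" by (subst (asm) integrable_distr_eq) auto
  then show ?thesis by (simp add: add.commute)
qed

lemma nn_integral_lborel_translate:
  fixes f :: "'a::euclidean_space \<Rightarrow> ennreal"
  assumes [measurable]: "f \<in> borel_measurable borel"
  shows "(\<integral>\<^sup>+x. f (x + v) \<partial>lborel) = (\<integral>\<^sup>+x. f x \<partial>lborel)"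
proof -
  have "(\<integral>\<^sup>+x. f x \<partial>lborel) = (\<integral>\<^sup>+x. f x \<partial>distr lborel borel ((+) v))" by (simp add: lborel_distr_plus)
  also have "\<dots> = (\<integral>\<^sup>+x. f (v + x) \<partial>lborel)" by (rule nn_integral_distr) auto
  finally show ?thesis by (simp add: add.commute)
qed

text \<open>By translation invariance the inner integral of the absolute value does not depend on
  \<open>t\<close>, so its integral over the unit interval is finite. This permits exchanging
  \<open>t\<close> and \<open>y\<close> in signed integrals.\<close>

lemma integrable_pair_translate:
  fixes h :: "'a::euclidean_space \<Rightarrow> real"
  assumes "integrable lborel h"
  shows "integrable (lborel \<Otimes>\<^sub>M lborel) (\<lambda>(t::real, y). indicator {0..1} t * h (y + t *\<^sub>R v))"
proof (rule lborel_pair.Fubini_integrable)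
  have [measurable]: "h \<in> borel_measurable borel" using assms by auto
  show "(\<lambda>(t::real, y). indicator {0..1} t * h (y + t *\<^sub>R v)) \<in> borel_measurable (lborel \<Otimes>\<^sub>M lborel)"
    by measurable
  have "(\<integral>y. norm (case (t, y) of (t::real, y) \<Rightarrow> indicator {0..1} t * h (y + t *\<^sub>R v)) \<partial>lborel)
      = indicator {0..1} t * (\<integral>y. \<bar>h y\<bar> \<partial>lborel)" for t :: real
    using lborel_integral_translate[of "\<lambda>y. \<bar>h y\<bar>" "t *\<^sub>R v"] by (simp add: abs_mult)
  then show "integrable lborel (\<lambda>t. \<integral>y. norm (case (t, y) of (t::real, y) \<Rightarrow> indicator {0..1} t * h (y + t *\<^sub>R v)) \<partial>lborel)"
    by (simp add: integrable_real_mult_indicator mult.commute)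
  show "AE t in lborel. integrable lborel (\<lambda>y. case (t, y) of (t::real, y) \<Rightarrow> indicator {0..1} t * h (y + t *\<^sub>R v))"
    using lborel_integrable_translate[OF assms] by simp
qed

lemma test_function_translate:
  assumes "test_function A \<phi>" "\<And>x. x \<in> A \<Longrightarrow> x + w \<in> B"
  shows "test_function B (\<lambda>x. \<phi> (x - w))"
proof -
  have "{x. \<phi> (x - w) \<noteq> 0} = (+) w ` {x. \<phi> x \<noteq> 0}"
    by (auto simp: image_iff) (metis add.commute diff_add_cancel)
  then have t: "tsupp (\<lambda>x. \<phi> (x - w)) = (+) w ` tsupp \<phi>"
    by (simp add: tsupp_def closure_translation)
  have "smooth (\<lambda>x. \<phi> (x - w))" using assms(1) Ck_translate by (auto simp: smooth_def test_function_def)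
  moreover have "compact (tsupp (\<lambda>x. \<phi> (x - w)))"
    unfolding t using assms(1) by (intro compact_translation) (simp add: test_function_def)
  moreover have "tsupp (\<lambda>x. \<phi> (x - w)) \<subseteq> B"
    unfolding t using assms by (auto simp: test_function_def add.commute)
  ultimately show ?thesis by (simp add: test_function_def)
qed

text \<open>The fundamental theorem of calculus along the segment from \<open>y\<close> to
  \<open>y + v\<close>; the null set depends on \<open>v\<close>. Under a test function \<phi> the
  shift by \<open>t *\<^sub>R v\<close> moves onto \<phi>, the weak derivative becomes a classical
  derivative of \<phi>, and its integral over \<open>t\<close> is elementary. The fundamental lemma
  then removes \<phi>.\<close>

lemma ae_difference_eq_line_integral:
  fixes u :: "real^'n::finite \<Rightarrow> real" and g :: "'n \<Rightarrow> real^'n \<Rightarrow> real"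
  assumes u: "integrable lborel u" and g: "\<And>i. integrable lborel (g i)"
    and weak: "\<And>i \<phi>. test_function (box a b) \<phi> \<Longrightarrow>
      (\<integral>x. u x * partial_deriv i \<phi> x \<partial>lborel) = - (\<integral>x. g i x * \<phi> x \<partial>lborel)"
  shows "AE y in lborel. y \<in> box a b \<and> y + v \<in> box a b \<longrightarrow>
    u (y + v) - u y = (\<integral>t. indicator {0..1} t * (\<Sum>i\<in>UNIV. v $ i * g i (y + t *\<^sub>R v)) \<partial>lborel)"
proof -
  have [measurable]: "u \<in> borel_measurable borel" "\<And>i. g i \<in> borel_measurable borel" using u g by auto
  \<comment> \<open>The corners of the intersection of \<open>box a b\<close> with its translate by
    \<open>- v\<close>, that is, of the set of \<open>y\<close> for which the claim says
    something.\<close>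
  define a' b' where "a' = (\<chi> i. max (a $ i) (a $ i - v $ i))" and "b' = (\<chi> i. min (b $ i) (b $ i - v $ i))"
  have box': "y \<in> box a' b' \<longleftrightarrow> y \<in> box a b \<and> y + v \<in> box a b" for y
    by (auto simp: a'_def b'_def mem_box_cart algebra_simps)
  define h where "h y = (\<Sum>i\<in>UNIV. v $ i * g i y)" for y
  define F where "F y = (\<integral>t. indicator {0..1} t * h (y + t *\<^sub>R v) \<partial>lborel)" for y
  have h: "integrable lborel h" unfolding h_def using g by auto
  then have [measurable]: "h \<in> borel_measurable borel" by auto
  note hp = integrable_pair_translate[OF h, of v]
  have F: "integrable lborel F"
    unfolding F_def by (rule lborel_pair.integrable_snd[OF hp])
  have "AE y in lborel. y \<in> box a' b' \<longrightarrow> u (y + v) - u y - F y = 0"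
  proof (rule ae_zero_of_test_functions)
    show "integrable lborel (\<lambda>y. u (y + v) - u y - F y)"
      using u F by (intro Bochner_Integration.integrable_diff lborel_integrable_translate)
  next
    fix \<phi> assume \<phi>: "test_function (box a' b') \<phi>"
    let ?d = "\<lambda>i. partial_deriv i \<phi>"
    let ?dv = "\<lambda>x. \<Sum>i\<in>UNIV. v $ i * ?d i x"
    have [measurable]: "\<phi> \<in> borel_measurable borel" "?d i \<in> borel_measurable borel" for i
      using test_function_borel[OF \<phi>] test_function_borel[OF test_function_partial_deriv[OF \<phi>]] .
    obtain B where B: "\<And>x. \<bar>\<phi> x\<bar> \<le> B" using test_function_bounded[OF \<phi>] by blast
    have sm: "smooth \<phi>" using \<phi> by (simp add: test_function_def)
    \<comment> \<open>Convexity keeps every intermediate translate of the support inside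
      \<open>box a b\<close>, so the weak derivative may be tested against each of them.\<close>
    have tr: "test_function (box a b) (\<lambda>x. \<phi> (x - t *\<^sub>R v))" if "0 \<le> t" "t \<le> 1" for t
    proof (rule test_function_translate[OF \<phi>])
      fix x assume "x \<in> box a' b'"
      then have "(1 - t) *\<^sub>R x + t *\<^sub>R (x + v) \<in> box a b"
        using that by (intro convexD_alt[OF convex_box(2)]) (auto simp: box')
      then show "x + t *\<^sub>R v \<in> box a b" by (simp add: algebra_simps)
    qed
    have inner: "(\<integral>y. h (y + t *\<^sub>R v) * \<phi> y \<partial>lborel) = - (\<integral>w. u w * ?dv (w - t *\<^sub>R v) \<partial>lborel)"
      if t: "0 \<le> t" "t \<le> 1" for t
    proof -
      have "(\<integral>y. h (y + t *\<^sub>R v) * \<phi> y \<partial>lborel) = (\<integral>w. h w * \<phi> (w - t *\<^sub>R v) \<partial>lborel)"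
        using lborel_integral_translate[of "\<lambda>w. h w * \<phi> (w - t *\<^sub>R v)" "t *\<^sub>R v"] by simp
      also have "\<dots> = (\<Sum>i\<in>UNIV. v $ i * (\<integral>w. g i w * \<phi> (w - t *\<^sub>R v) \<partial>lborel))"
        using integrable_mult_test_function[OF g tr[OF t]]
        by (simp add: h_def sum_distrib_right mult.assoc)
      also have "\<dots> = (\<Sum>i\<in>UNIV. v $ i * - (\<integral>w. u w * ?d i (w - t *\<^sub>R v) \<partial>lborel))"
        using weak[OF tr[OF t]] partial_deriv_translate[OF sm] by simp
      also have "\<dots> = - (\<integral>w. u w * ?dv (w - t *\<^sub>R v) \<partial>lborel)"
      proof -
        have eq: "(\<lambda>w. u w * ?dv (w - t *\<^sub>R v)) = (\<lambda>w. \<Sum>i\<in>UNIV. v $ i * (u w * ?d i (w - t *\<^sub>R v)))"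
          by (simp add: fun_eq_iff sum_distrib_left mult.left_commute)
        show ?thesis
          unfolding eq
          using integrable_mult_test_function[OF u test_function_partial_deriv[OF tr[OF t]]] partial_deriv_translate[OF sm]
          by (simp add: sum_negf)
      qed
      finally show ?thesis .
    qed
    have ftc: "(\<integral>t. indicator {0..1} t * ?dv (w - t *\<^sub>R v) \<partial>lborel) = \<phi> w - \<phi> (w - v)" for w
    proof -
      have "Ck (Suc 0) \<phi>" using sm unfolding smooth_def by blast
      note D = Ck_Suc_has_derivative[OF this]
      have deriv: "((\<lambda>t. - \<phi> (w - t *\<^sub>R v)) has_real_derivative ?dv (w - t *\<^sub>R v)) (at t)" for t
      proof -
        have "((\<lambda>t. \<phi> (w - t *\<^sub>R v)) has_derivative (\<lambda>s. \<Sum>i\<in>UNIV. (- (s *\<^sub>R v)) $ i * ?d i (w - t *\<^sub>R v))) (at t)"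
          by (rule has_derivative_compose[OF _ D]) (auto intro!: derivative_eq_intros)
        then have "((\<lambda>t. - \<phi> (w - t *\<^sub>R v)) has_derivative (\<lambda>s. - (\<Sum>i\<in>UNIV. (- (s *\<^sub>R v)) $ i * ?d i (w - t *\<^sub>R v)))) (at t)"
          by (rule has_derivative_minus)
        then show ?thesis
          unfolding has_field_derivative_def
          by (rule has_derivative_eq_rhs) (simp add: fun_eq_iff sum_negf sum_distrib_left mult_ac)
      qed
      have cont: "continuous_on UNIV (?d i)" for i
        by (rule test_function_continuous[OF test_function_partial_deriv[OF \<phi>]])
      have "(\<integral>t. ?dv (w - t *\<^sub>R v) * indicator {0..1} t \<partial>lborel) = - \<phi> (w - 1 *\<^sub>R v) - - \<phi> (w - 0 *\<^sub>R v)"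
        by (rule integral_FTC_Icc_real[where F="\<lambda>t. - \<phi> (w - t *\<^sub>R v)"])
           (auto intro!: deriv continuous_on_interior[of UNIV] continuous_intros continuous_on_compose2[OF cont])
      then show ?thesis by (simp add: mult.commute)
    qed
    have "(\<integral>y. F y * \<phi> y \<partial>lborel) = (\<integral>y. (\<integral>t. indicator {0..1} t * h (y + t *\<^sub>R v) * \<phi> y \<partial>lborel) \<partial>lborel)"
      by (simp add: F_def)
    also have "\<dots> = (\<integral>t. (\<integral>y. indicator {0..1} t * h (y + t *\<^sub>R v) * \<phi> y \<partial>lborel) \<partial>lborel)"
    proof (rule lborel_pair.Fubini_integral)
      have "integrable (lborel \<Otimes>\<^sub>M lborel) (\<lambda>p. (case p of (t, y) \<Rightarrow> indicator {0..1} t * h (y + t *\<^sub>R v)) * \<phi> (snd p))"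
        by (rule integrable_mult_bounded[OF hp, where B=B]) (use B in auto)
      then show "integrable (lborel \<Otimes>\<^sub>M lborel) (\<lambda>(t, y). indicator {0..1} t * h (y + t *\<^sub>R v) * \<phi> y)"
        by (simp add: case_prod_unfold)
    qed
    also have "\<dots> = (\<integral>t. (\<integral>w. - (indicator {0..1} t * u w * ?dv (w - t *\<^sub>R v)) \<partial>lborel) \<partial>lborel)"
    proof (rule Bochner_Integration.integral_cong[OF refl])
      fix t :: real
      show "(\<integral>y. indicator {0..1} t * h (y + t *\<^sub>R v) * \<phi> y \<partial>lborel) =
          (\<integral>w. - (indicator {0..1} t * u w * ?dv (w - t *\<^sub>R v)) \<partial>lborel)"
        using inner[of t] by (cases "t \<in> {0..1}") simp_all
    qed
    also have "\<dots> = - (\<integral>t. (\<integral>w. indicator {0..1} t * u w * ?dv (w - t *\<^sub>R v) \<partial>lborel) \<partial>lborel)"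
      by simp
    also have "(\<integral>t. (\<integral>w. indicator {0..1} t * u w * ?dv (w - t *\<^sub>R v) \<partial>lborel) \<partial>lborel)
        = (\<integral>w. (\<integral>t. indicator {0..1} t * u w * ?dv (w - t *\<^sub>R v) \<partial>lborel) \<partial>lborel)"
    proof (rule lborel_pair.Fubini_integral[symmetric])
      have "\<exists>B. \<forall>x. \<bar>?d i x\<bar> \<le> B" for i
        using test_function_bounded[OF test_function_partial_deriv[OF \<phi>]] by metis
      then obtain C where C: "\<And>i x. \<bar>?d i x\<bar> \<le> C i" by metis
      have "\<bar>?dv x\<bar> \<le> (\<Sum>i\<in>UNIV. \<bar>v $ i\<bar> * C i)" for x
        by (rule order_trans[OF sum_abs]) (auto intro!: sum_mono mult_left_mono C simp: abs_mult)
      then have "integrable (lborel \<Otimes>\<^sub>M lborel) (\<lambda>p. (case p of (t::real, y) \<Rightarrow> indicator {0..1} t * u (y + t *\<^sub>R 0)) * ?dv (snd p - fst p *\<^sub>R v))"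
        by (intro integrable_mult_bounded[OF integrable_pair_translate[OF u]]) auto
      then show "integrable (lborel \<Otimes>\<^sub>M lborel) (\<lambda>(t, w). indicator {0..1} t * u w * ?dv (w - t *\<^sub>R v))"
        by (simp add: case_prod_unfold)
    qed
    also have "\<dots> = (\<integral>w. u w * (\<integral>t. indicator {0..1} t * ?dv (w - t *\<^sub>R v) \<partial>lborel) \<partial>lborel)"
      by (simp add: mult.assoc mult.left_commute[of _ "u _"])
    also have "\<dots> = (\<integral>w. u w * \<phi> w - u w * \<phi> (w - v) \<partial>lborel)"
      by (simp add: ftc right_diff_distrib)
    finally have Fint: "(\<integral>y. F y * \<phi> y \<partial>lborel) = - (\<integral>w. u w * \<phi> w - u w * \<phi> (w - v) \<partial>lborel)" .
    \<comment> \<open>Shifting the variable produces the integral against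
      \<open>\<phi> (w - v)\<close> that also occurs in \<open>Fint\<close>, so the three
      contributions cancel.\<close>
    have uv: "(\<integral>y. u (y + v) * \<phi> y \<partial>lborel) = (\<integral>w. u w * \<phi> (w - v) \<partial>lborel)"
      using lborel_integral_translate[of "\<lambda>w. u w * \<phi> (w - v)" v] by simp
    have i1: "integrable lborel (\<lambda>w. u w * \<phi> (w - v))"
      using integrable_mult_test_function[OF u tr[of 1]] by simp
    have i2: "integrable lborel (\<lambda>w. u w * \<phi> w)" by (rule integrable_mult_test_function[OF u \<phi>])
    have i3: "integrable lborel (\<lambda>w. F w * \<phi> w)" by (rule integrable_mult_test_function[OF F \<phi>])
    have i4: "integrable lborel (\<lambda>y. u (y + v) * \<phi> y)"
      by (rule integrable_mult_test_function[OF lborel_integrable_translate[OF u] \<phi>])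
    have "(\<integral>y. (u (y + v) - u y - F y) * \<phi> y \<partial>lborel)
       = (\<integral>y. u (y + v) * \<phi> y \<partial>lborel) - (\<integral>y. u y * \<phi> y \<partial>lborel) - (\<integral>y. F y * \<phi> y \<partial>lborel)"
      using i2 i3 i4 by (simp add: left_diff_distrib)
    also have "\<dots> = 0" unfolding uv Fint using i1 i2 by simp
    finally show "(\<integral>y. (u (y + v) - u y - F y) * \<phi> y \<partial>lborel) = 0" .
  qed
  then show ?thesis by eventually_elim (auto simp: box' F_def h_def)
qed

section \<open>The Poincare inequality on cubes\<close>

text \<open>The point \<open>x\<close> is the lower corner, not the centre: such cubes are nested,
  halving preserves the corner, and Lebesgue differentiation is available along them. For densities
  at \<open>x\<close> it suffices that they lie in balls about \<open>x\<close> of comparable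
  radius.\<close>

definition cube :: "real^'n::finite \<Rightarrow> real \<Rightarrow> (real^'n) set" where
  "cube x r = box x (\<chi> i. x $ i + r)"

lemma mem_cube: "y \<in> cube x r \<longleftrightarrow> (\<forall>i. x $ i < y $ i \<and> y $ i < x $ i + r)"
  by (auto simp: cube_def mem_box_cart)

lemma cube_borel [measurable, simp]: "cube x r \<in> sets borel"
  by (simp add: cube_def)

lemma emeasure_cube:
  fixes x :: "real^'n::finite"
  assumes "0 \<le> r" shows "emeasure lborel (cube x r) = ennreal (r ^ CARD('n))"
proof -
  have "emeasure lborel (cube x r) = emeasure lborel (cbox x (\<chi> i. x $ i + r))"
    unfolding cube_def emeasure_lborel_box_eq emeasure_lborel_cbox_eq ..
  also have "\<dots> = ennreal (measure lborel (cbox x (\<chi> i. x $ i + r)))"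
    by (rule emeasure_eq_ennreal_measure) (simp add: emeasure_lborel_cbox_eq)
  also have "measure lborel (cbox x (\<chi> i. x $ i + r)) = r ^ CARD('n)"
    using assms by (subst content_cbox_cart) (simp_all add: interval_ne_empty_cart)
  finally show ?thesis .
qed

lemma cube_mono: "r \<le> s \<Longrightarrow> cube x r \<subseteq> cube x s"
proof
  fix y assume "r \<le> s" "y \<in> cube x r"
  then have "x $ i < y $ i \<and> y $ i < x $ i + s" for i
    using mem_cube[of y x r] by (metis add_left_mono less_le_trans)
  then show "y \<in> cube x s" by (simp add: mem_cube)
qed

text \<open>With \<open>w = y + v\<close> the difference is a line integral of the gradient. For
  fixed \<open>v\<close> and \<open>t\<close>, translating \<open>y\<close> bounds the inner
  integral by that of the gradient over the whole cube. What remains is the volume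
  \<open>(2 * r)^n\<close> of possible displacements and the bound \<open>r\<close> on their
  coordinates. Nonnegative integrals make the exchanges unconditional.\<close>

lemma cube_poincare_double:
  fixes u :: "real^'n::finite \<Rightarrow> real" and g :: "'n \<Rightarrow> real^'n \<Rightarrow> real"
  assumes u: "integrable lborel u" and g: "\<And>i. integrable lborel (g i)"
    and weak: "\<And>i \<phi>. test_function (cube x r) \<phi> \<Longrightarrow>
      (\<integral>x. u x * partial_deriv i \<phi> x \<partial>lborel) = - (\<integral>x. g i x * \<phi> x \<partial>lborel)"
    and r: "0 < r"
  shows "(\<integral>\<^sup>+y\<in>cube x r. (\<integral>\<^sup>+w\<in>cube x r. ennreal \<bar>u y - u w\<bar> \<partial>lborel) \<partial>lborel)
    \<le> ennreal ((2 * r) ^ CARD('n) * r) * (\<integral>\<^sup>+y\<in>cube x r. ennreal (\<Sum>i\<in>UNIV. \<bar>g i y\<bar>) \<partial>lborel)"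
proof -
  let ?Q = "cube x r"
  let ?G = "\<lambda>y. \<Sum>i\<in>UNIV. \<bar>g i y\<bar>"
  have [measurable]: "u \<in> borel_measurable borel" "\<And>i. g i \<in> borel_measurable borel" using u g by auto
  \<comment> \<open>Two points of a cube of side \<open>r\<close> differ by less than
    \<open>r\<close> in each coordinate; these displacements form the cube of side
    \<open>2 * r\<close> with lower corner at \<open>- r\<close>.\<close>
  let ?V = "cube (\<chi> i. - r) (2 * r) :: (real^'n) set"
  let ?I = "\<integral>\<^sup>+y. ennreal (?G y) * indicator ?Q y \<partial>lborel"
  let ?k = "\<lambda>v y. ennreal \<bar>u y - u (y + v)\<bar> * indicator ?Q (y + v) * indicator ?Q y"
  have bound: "(\<integral>\<^sup>+y. ?k v y \<partial>lborel) \<le> ennreal r * ?I * indicator ?V v" for v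
  proof (cases "v \<in> ?V")
    case False
    have "y \<notin> ?Q \<or> y + v \<notin> ?Q" for y
    proof (rule ccontr)
      assume "\<not> ?thesis"
      then have "\<forall>i. - r < v $ i \<and> v $ i < r" by (auto simp: mem_cube) (smt (verit))+
      with False show False by (auto simp: mem_cube)
    qed
    then have "?k v y = 0" for y by (auto simp: indicator_def)
    then show ?thesis by (simp only: nn_integral_const) simp
  next
    case True
    have vi: "\<bar>v $ i\<bar> \<le> r" for i
    proof -
      have "- r < v $ i \<and> v $ i < - r + 2 * r" using True by (simp add: mem_cube)
      then show ?thesis by linarith
    qed
    have "(\<integral>\<^sup>+y. ?k v y \<partial>lborel) \<le>
      (\<integral>\<^sup>+y. (\<integral>\<^sup>+t. ennreal r * (ennreal (?G (y + t *\<^sub>R v)) * indicator ?Q (y + t *\<^sub>R v)) * indicator {0..1} t \<partial>lborel) \<partial>lborel)"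
    proof (rule nn_integral_mono_AE)
      have ae: "AE y in lborel. y \<in> box x (\<chi> i. x $ i + r) \<and> y + v \<in> box x (\<chi> i. x $ i + r) \<longrightarrow>
          u (y + v) - u y = (\<integral>t. indicator {0..1} t * (\<Sum>i\<in>UNIV. v $ i * g i (y + t *\<^sub>R v)) \<partial>lborel)"
        by (rule ae_difference_eq_line_integral[OF u g]) (rule weak[unfolded cube_def])
      show "AE y in lborel. ?k v y \<le>
        (\<integral>\<^sup>+t. ennreal r * (ennreal (?G (y + t *\<^sub>R v)) * indicator ?Q (y + t *\<^sub>R v)) * indicator {0..1} t \<partial>lborel)"
        using ae
      proof eventually_elim
        fix y
        assume *: "y \<in> box x (\<chi> i. x $ i + r) \<and> y + v \<in> box x (\<chi> i. x $ i + r) \<longrightarrow>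
          u (y + v) - u y = (\<integral>t. indicator {0..1} t * (\<Sum>i\<in>UNIV. v $ i * g i (y + t *\<^sub>R v)) \<partial>lborel)"
        show "?k v y \<le> (\<integral>\<^sup>+t. ennreal r * (ennreal (?G (y + t *\<^sub>R v)) * indicator ?Q (y + t *\<^sub>R v)) * indicator {0..1} t \<partial>lborel)"
        proof (cases "y \<in> ?Q \<and> y + v \<in> ?Q")
          case True
          let ?f = "\<lambda>t. indicator {0..1} t * (\<Sum>i\<in>UNIV. v $ i * g i (y + t *\<^sub>R v))"
          have seg: "y + t *\<^sub>R v \<in> ?Q" if "0 \<le> t" "t \<le> 1" for t
          proof -
            have "(1 - t) *\<^sub>R y + t *\<^sub>R (y + v) \<in> ?Q"
              using that True unfolding cube_def by (intro convexD_alt[OF convex_box(2)]) auto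
            then show ?thesis by (simp add: algebra_simps)
          qed
          have "?k v y = ennreal (norm (\<integral>t. ?f t \<partial>lborel))"
            using True * by (simp add: cube_def abs_minus_commute)
          \<comment> \<open>If the integrand is not integrable on this segment, its integral is 0 by
            convention and the bound is trivial.\<close>
          also have "\<dots> \<le> (\<integral>\<^sup>+t. norm (?f t) \<partial>lborel)"
          proof (cases "integrable lborel ?f")
            case True
            then show ?thesis by (rule integral_norm_bound_ennreal)
          qed (simp add: not_integrable_integral_eq)
          also have "\<dots> \<le> (\<integral>\<^sup>+t. ennreal r * (ennreal (?G (y + t *\<^sub>R v)) * indicator ?Q (y + t *\<^sub>R v)) * indicator {0..1} t \<partial>lborel)"
          proof (rule nn_integral_mono)
            fix t :: real
            have "\<bar>\<Sum>i\<in>UNIV. v $ i * g i (y + t *\<^sub>R v)\<bar> \<le> (\<Sum>i\<in>UNIV. r * \<bar>g i (y + t *\<^sub>R v)\<bar>)"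
              by (rule order_trans[OF sum_abs]) (auto simp: abs_mult intro!: sum_mono mult_right_mono vi)
            then have "ennreal \<bar>\<Sum>i\<in>UNIV. v $ i * g i (y + t *\<^sub>R v)\<bar> \<le> ennreal r * ennreal (?G (y + t *\<^sub>R v))"
              using r by (simp add: sum_distrib_left ennreal_mult[symmetric] sum_nonneg ennreal_leI)
            then show "ennreal (norm (?f t)) \<le> ennreal r * (ennreal (?G (y + t *\<^sub>R v)) * indicator ?Q (y + t *\<^sub>R v)) * indicator {0..1} t"
              using seg[of t] by (cases "t \<in> {0..1}") auto
          qed
          finally show ?thesis .
        qed auto
      qed
    qed
    also have "\<dots> = (\<integral>\<^sup>+t. (\<integral>\<^sup>+y. ennreal r * (ennreal (?G (y + t *\<^sub>R v)) * indicator ?Q (y + t *\<^sub>R v)) * indicator {0..1} t \<partial>lborel) \<partial>lborel)"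
      by (rule lborel_pair.Fubini') measurable
    also have "\<dots> = (\<integral>\<^sup>+t. ennreal r * ?I * indicator {0..1::real} t \<partial>lborel)"
    proof (rule nn_integral_cong)
      fix t :: real
      show "(\<integral>\<^sup>+y. ennreal r * (ennreal (?G (y + t *\<^sub>R v)) * indicator ?Q (y + t *\<^sub>R v)) * indicator {0..1} t \<partial>lborel)
          = ennreal r * ?I * indicator {0..1::real} t"
        using nn_integral_lborel_translate[of "\<lambda>y. ennreal (?G y) * indicator ?Q y" "t *\<^sub>R v"]
        by (simp add: nn_integral_cmult nn_integral_multc)
    qed
    also have "\<dots> = ennreal r * ?I" by (simp add: nn_integral_cmult_indicator)
    finally show ?thesis using True by simp
  qed
  have "(\<integral>\<^sup>+y\<in>?Q. (\<integral>\<^sup>+w\<in>?Q. ennreal \<bar>u y - u w\<bar> \<partial>lborel) \<partial>lborel)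
      = (\<integral>\<^sup>+y. (\<integral>\<^sup>+v. ?k v y \<partial>lborel) \<partial>lborel)"
  proof (rule nn_integral_cong)
    fix y
    show "(\<integral>\<^sup>+w\<in>?Q. ennreal \<bar>u y - u w\<bar> \<partial>lborel) * indicator ?Q y = (\<integral>\<^sup>+v. ?k v y \<partial>lborel)"
      using nn_integral_lborel_translate[of "\<lambda>w. ennreal \<bar>u y - u w\<bar> * indicator ?Q w" y]
      by (simp add: nn_integral_multc add.commute)
  qed
  also have "\<dots> = (\<integral>\<^sup>+v. (\<integral>\<^sup>+y. ?k v y \<partial>lborel) \<partial>lborel)"
    by (rule lborel_pair.Fubini') measurable
  also have "\<dots> \<le> (\<integral>\<^sup>+v. ennreal r * ?I * indicator ?V v \<partial>lborel)"
    by (rule nn_integral_mono) (rule bound)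
  also have "\<dots> = ennreal r * ?I * ennreal ((2 * r) ^ CARD('n))"
    using r by (simp add: nn_integral_cmult_indicator emeasure_cube)
  also have "\<dots> = ennreal ((2 * r) ^ CARD('n) * r) * ?I"
    using r by (simp add: ennreal_mult mult_ac)
  finally show ?thesis .
qed

text \<open>The comparison sequence \<open>e\<close> decreases by exactly
  \<open>B * \<theta> ^ k\<close> at each step, so differences of \<open>m\<close> are bounded by
  telescoping differences of \<open>e\<close> and no series has to be summed.\<close>

lemma geometric_increments_limit:
  fixes m :: "nat \<Rightarrow> real"
  assumes step: "\<And>k. \<bar>m (Suc k) - m k\<bar> \<le> B * \<theta> ^ k" and \<theta>: "0 < \<theta>" "\<theta> < 1"
  obtains A where "\<And>k. \<bar>m k - A\<bar> \<le> B / (1 - \<theta>) * \<theta> ^ k"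
proof -
  define e where "e k = B / (1 - \<theta>) * \<theta> ^ k" for k
  have B: "0 \<le> B" using step[of 0] by simp
  have e0: "0 \<le> e k" for k using B \<theta> by (simp add: e_def)
  have e_step: "e k - e (Suc k) = B * \<theta> ^ k" for k
  proof -
    have "e k - e (Suc k) = B / (1 - \<theta>) * (1 - \<theta>) * \<theta> ^ k"
      unfolding e_def by (simp only: right_diff_distrib left_diff_distrib power_Suc mult_1_right mult_ac)
    then show ?thesis using \<theta> by simp
  qed
  have tail: "\<bar>m (k + j) - m k\<bar> \<le> e k - e (k + j)" for k j
  proof (induction j)
    case (Suc j)
    then show ?case using step[of "k + j"] e_step[of "k + j"] by simp
  qed simp
  then have tail': "\<bar>m (k + j) - m k\<bar> \<le> e k" for k j using e0[of "k + j"] by (meson diff_left_mono diff_ge_0_iff_ge order_trans le_add_same_cancel1 diff_le_eq)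
  have e_lim: "e \<longlonglongrightarrow> 0"
    unfolding e_def using \<theta> by (intro tendsto_mult_right_zero LIMSEQ_power_zero) auto
  have "Cauchy m"
  proof (rule CauchyI)
    fix \<epsilon> :: real assume "0 < \<epsilon>"
    then have "\<forall>\<^sub>F k in sequentially. e k < \<epsilon> / 2" using e_lim by (intro order_tendstoD) auto
    then obtain N where N: "e N < \<epsilon> / 2" by (auto simp: eventually_sequentially)
    have "norm (m i - m j) < \<epsilon>" if "i \<ge> N" "j \<ge> N" for i j
      using tail'[of N "i - N"] tail'[of N "j - N"] that N by simp
    then show "\<exists>M. \<forall>i\<ge>M. \<forall>j\<ge>M. norm (m i - m j) < \<epsilon>" by blast
  qed
  then obtain A where A: "m \<longlonglongrightarrow> A" using real_Cauchy_convergent convergent_def by blast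
  have "\<bar>m k - A\<bar> \<le> e k" for k
  proof (rule LIMSEQ_le_const2)
    show "(\<lambda>j. \<bar>m k - m j\<bar>) \<longlonglongrightarrow> \<bar>m k - A\<bar>" by (intro tendsto_intros A)
    have "\<bar>m k - m j\<bar> \<le> e k" if "k \<le> j" for j using tail'[of k "j - k"] that by simp
    then show "\<exists>N. \<forall>j\<ge>N. \<bar>m k - m j\<bar> \<le> e k" by blast
  qed
  then show ?thesis unfolding e_def by (rule that)
qed

definition cube_avg :: "(real^'n::finite \<Rightarrow> real) \<Rightarrow> real^'n \<Rightarrow> real \<Rightarrow> real" where
  "cube_avg u x r = (\<integral>y\<in>cube x r. u y \<partial>lborel) / r ^ CARD('n)"

lemma cube_avg_diff_le:
  fixes u :: "real^'n::finite \<Rightarrow> real"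
  assumes u: "integrable lborel u" and r: "0 < r"
  shows "ennreal \<bar>c - cube_avg u x r\<bar> \<le> ennreal (1 / r ^ CARD('n)) * (\<integral>\<^sup>+w\<in>cube x r. ennreal \<bar>c - u w\<bar> \<partial>lborel)"
proof -
  have m: "measure lborel (cube x r) = r ^ CARD('n)" and e: "emeasure lborel (cube x r) < \<infinity>"
    using r by (auto simp: emeasure_cube measure_def)
  have s: "set_integrable lborel (cube x r) u"
    unfolding set_integrable_def using u by (intro integrable_mult_indicator) auto
  have c: "set_integrable lborel (cube x r) (\<lambda>_. c)" using e by (auto simp: set_integrable_def)
  have cs: "set_integrable lborel (cube x r) (\<lambda>w. c - u w)" by (rule set_integral_diff(1)[OF c s])
  have "c - cube_avg u x r = 1 / r ^ CARD('n) * (\<integral>w\<in>cube x r. (c - u w) \<partial>lborel)"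
    using r unfolding cube_avg_def set_integral_diff(2)[OF c s]
    by (simp add: set_lebesgue_integral_def m field_simps)
  then have "ennreal \<bar>c - cube_avg u x r\<bar> = ennreal (1 / r ^ CARD('n)) * ennreal (norm (\<integral>w\<in>cube x r. (c - u w) \<partial>lborel))"
    using r by (simp add: abs_mult ennreal_mult[symmetric])
  also have "\<dots> \<le> ennreal (1 / r ^ CARD('n)) * (\<integral>\<^sup>+w. norm (indicator (cube x r) w *\<^sub>R (c - u w)) \<partial>lborel)"
    unfolding set_lebesgue_integral_def
    by (intro mult_left_mono integral_norm_bound_ennreal cs[unfolded set_integrable_def]) simp
  also have "(\<integral>\<^sup>+w. norm (indicator (cube x r) w *\<^sub>R (c - u w)) \<partial>lborel) = (\<integral>\<^sup>+w\<in>cube x r. ennreal \<bar>c - u w\<bar> \<partial>lborel)"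
    by (intro nn_integral_cong) (simp add: indicator_def)
  finally show ?thesis .
qed

text \<open>Averaging the double integral over the second point divides by \<open>r^n\<close>, which
  reduces \<open>(2 * r)^n * r\<close> to \<open>2^n * r\<close>.\<close>

lemma cube_oscillation_le:
  fixes u :: "real^'n::finite \<Rightarrow> real" and g :: "'n \<Rightarrow> real^'n \<Rightarrow> real" and r :: real
  assumes u: "integrable lborel u" and g: "\<And>i. integrable lborel (g i)"
    and weak: "\<And>i \<phi>. test_function (cube x r) \<phi> \<Longrightarrow>
      (\<integral>x. u x * partial_deriv i \<phi> x \<partial>lborel) = - (\<integral>x. g i x * \<phi> x \<partial>lborel)"
    and r: "0 < r"
  shows "(\<integral>\<^sup>+y\<in>cube x r. ennreal \<bar>u y - cube_avg u x r\<bar> \<partial>lborel)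
    \<le> ennreal (2 ^ CARD('n) * r) * (\<integral>\<^sup>+y\<in>cube x r. ennreal (\<Sum>i\<in>UNIV. \<bar>g i y\<bar>) \<partial>lborel)"
proof -
  let ?Q = "cube x r" and ?n = "CARD('n)"
  let ?I = "\<integral>\<^sup>+y\<in>?Q. ennreal (\<Sum>i\<in>UNIV. \<bar>g i y\<bar>) \<partial>lborel"
  have [measurable]: "u \<in> borel_measurable borel" using u by auto
  have "(\<integral>\<^sup>+y\<in>?Q. ennreal \<bar>u y - cube_avg u x r\<bar> \<partial>lborel) \<le>
    (\<integral>\<^sup>+y\<in>?Q. ennreal (1 / r ^ ?n) * (\<integral>\<^sup>+w\<in>?Q. ennreal \<bar>u y - u w\<bar> \<partial>lborel) \<partial>lborel)"
    by (intro nn_integral_mono mult_right_mono cube_avg_diff_le u r) auto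
  also have "\<dots> = ennreal (1 / r ^ ?n) * (\<integral>\<^sup>+y\<in>?Q. (\<integral>\<^sup>+w\<in>?Q. ennreal \<bar>u y - u w\<bar> \<partial>lborel) \<partial>lborel)"
    by (simp add: mult.assoc nn_integral_cmult)
  also have "\<dots> \<le> ennreal (1 / r ^ ?n) * (ennreal ((2 * r) ^ ?n * r) * ?I)"
    by (intro mult_left_mono cube_poincare_double[OF u g weak r]) auto
  also have "\<dots> = ennreal (1 / r ^ ?n * ((2 * r) ^ ?n * r)) * ?I"
    using r by (simp add: mult.assoc[symmetric] ennreal_mult[symmetric])
  also have "1 / r ^ ?n * ((2 * r) ^ ?n * r) = 2 ^ ?n * r"
    using r by (simp add: power_mult_distrib)
  finally show ?thesis .
qed

text \<open>The average over the large cube is compared with \<open>u\<close> on the half cube,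
  whose volume is smaller by the factor \<open>2^n\<close>; together with the \<open>2^n\<close> of
  the oscillation bound this gives \<open>4^n\<close>.\<close>

lemma cube_avg_halve_le:
  fixes u :: "real^'n::finite \<Rightarrow> real" and g :: "'n \<Rightarrow> real^'n \<Rightarrow> real" and r :: real
  assumes u: "integrable lborel u" and g: "\<And>i. integrable lborel (g i)"
    and weak: "\<And>i \<phi>. test_function (cube x r) \<phi> \<Longrightarrow>
      (\<integral>x. u x * partial_deriv i \<phi> x \<partial>lborel) = - (\<integral>x. g i x * \<phi> x \<partial>lborel)"
    and r: "0 < r"
  shows "ennreal \<bar>cube_avg u x r - cube_avg u x (r / 2)\<bar>
    \<le> ennreal (4 ^ CARD('n) * r / r ^ CARD('n)) * (\<integral>\<^sup>+y\<in>cube x r. ennreal (\<Sum>i\<in>UNIV. \<bar>g i y\<bar>) \<partial>lborel)"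
proof -
  let ?n = "CARD('n)" and ?m = "cube_avg u x r"
  let ?I = "\<integral>\<^sup>+y\<in>cube x r. ennreal (\<Sum>i\<in>UNIV. \<bar>g i y\<bar>) \<partial>lborel"
  have "ennreal \<bar>?m - cube_avg u x (r / 2)\<bar> \<le>
      ennreal (1 / (r / 2) ^ ?n) * (\<integral>\<^sup>+w\<in>cube x (r / 2). ennreal \<bar>?m - u w\<bar> \<partial>lborel)"
    using r by (intro cube_avg_diff_le u) simp
  also have "\<dots> \<le> ennreal (1 / (r / 2) ^ ?n) * (\<integral>\<^sup>+w\<in>cube x r. ennreal \<bar>u w - ?m\<bar> \<partial>lborel)"
    using cube_mono[of "r / 2" r x] r
    by (intro mult_left_mono nn_integral_mono) (auto simp: abs_minus_commute split: split_indicator)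
  also have "\<dots> \<le> ennreal (1 / (r / 2) ^ ?n) * (ennreal (2 ^ ?n * r) * ?I)"
    by (intro mult_left_mono cube_oscillation_le[OF u g weak r]) auto
  also have "\<dots> = ennreal (1 / (r / 2) ^ ?n * (2 ^ ?n * r)) * ?I"
    using r by (simp add: mult.assoc[symmetric] ennreal_mult[symmetric])
  also have "1 / (r / 2) ^ ?n * (2 ^ ?n * r) = 4 ^ ?n * r / r ^ ?n"
    using r by (simp add: power_divide flip: power_mult_distrib)
  finally show ?thesis .
qed

lemma test_function_mono: "test_function A \<phi> \<Longrightarrow> A \<subseteq> B \<Longrightarrow> test_function B \<phi>"
  by (auto simp: test_function_def)

lemma powr_dyadic:
  assumes "0 < (R::real)" shows "(R / 2 ^ k) powr \<beta> = R powr \<beta> * ((1 / 2) powr \<beta>) ^ k"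
proof -
  have "R / 2 ^ k = R * (1 / 2) powr real k" by (simp add: powr_realpow power_divide)
  then show ?thesis using assms by (simp add: powr_mult powr_powr powr_power mult.commute)
qed

text \<open>Under Morrey growth the mean oscillation at scale \<open>r\<close> is of order
  \<open>r powr \<beta>\<close>, so successive dyadic averages differ by a geometric sequence of
  ratio \<open>(1 / 2) powr \<beta>\<close>, which is below 1 as \<beta> > 0. The limit
  \<open>A\<close> serves as the value of \<open>u\<close> at the single point
  \<open>x\<close>.\<close>

lemma dyadic_oscillation_decay:
  fixes u :: "real^'n::finite \<Rightarrow> real" and g :: "'n \<Rightarrow> real^'n \<Rightarrow> real" and R \<beta> C :: real
  assumes u: "integrable lborel u" and g: "\<And>i. integrable lborel (g i)"
    and weak: "\<And>i \<phi>. test_function (cube x R) \<phi> \<Longrightarrow>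
      (\<integral>x. u x * partial_deriv i \<phi> x \<partial>lborel) = - (\<integral>x. g i x * \<phi> x \<partial>lborel)"
    and R: "0 < R" and \<beta>: "0 < \<beta>" and C: "0 \<le> C"
    and growth: "\<And>r. 0 < r \<Longrightarrow> r \<le> R \<Longrightarrow>
      (\<integral>\<^sup>+y\<in>cube x r. ennreal (\<Sum>i\<in>UNIV. \<bar>g i y\<bar>) \<partial>lborel) \<le> ennreal (C * r powr (real CARD('n) - 1 + \<beta>))"
  obtains A C' where "0 \<le> C'"
    "\<And>k. (\<integral>\<^sup>+y\<in>cube x (R / 2 ^ k). ennreal \<bar>u y - A\<bar> \<partial>lborel) \<le> ennreal (C' * (R / 2 ^ k) powr (CARD('n) + \<beta>))"
proof -
  let ?n = "CARD('n)"
  define r where "r k = R / 2 ^ k" for k :: nat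
  have r: "0 < r k" "r k \<le> R" "r (Suc k) = r k / 2" for k
    using R by (auto simp: r_def field_simps)
  define m where "m k = cube_avg u x (r k)" for k
  have [measurable]: "u \<in> borel_measurable borel" using u by auto
  define K where "K = 2 ^ ?n * C"
  have K: "0 \<le> K" using C by (simp add: K_def)
  have osc: "(\<integral>\<^sup>+y\<in>cube x (r k). ennreal \<bar>u y - m k\<bar> \<partial>lborel) \<le> ennreal (K * r k powr (?n + \<beta>))" for k
  proof -
    have wk: "test_function (cube x R) \<phi>" if "test_function (cube x (r k)) \<phi>" for \<phi>
      using that cube_mono[OF r(2)] by (rule test_function_mono)
    have "(\<integral>\<^sup>+y\<in>cube x (r k). ennreal \<bar>u y - m k\<bar> \<partial>lborel)
        \<le> ennreal (2 ^ ?n * r k) * ennreal (C * r k powr (real ?n - 1 + \<beta>))"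
      unfolding m_def
      by (rule order_trans[OF cube_oscillation_le[OF u g weak[OF wk] r(1)] mult_left_mono[OF growth[OF r(1,2)]]]) auto
    also have "\<dots> = ennreal (K * r k powr (?n + \<beta>))"
    proof -
      have "r k * r k powr (real ?n - 1 + \<beta>) = r k powr (?n + \<beta>)"
        using r(1)[of k] by (simp add: powr_mult_base)
      then show ?thesis using r(1)[of k] C by (simp add: ennreal_mult[symmetric] K_def mult_ac)
    qed
    finally show ?thesis .
  qed
  have "\<bar>m (Suc k) - m k\<bar> \<le> 2 ^ ?n * K * R powr \<beta> * ((1 / 2) powr \<beta>) ^ k" for k
  proof -
    have wk: "test_function (cube x R) \<phi>" if "test_function (cube x (r k)) \<phi>" for \<phi>
      using that cube_mono[OF r(2)] by (rule test_function_mono)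
    have "ennreal \<bar>m k - m (Suc k)\<bar> \<le> ennreal (4 ^ ?n * r k / r k ^ ?n) * ennreal (C * r k powr (real ?n - 1 + \<beta>))"
      unfolding m_def r(3)
      by (rule order_trans[OF cube_avg_halve_le[OF u g weak[OF wk] r(1)] mult_left_mono[OF growth[OF r(1,2)]]]) auto
    also have "\<dots> = ennreal (2 ^ ?n * K * r k powr \<beta>)"
    proof -
      have "r k * r k powr (real ?n - 1 + \<beta>) = r k ^ ?n * r k powr \<beta>"
        using r(1)[of k] by (simp add: powr_mult_base powr_add powr_realpow)
      then have "4 ^ ?n * r k / r k ^ ?n * (C * r k powr (real ?n - 1 + \<beta>)) = 4 ^ ?n * C * r k powr \<beta>"
        using r(1)[of k] by (simp add: field_simps)
      also have "\<dots> = 2 ^ ?n * K * r k powr \<beta>" by (simp add: K_def flip: power_mult_distrib)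
      finally show ?thesis using r(1)[of k] C by (simp add: ennreal_mult[symmetric])
    qed
    finally have "\<bar>m k - m (Suc k)\<bar> \<le> 2 ^ ?n * K * r k powr \<beta>" using K by simp
    then show ?thesis using powr_dyadic[OF R, of k \<beta>] by (simp add: abs_minus_commute mult.assoc r_def)
  qed
  moreover have "0 < (1 / 2 :: real) powr \<beta>" "(1 / 2 :: real) powr \<beta> < 1"
    using \<beta> powr_less_mono2[of \<beta> "1/2" 1] by auto
  ultimately obtain A where A: "\<And>k. \<bar>m k - A\<bar> \<le> 2 ^ ?n * K * R powr \<beta> / (1 - (1 / 2) powr \<beta>) * ((1 / 2) powr \<beta>) ^ k"
    using geometric_increments_limit[of m "2 ^ ?n * K * R powr \<beta>" "(1 / 2) powr \<beta>"] by blast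
  \<comment> \<open>Dividing by \<open>1 - (1 / 2) powr \<beta>\<close> accounts for all later
    increments, so the distance from \<open>m k\<close> to the limit is again of order
    \<open>r k powr \<beta>\<close>.\<close>
  define L where "L = 2 ^ ?n * K / (1 - (1 / 2) powr \<beta>)"
  have L: "0 \<le> L" using K \<open>(1 / 2 :: real) powr \<beta> < 1\<close> by (simp add: L_def)
  have A': "\<bar>m k - A\<bar> \<le> L * r k powr \<beta>" for k
    using A[of k] powr_dyadic[OF R, of k \<beta>] by (simp add: L_def r_def)
  have "(\<integral>\<^sup>+y\<in>cube x (r k). ennreal \<bar>u y - A\<bar> \<partial>lborel) \<le> ennreal ((K + L) * r k powr (?n + \<beta>))" for k
  proof -
    let ?Q = "cube x (r k)"
    have "(\<integral>\<^sup>+y\<in>?Q. ennreal \<bar>u y - A\<bar> \<partial>lborel) \<le>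
      (\<integral>\<^sup>+y. ennreal \<bar>u y - m k\<bar> * indicator ?Q y + ennreal \<bar>m k - A\<bar> * indicator ?Q y \<partial>lborel)"
      by (intro nn_integral_mono) (auto simp: indicator_def ennreal_plus[symmetric] simp del: ennreal_plus intro!: ennreal_leI)
    also have "\<dots> = (\<integral>\<^sup>+y\<in>?Q. ennreal \<bar>u y - m k\<bar> \<partial>lborel) + ennreal \<bar>m k - A\<bar> * ennreal (r k ^ ?n)"
      using r(1)[of k] by (subst nn_integral_add) (auto simp: nn_integral_cmult_indicator emeasure_cube)
    also have "\<dots> \<le> ennreal (K * r k powr (?n + \<beta>)) + ennreal (L * r k powr \<beta>) * ennreal (r k ^ ?n)"
      by (intro add_mono mult_right_mono osc ennreal_leI A') auto
    also have "\<dots> = ennreal ((K + L) * r k powr (?n + \<beta>))"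
      using r(1)[of k] K L by (simp add: ennreal_mult[symmetric] ennreal_plus[symmetric] powr_add powr_realpow algebra_simps del: ennreal_plus)
    finally show ?thesis .
  qed
  then show ?thesis using that[of "K + L" A] K L by (simp add: r_def)
qed

section \<open>Perturbation of determinants\<close>

text \<open>The constant depends on the base point \<open>a\<close> alone. The restriction
  \<open>\<tau> \<le> 1\<close> bounds each perturbed factor by one more than the modulus of
  \<open>a i\<close>, which keeps the estimate linear in \<tau>.\<close>

lemma prod_perturbation:
  fixes a :: "'i \<Rightarrow> real"
  assumes "finite S"
  shows "\<exists>C\<ge>0. \<forall>b \<tau>. 0 \<le> \<tau> \<and> \<tau> \<le> 1 \<and> (\<forall>i\<in>S. \<bar>b i - a i\<bar> \<le> \<tau>) \<longrightarrow> \<bar>prod b S - prod a S\<bar> \<le> C * \<tau>"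
  using assms
proof (induction S rule: finite_induct)
  case (insert i S)
  then obtain C where C: "C \<ge> 0" "\<And>b \<tau>. 0 \<le> \<tau> \<Longrightarrow> \<tau> \<le> 1 \<Longrightarrow> (\<forall>i\<in>S. \<bar>b i - a i\<bar> \<le> \<tau>) \<Longrightarrow> \<bar>prod b S - prod a S\<bar> \<le> C * \<tau>"
    by blast
  show ?case
  proof (intro exI[of _ "(\<bar>a i\<bar> + 1) * C + \<bar>prod a S\<bar>"] conjI allI impI)
    fix b \<tau> assume *: "0 \<le> \<tau> \<and> \<tau> \<le> 1 \<and> (\<forall>j\<in>insert i S. \<bar>b j - a j\<bar> \<le> \<tau>)"
    have "prod b (insert i S) - prod a (insert i S) = b i * (prod b S - prod a S) + (b i - a i) * prod a S"
      using insert by (simp add: algebra_simps)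
    also have "\<bar>\<dots>\<bar> \<le> \<bar>b i\<bar> * \<bar>prod b S - prod a S\<bar> + \<bar>b i - a i\<bar> * \<bar>prod a S\<bar>"
      by (rule order_trans[OF abs_triangle_ineq]) (simp add: abs_mult)
    also have "\<dots> \<le> (\<bar>a i\<bar> + 1) * (C * \<tau>) + \<tau> * \<bar>prod a S\<bar>"
      using * C(1) by (intro add_mono mult_mono C(2)) auto
    finally show "\<bar>prod b (insert i S) - prod a (insert i S)\<bar> \<le> ((\<bar>a i\<bar> + 1) * C + \<bar>prod a S\<bar>) * \<tau>"
      by (simp add: algebra_simps)
  qed (use C(1) in auto)
qed auto

lemma det_perturbation:
  fixes A :: "real^'n::finite^'n"
  obtains C where "0 \<le> C" "\<And>B \<tau>. 0 \<le> \<tau> \<Longrightarrow> \<tau> \<le> 1 \<Longrightarrow> (\<And>i j. \<bar>B $ i $ j - A $ i $ j\<bar> \<le> \<tau>) \<Longrightarrow> \<bar>det B - det A\<bar> \<le> C * \<tau>"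
proof -
  let ?P = "{p. p permutes (UNIV :: 'n set)}"
  have "\<exists>C\<ge>0. \<forall>b \<tau>. 0 \<le> \<tau> \<and> \<tau> \<le> 1 \<and> (\<forall>i\<in>UNIV. \<bar>b i - A $ i $ p i\<bar> \<le> \<tau>) \<longrightarrow>
      \<bar>prod b UNIV - (\<Prod>i\<in>UNIV. A $ i $ p i)\<bar> \<le> C * \<tau>" for p
    using prod_perturbation[of UNIV "\<lambda>i. A $ i $ p i"] by simp
  then obtain C where C: "\<And>p. C p \<ge> 0" "\<And>p b \<tau>. 0 \<le> \<tau> \<Longrightarrow> \<tau> \<le> 1 \<Longrightarrow> (\<forall>i\<in>UNIV. \<bar>b i - A $ i $ p i\<bar> \<le> \<tau>) \<Longrightarrow>
      \<bar>prod b UNIV - (\<Prod>i\<in>UNIV. A $ i $ p i)\<bar> \<le> C p * \<tau>" by metis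
  show ?thesis
  proof (rule that[of "\<Sum>p\<in>?P. C p"])
    fix B :: "real^'n^'n" and \<tau> :: real
    assume *: "0 \<le> \<tau>" "\<tau> \<le> 1" "\<And>i j. \<bar>B $ i $ j - A $ i $ j\<bar> \<le> \<tau>"
    have "\<bar>det B - det A\<bar> = \<bar>\<Sum>p\<in>?P. of_int (sign p) * ((\<Prod>i\<in>UNIV. B $ i $ p i) - (\<Prod>i\<in>UNIV. A $ i $ p i))\<bar>"
      by (simp add: det_def sum_subtractf right_diff_distrib)
    also have "\<dots> \<le> (\<Sum>p\<in>?P. C p * \<tau>)"
      by (rule order_trans[OF sum_abs])
         (use C(2)[OF *(1,2)] *(3) in \<open>auto simp: abs_mult sign_def intro!: sum_mono\<close>)
    finally show "\<bar>det B - det A\<bar> \<le> (\<Sum>p\<in>?P. C p) * \<tau>" by (simp add: sum_distrib_right)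
  qed (use C(1) in \<open>auto intro: sum_nonneg\<close>)
qed

text \<open>A product of n factors is at most the n-th power of the largest. Hence a matrix function
  with entries in L^n has an integrable determinant.\<close>

lemma abs_det_le_sum_powers:
  fixes B :: "real^'n::finite^'n"
  shows "\<bar>det B\<bar> \<le> fact CARD('n) * (\<Sum>i\<in>UNIV. \<Sum>j\<in>UNIV. \<bar>B $ i $ j\<bar> ^ CARD('n))"
proof -
  let ?P = "{p. p permutes (UNIV :: 'n set)}"
  let ?S = "\<Sum>i\<in>UNIV. \<Sum>j\<in>UNIV. \<bar>B $ i $ j\<bar> ^ CARD('n)"
  have "(\<Prod>i\<in>UNIV. \<bar>B $ i $ p i\<bar>) \<le> ?S" for p :: "'n \<Rightarrow> 'n"
  proof -
    define M where "M = Max (range (\<lambda>i. \<bar>B $ i $ p i\<bar>))"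
    have "M \<in> range (\<lambda>i. \<bar>B $ i $ p i\<bar>)" unfolding M_def by (intro Max_in) auto
    then obtain k where k: "M = \<bar>B $ k $ p k\<bar>" by blast
    have "(\<Prod>i\<in>UNIV. \<bar>B $ i $ p i\<bar>) \<le> (\<Prod>i\<in>(UNIV :: 'n set). M)"
      by (intro prod_mono) (auto simp: M_def)
    also have "\<dots> = \<bar>B $ k $ p k\<bar> ^ CARD('n)" by (simp add: k)
    also have "\<dots> \<le> (\<Sum>j\<in>UNIV. \<bar>B $ k $ j\<bar> ^ CARD('n))" by (rule member_le_sum) auto
    also have "\<dots> \<le> ?S" by (rule member_le_sum[of k UNIV "\<lambda>i. \<Sum>j\<in>UNIV. \<bar>B $ i $ j\<bar> ^ CARD('n)"]) (auto intro: sum_nonneg)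
    finally show ?thesis .
  qed
  then have "\<bar>of_int (sign p) * (\<Prod>i\<in>UNIV. B $ i $ p i)\<bar> \<le> ?S" for p :: "'n \<Rightarrow> 'n"
    by (simp add: abs_mult abs_prod sign_def)
  then have "\<bar>det B\<bar> \<le> (\<Sum>p\<in>?P. ?S)"
    unfolding det_def by (intro order_trans[OF sum_abs] sum_mono)
  also have "\<dots> = fact CARD('n) * ?S" using card_permutations[of "UNIV :: 'n set" "CARD('n)"] by simp
  finally show ?thesis .
qed

text \<open>The sum is at most the number of terms times the largest one; this constant is cruder
  than the one from convexity but valid for every nonnegative \<open>q\<close>.\<close>

lemma sum_powr_le:
  fixes t :: "'i \<Rightarrow> real"
  assumes S: "finite S" and t: "\<And>i. i \<in> S \<Longrightarrow> 0 \<le> t i" and q: "0 \<le> q"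
  shows "(\<Sum>i\<in>S. t i) powr q \<le> real (card S) powr q * (\<Sum>i\<in>S. t i powr q)"
proof (cases "S = {}")
  case False
  define M where "M = Max (t ` S)"
  have "M \<in> t ` S" unfolding M_def using S False by (intro Max_in) auto
  then obtain k where k: "k \<in> S" "M = t k" by blast
  have "(\<Sum>i\<in>S. t i) \<le> real (card S) * M"
    by (rule sum_bounded_above) (use S in \<open>auto simp: M_def\<close>)
  then have "(\<Sum>i\<in>S. t i) powr q \<le> (real (card S) * M) powr q"
    using t q by (intro powr_mono2) (auto intro: sum_nonneg)
  also have "\<dots> = real (card S) powr q * t k powr q" using t k by (simp add: powr_mult)
  also have "\<dots> \<le> real (card S) powr q * (\<Sum>i\<in>S. t i powr q)"
    using k S by (intro mult_left_mono member_le_sum[of k S "\<lambda>i. t i powr q"]) auto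
  finally show ?thesis .
qed simp

text \<open>Above the threshold, \<open>t powr (1 - q)\<close> is at most
  \<open>\<tau> powr (1 - q)\<close>. Integrated and then optimised in \<tau>, the inequality takes
  the place of Hoelder's.\<close>

lemma young_threshold:
  fixes t \<tau> q :: real
  assumes "0 \<le> t" "0 < \<tau>" "1 \<le> q"
  shows "t \<le> \<tau> + \<tau> powr (1 - q) * t powr q"
proof (cases "t \<le> \<tau>")
  case False
  then have "t = t powr (1 - q) * t powr q" using assms by (simp flip: powr_add)
  also have "\<dots> \<le> \<tau> powr (1 - q) * t powr q"
    using False assms by (intro mult_right_mono powr_mono2') auto
  finally show ?thesis using assms by simp
qed (use assms in \<open>simp add: add_increasing2\<close>)

section \<open>Local integrability of Sobolev functions\<close>

text \<open>Hoelder's inequality with constant 2: \<open>young_threshold\<close> is integrated with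
  the threshold at which its two terms agree.\<close>

lemma nn_integral_Holder_finite:
  fixes G :: "'a \<Rightarrow> real"
  assumes G [measurable]: "G \<in> borel_measurable M" and Q [measurable]: "Q \<in> sets M"
    and G0: "\<And>x. 0 \<le> G x" and V: "0 < V" "emeasure M Q = ennreal V" and q: "1 \<le> q" and e: "0 \<le> e"
    and le: "(\<integral>\<^sup>+x\<in>Q. ennreal (G x powr q) \<partial>M) \<le> ennreal e"
  shows "(\<integral>\<^sup>+x\<in>Q. ennreal (G x) \<partial>M) \<le> ennreal (2 * V * (e / V) powr (1 / q))"
proof -
  have thr: "(\<integral>\<^sup>+x\<in>Q. ennreal (G x) \<partial>M) \<le> ennreal (\<tau> * V + \<tau> powr (1 - q) * e)" if \<tau>: "0 < \<tau>" for \<tau>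
  proof -
    have "(\<integral>\<^sup>+x\<in>Q. ennreal (G x) \<partial>M) \<le>
      (\<integral>\<^sup>+x. ennreal \<tau> * indicator Q x + ennreal (\<tau> powr (1 - q)) * (ennreal (G x powr q) * indicator Q x) \<partial>M)"
    proof (rule nn_integral_mono)
      fix x
      have "ennreal (G x) \<le> ennreal (\<tau> + \<tau> powr (1 - q) * G x powr q)"
        by (intro ennreal_leI young_threshold G0 \<tau> q)
      also have "\<dots> = ennreal \<tau> + ennreal (\<tau> powr (1 - q)) * ennreal (G x powr q)"
        using \<tau> by (simp add: ennreal_mult)
      finally show "ennreal (G x) * indicator Q x \<le>
        ennreal \<tau> * indicator Q x + ennreal (\<tau> powr (1 - q)) * (ennreal (G x powr q) * indicator Q x)"
        by (auto split: split_indicator)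
    qed
    also have "\<dots> = ennreal \<tau> * ennreal V + ennreal (\<tau> powr (1 - q)) * (\<integral>\<^sup>+x\<in>Q. ennreal (G x powr q) \<partial>M)"
      by (subst nn_integral_add) (auto simp: nn_integral_cmult nn_integral_cmult_indicator V)
    also have "\<dots> \<le> ennreal \<tau> * ennreal V + ennreal (\<tau> powr (1 - q)) * ennreal e"
      by (intro add_mono mult_left_mono le) auto
    also have "\<dots> = ennreal (\<tau> * V + \<tau> powr (1 - q) * e)"
      using \<tau> V e by (simp add: ennreal_mult)
    finally show ?thesis .
  qed
  show ?thesis
  \<comment> \<open>For \<open>e = 0\<close> the balancing threshold would be 0, which is excluded;
    instead an arbitrarily small positive threshold is used.\<close>
  proof (cases "e = 0")
    case True
    have "(\<integral>\<^sup>+x\<in>Q. ennreal (G x) \<partial>M) \<le> 0"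
    proof (rule ennreal_le_epsilon)
      fix \<epsilon> :: real assume "0 < \<epsilon>"
      then show "(\<integral>\<^sup>+x\<in>Q. ennreal (G x) \<partial>M) \<le> 0 + ennreal \<epsilon>"
        using thr[of "\<epsilon> / V"] V True by simp
    qed
    then show ?thesis by simp
  next
    case False
    define \<tau> where "\<tau> = (e / V) powr (1 / q)"
    have eV: "0 < e / V" using False e V by simp
    have \<tau>: "0 < \<tau>" "\<tau> powr q = e / V"
      using eV q V e by (auto simp: \<tau>_def powr_powr)
    have "\<tau> powr (1 - q) * e = \<tau> * V"
      using \<tau> q False V by (simp add: powr_diff)
    then show ?thesis using thr[OF \<tau>(1)] by (simp add: \<tau>_def mult_ac)
  qed
qed

section \<open>Integrals over moving cubes\<close>

lemma cube_translate: "indicator (cube y r) (v + y) = indicator (cube 0 r) v"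
  by (auto simp: mem_cube indicator_def)

lemma nn_integral_cube_translate:
  assumes [measurable]: "H \<in> borel_measurable borel"
  shows "(\<integral>\<^sup>+w\<in>cube y r. H w \<partial>lborel) = (\<integral>\<^sup>+v. H (v + y) * indicator (cube 0 r) v \<partial>lborel)"
  using nn_integral_lborel_translate[of "\<lambda>w. H w * indicator (cube y r) w" y] by (simp add: cube_translate)

lemma measurable_nn_integral_cube:
  assumes [measurable]: "H \<in> borel_measurable borel"
  shows "(\<lambda>y. \<integral>\<^sup>+w\<in>cube y r. H w \<partial>lborel) \<in> borel_measurable borel"
  unfolding nn_integral_cube_translate[OF assms] by measurable

text \<open>By Tonelli this counts each point with the volume of the set of corners whose cube
  contains it, and that volume is \<open>r^n\<close>.\<close>

lemma nn_integral_nn_integral_cube: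
  fixes H :: "real^'n::finite \<Rightarrow> ennreal"
  assumes [measurable]: "H \<in> borel_measurable borel" and r: "0 \<le> r"
  shows "(\<integral>\<^sup>+y. (\<integral>\<^sup>+w\<in>cube y r. H w \<partial>lborel) \<partial>lborel) = ennreal (r ^ CARD('n)) * (\<integral>\<^sup>+y. H y \<partial>lborel)"
proof -
  have "(\<integral>\<^sup>+y. (\<integral>\<^sup>+w\<in>cube y r. H w \<partial>lborel) \<partial>lborel) = (\<integral>\<^sup>+v. (\<integral>\<^sup>+y. H (v + y) * indicator (cube 0 r) v \<partial>lborel) \<partial>lborel)"
    unfolding nn_integral_cube_translate[OF assms(1)] by (rule lborel_pair.Fubini') measurable
  also have "\<dots> = (\<integral>\<^sup>+v. (\<integral>\<^sup>+y. H y \<partial>lborel) * indicator (cube (0::real^'n) r) v \<partial>lborel)"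
    using nn_integral_lborel_translate[of H] by (simp add: nn_integral_multc add.commute)
  also have "\<dots> = ennreal (r ^ CARD('n)) * (\<integral>\<^sup>+y. H y \<partial>lborel)"
    using r by (simp add: nn_integral_cmult_indicator emeasure_cube mult.commute)
  finally show ?thesis .
qed

lemma vec_add_One: "(\<chi> i. y $ i + h) = y + h *\<^sub>R (One :: real^'n::finite)"
proof -
  have "(One :: real^'n) \<bullet> axis i 1 = 1" for i by (rule inner_sum_Basis) simp
  then have "(One :: real^'n) $ i = 1" for i by (simp add: inner_axis)
  then show ?thesis by (simp add: vec_eq_iff)
qed

lemma cube_avg_tendsto_AE:
  fixes u :: "real^'n::finite \<Rightarrow> real"
  assumes u: "integrable lborel u" and R: "0 < R"
  shows "AE y in lborel. (\<lambda>k. cube_avg u y (R / 2 ^ k)) \<longlonglongrightarrow> u y"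
proof -
  have sint: "set_integrable lborel S u" if "S \<in> sets borel" for S
    unfolding set_integrable_def using that u by (intro integrable_mult_indicator) auto
  have "u integrable_on cbox c e" for c e
    using set_borel_integral_eq_integral(1)[OF sint[of "cbox c e"]] by simp
  from integrable_ccontinuous_explicit[of u, OF this] obtain N where N: "negligible N"
       "\<And>x e. x \<notin> N \<Longrightarrow> 0 < e \<Longrightarrow> \<exists>d>0. \<forall>h. 0 < h \<and> h < d \<longrightarrow>
           norm (integral (cbox x (x + h *\<^sub>R One)) u /\<^sub>R h ^ DIM(real^'n) - u x) < e"
    by blast
  have avg: "cube_avg u y h = integral (cbox y (y + h *\<^sub>R One)) u /\<^sub>R h ^ DIM(real^'n)" for y h
    using set_borel_integral_eq_integral(2)[OF sint[of "cube y h"]]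
    unfolding cube_avg_def cube_def vec_add_One by (simp add: integral_open_interval divide_inverse mult.commute)
  have lim: "(\<lambda>k. cube_avg u y (R / 2 ^ k)) \<longlonglongrightarrow> u y" if y: "y \<notin> N" for y
  proof (rule tendstoI)
    fix e :: real assume "0 < e"
    from N(2)[OF y this] obtain d where d: "0 < d"
      "\<And>h. 0 < h \<Longrightarrow> h < d \<Longrightarrow> norm (integral (cbox y (y + h *\<^sub>R One)) u /\<^sub>R h ^ DIM(real^'n) - u y) < e" by blast
    have "(\<lambda>k. R * (1 / 2) ^ k) \<longlonglongrightarrow> 0" by (intro tendsto_mult_right_zero LIMSEQ_power_zero) auto
    then have "\<forall>\<^sub>F k in sequentially. R * (1 / 2) ^ k < d" using d(1) by (rule order_tendstoD)
    then show "\<forall>\<^sub>F k in sequentially. dist (cube_avg u y (R / 2 ^ k)) (u y) < e"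
    proof eventually_elim
      fix k assume "R * (1 / 2) ^ k < d"
      then have "norm (integral (cbox y (y + (R / 2 ^ k) *\<^sub>R One)) u /\<^sub>R (R / 2 ^ k) ^ DIM(real^'n) - u y) < e"
        using R by (intro d(2)) (auto simp: power_divide)
      then show "dist (cube_avg u y (R / 2 ^ k)) (u y) < e" by (simp only: avg dist_norm)
    qed
  qed
  have "AE x in lebesgue. x \<notin> N" using N(1) by (intro AE_not_in) (simp add: negligible_iff_null_sets)
  then have "AE x in lborel. x \<notin> N" by (simp add: AE_completion_iff)
  then show ?thesis by eventually_elim (rule lim)
qed

lemma power_add_le: "0 \<le> x \<Longrightarrow> 0 \<le> y \<Longrightarrow> (x + y) ^ n \<le> 2 ^ n * (x ^ n + y ^ (n::nat))" for x y :: real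
proof -
  assume *: "0 \<le> x" "0 \<le> y"
  have "(x + y) ^ n \<le> (2 * max x y) ^ n" using * by (intro power_mono) auto
  also have "\<dots> \<le> 2 ^ n * (x ^ n + y ^ n)" using * by (auto simp: power_mult_distrib max_def)
  finally show ?thesis .
qed

text \<open>A Sobolev embedding: for \<open>q < n\<close> the exponent n q / (n - q) exceeds n
  exactly when \<open>q > n / 2\<close>. The value \<open>u y\<close> is reached as the limit of
  dyadic averages at \<open>y\<close>, whose increments Hoelder's inequality bounds by local
  energies. The doubled cube in \<open>weak\<close> leaves room for cubes cornered at points of
  \<open>cube x R\<close>.\<close>

lemma W1q_imp_local_Ln:
  fixes u :: "real^'n::finite \<Rightarrow> real" and g :: "'n \<Rightarrow> real^'n \<Rightarrow> real" and R q E :: real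
  assumes u: "integrable lborel u" and g: "\<And>i. integrable lborel (g i)"
    and weak: "\<And>i \<phi>. test_function (cube x (2 * R)) \<phi> \<Longrightarrow>
      (\<integral>x. u x * partial_deriv i \<phi> x \<partial>lborel) = - (\<integral>x. g i x * \<phi> x \<partial>lborel)"
    and R: "0 < R" and q: "1 < q" "real CARD('n) / 2 < q" "q \<le> real CARD('n)" and E: "0 < E"
    and Gq: "(\<integral>\<^sup>+y. ennreal ((\<Sum>i\<in>UNIV. \<bar>g i y\<bar>) powr q) \<partial>lborel) \<le> ennreal E"
  shows "(\<integral>\<^sup>+y\<in>cube x R. ennreal (\<bar>u y\<bar> ^ CARD('n)) \<partial>lborel) < \<infinity>"
proof -
  let ?N = "CARD('n)" and ?n = "real CARD('n)"
  \<comment> \<open>Hoelder's inequality gives increments with the factor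
    \<open>r powr (1 - n / q)\<close>, and \<open>1 - n / q = \<rho> / 2 + (\<rho> / 2 - 1)\<close>.
    The first half of \<rho> makes the increments geometric, the second half makes the weighted
    energies summable.\<close>
  define \<rho> where "\<rho> = 2 - ?n / q"
  have \<rho>: "0 < \<rho>" using q by (simp add: \<rho>_def field_simps)
  define r where "r k = R / 2 ^ k" for k :: nat
  have r: "0 < r k" "r k \<le> R" "r (Suc k) = r k / 2" for k
    using R by (auto simp: r_def field_simps)
  have [measurable]: "u \<in> borel_measurable borel" "\<And>i. g i \<in> borel_measurable borel" using u g by auto
  let ?G = "\<lambda>y. \<Sum>i\<in>UNIV. \<bar>g i y\<bar>"
  define e where "e k y = (\<integral>\<^sup>+w\<in>cube y (r k). ennreal (?G w powr q) \<partial>lborel)" for k y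
  have e_meas [measurable]: "e k \<in> borel_measurable borel" for k
    unfolding e_def by (rule measurable_nn_integral_cube) measurable
  have eE: "e k y \<le> ennreal E" for k y
    unfolding e_def by (rule order_trans[OF nn_integral_mono Gq]) (auto split: split_indicator)
  \<comment> \<open>The increments of the dyadic averages at \<open>y\<close> are at most \<open>C * \<Phi> y powr (1 / n) * \<theta> ^ k\<close>, while the
    weights keep \<open>\<Phi>\<close> integrable; both need \<open>\<rho> > 0\<close>.\<close>
  define \<Phi> where "\<Phi> y = (\<Sum>k. ennreal (r k powr (?n * (\<rho> / 2 - 1))) * e k y)" for y
  have [measurable]: "\<Phi> \<in> borel_measurable borel" unfolding \<Phi>_def by measurable
  define \<theta> where "\<theta> = (1 / 2 :: real) powr (\<rho> / 2)"
  have \<theta>: "0 < \<theta>" "\<theta> < 1" using \<rho> powr_less_mono2[of "\<rho> / 2" "1/2" 1] by (auto simp: \<theta>_def)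
  have r\<theta>: "r k powr (\<rho> / 2) = R powr (\<rho> / 2) * \<theta> ^ k" for k
    unfolding r_def \<theta>_def by (rule powr_dyadic[OF R])
  have \<Phi>_fin: "(\<integral>\<^sup>+y. \<Phi> y \<partial>lborel) < \<infinity>"
  proof -
    have "(\<integral>\<^sup>+y. \<Phi> y \<partial>lborel) = (\<Sum>k. ennreal (r k powr (?n * (\<rho> / 2 - 1))) * (\<integral>\<^sup>+y. e k y \<partial>lborel))"
      unfolding \<Phi>_def by (subst nn_integral_suminf) (auto simp: nn_integral_cmult)
    also have "\<dots> \<le> (\<Sum>k. ennreal (E * (R powr (\<rho> / 2)) ^ ?N * (\<theta> ^ ?N) ^ k))"
    proof (intro suminf_le)
      fix k
      \<comment> \<open>Integration over \<open>y\<close> gains \<open>r k ^ n\<close>, which turns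
        the weight into the positive power \<open>n * \<rho> / 2\<close> of
        \<open>r k\<close>.\<close>
      have "(\<integral>\<^sup>+y. e k y \<partial>lborel) = ennreal (r k ^ ?N) * (\<integral>\<^sup>+y. ennreal (?G y powr q) \<partial>lborel)"
        unfolding e_def using r(1)[of k] by (intro nn_integral_nn_integral_cube) (auto simp: less_imp_le)
      also have "\<dots> \<le> ennreal (r k ^ ?N) * ennreal E" by (intro mult_left_mono Gq) auto
      finally have "ennreal (r k powr (?n * (\<rho> / 2 - 1))) * (\<integral>\<^sup>+y. e k y \<partial>lborel)
          \<le> ennreal (r k powr (?n * (\<rho> / 2 - 1))) * (ennreal (r k ^ ?N) * ennreal E)"
        by (rule mult_left_mono) auto
      also have "\<dots> = ennreal (r k powr (?n * (\<rho> / 2 - 1)) * r k ^ ?N * E)"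
        using r(1)[of k] E by (simp add: ennreal_mult[symmetric] mult.assoc)
      also have "r k powr (?n * (\<rho> / 2 - 1)) * r k ^ ?N = (r k powr (\<rho> / 2)) ^ ?N"
      proof -
        have "r k powr (?n * (\<rho> / 2 - 1)) * r k ^ ?N = r k powr (?n * (\<rho> / 2 - 1) + ?n)"
          using r(1)[of k] by (simp add: powr_add powr_realpow)
        also have "?n * (\<rho> / 2 - 1) + ?n = \<rho> / 2 * ?n" by (simp add: algebra_simps)
        also have "r k powr (\<rho> / 2 * ?n) = (r k powr (\<rho> / 2)) ^ ?N"
          using r(1)[of k] by (subst powr_realpow[symmetric]) (auto simp: powr_powr)
        finally show ?thesis .
      qed
      also have "(r k powr (\<rho> / 2)) ^ ?N * E = E * (R powr (\<rho> / 2)) ^ ?N * (\<theta> ^ ?N) ^ k"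
        by (simp add: r\<theta> power_mult_distrib power_mult[symmetric] mult.commute)
      finally show "ennreal (r k powr (?n * (\<rho> / 2 - 1))) * (\<integral>\<^sup>+y. e k y \<partial>lborel)
        \<le> ennreal (E * (R powr (\<rho> / 2)) ^ ?N * (\<theta> ^ ?N) ^ k)" .
    qed auto
    also have "\<dots> < \<infinity>"
    proof -
      have "\<theta> ^ ?N < 1" using \<theta> by (simp add: power_less_one_iff)
      then have "summable (\<lambda>k. E * (R powr (\<rho> / 2)) ^ ?N * (\<theta> ^ ?N) ^ k)"
        using \<theta> by (intro summable_mult summable_geometric) auto
      then show ?thesis using E \<theta> by (simp add: ennreal_suminf_neq_top less_top)
    qed
    finally show ?thesis .
  qed
  define K where "K = 4 ^ ?N * 2 * E powr (1 / q - 1 / ?n)"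
  have K: "0 \<le> K" by (simp add: K_def)
  define M where "M = (\<integral>y. \<bar>u y\<bar> \<partial>lborel) / R ^ ?N"
  have M: "0 \<le> M" using R by (simp add: M_def)
  define L where "L = K * R powr (\<rho> / 2) / (1 - \<theta>)"
  have L: "0 \<le> L" using K \<theta> by (simp add: L_def)
  have AE\<Phi>: "AE y in lborel. \<Phi> y \<noteq> \<infinity>"
    by (rule nn_integral_noteq_infinite) (use \<Phi>_fin in auto)
  have bound: "AE y in lborel. y \<in> cube x R \<longrightarrow>
      ennreal (\<bar>u y\<bar> ^ ?N) \<le> ennreal (2 ^ ?N * M ^ ?N) + ennreal (2 ^ ?N * L ^ ?N) * \<Phi> y"
    using cube_avg_tendsto_AE[OF u R] AE\<Phi>
  proof eventually_elim
    fix y assume lim: "(\<lambda>k. cube_avg u y (R / 2 ^ k)) \<longlonglongrightarrow> u y" and fin: "\<Phi> y \<noteq> \<infinity>"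
    show "y \<in> cube x R \<longrightarrow>
      ennreal (\<bar>u y\<bar> ^ ?N) \<le> ennreal (2 ^ ?N * M ^ ?N) + ennreal (2 ^ ?N * L ^ ?N) * \<Phi> y"
    proof
      assume y: "y \<in> cube x R"
      define \<phi> where "\<phi> = enn2real (\<Phi> y)"
      have \<phi>: "\<Phi> y = ennreal \<phi>" "0 \<le> \<phi>" using fin by (auto simp: \<phi>_def less_top)
      define m where "m k = cube_avg u y (r k)" for k
      have step: "\<bar>m (Suc k) - m k\<bar> \<le> K * \<phi> powr (1 / ?n) * R powr (\<rho> / 2) * \<theta> ^ k" for k
      proof -
        define \<epsilon> where "\<epsilon> = enn2real (e k y)"
        have "e k y < top" using eE[of k y] ennreal_less_top by (rule order_le_less_trans)
        have \<epsilon>: "e k y = ennreal \<epsilon>" "0 \<le> \<epsilon>" "\<epsilon> \<le> E"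
          using eE[of k y] E \<open>e k y < top\<close> by (auto simp: \<epsilon>_def enn2real_leI)
        have sub: "cube y (r k) \<subseteq> cube x (2 * R)"
        proof
          fix z assume z: "z \<in> cube y (r k)"
          have "x $ i < z $ i \<and> z $ i < x $ i + 2 * R" for i
          proof -
            have "y $ i < z $ i \<and> z $ i < y $ i + r k" "x $ i < y $ i \<and> y $ i < x $ i + R"
              using y z by (auto simp: mem_cube)
            then show ?thesis using r(2)[of k] by linarith
          qed
          then show "z \<in> cube x (2 * R)" by (simp add: mem_cube)
        qed
        have "ennreal \<bar>m k - m (Suc k)\<bar> \<le> ennreal (4 ^ ?N * r k / r k ^ ?N) * (\<integral>\<^sup>+w\<in>cube y (r k). ennreal (?G w) \<partial>lborel)"
          unfolding m_def r(3) by (rule cube_avg_halve_le[OF u g weak[OF test_function_mono[OF _ sub]] r(1)])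
        also have "\<dots> \<le> ennreal (4 ^ ?N * r k / r k ^ ?N) * ennreal (2 * r k ^ ?N * (\<epsilon> / r k ^ ?N) powr (1 / q))"
        proof (intro mult_left_mono nn_integral_Holder_finite)
          show "(\<integral>\<^sup>+w\<in>cube y (r k). ennreal (?G w powr q) \<partial>lborel) \<le> ennreal \<epsilon>"
            using \<epsilon>(1) by (simp add: e_def)
        qed (use r(1)[of k] q \<epsilon> in \<open>auto intro: sum_nonneg emeasure_cube\<close>)
        also have "\<dots> = ennreal (4 ^ ?N * 2 * r k * (\<epsilon> / r k ^ ?N) powr (1 / q))"
          using r(1)[of k] by (simp add: ennreal_mult[symmetric])
        finally have "\<bar>m k - m (Suc k)\<bar> \<le> 4 ^ ?N * 2 * (r k * (\<epsilon> / r k ^ ?N) powr (1 / q))"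
          using r(1)[of k] by (simp add: mult.assoc)
        also have "r k * (\<epsilon> / r k ^ ?N) powr (1 / q) \<le> E powr (1 / q - 1 / ?n) * (r k powr (\<rho> / 2) * \<phi> powr (1 / ?n))"
        proof -
          have "r k * (\<epsilon> / r k ^ ?N) powr (1 / q) = r k powr (1 - ?n / q) * \<epsilon> powr (1 / q)"
            using r(1)[of k] \<epsilon>(2)
            by (simp add: powr_divide powr_realpow[symmetric] powr_powr powr_diff)
          \<comment> \<open>Since \<open>q \<le> n\<close>, the surplus exponent
            \<open>1 / q - 1 / n\<close> is nonnegative and can be absorbed by the total energy
            \<open>E\<close>; the power \<open>1 / n\<close> left over is the one whose n-th power
            is integrable in \<open>y\<close>.\<close>
          also have "\<epsilon> powr (1 / q) = \<epsilon> powr (1 / q - 1 / ?n) * \<epsilon> powr (1 / ?n)"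
            by (simp flip: powr_add)
          also have "r k powr (1 - ?n / q) * \<dots> \<le> r k powr (1 - ?n / q) * (E powr (1 / q - 1 / ?n) * \<epsilon> powr (1 / ?n))"
            using \<epsilon> q by (intro mult_left_mono mult_right_mono powr_mono2) (auto simp: field_simps)
          also have "\<dots> = E powr (1 / q - 1 / ?n) * (r k powr (\<rho> / 2) * (r k powr (?n * (\<rho> / 2 - 1)) * \<epsilon>) powr (1 / ?n))"
          proof -
            have "(r k powr (?n * (\<rho> / 2 - 1)) * \<epsilon>) powr (1 / ?n) = r k powr (\<rho> / 2 - 1) * \<epsilon> powr (1 / ?n)"
              using \<epsilon>(2) by (simp add: powr_mult powr_powr)
            moreover have "r k powr (1 - ?n / q) = r k powr (\<rho> / 2) * r k powr (\<rho> / 2 - 1)"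
              by (simp add: \<rho>_def flip: powr_add)
            ultimately show ?thesis by simp
          qed
          also have "\<dots> \<le> E powr (1 / q - 1 / ?n) * (r k powr (\<rho> / 2) * \<phi> powr (1 / ?n))"
          proof -
            have "ennreal (r k powr (?n * (\<rho> / 2 - 1)) * \<epsilon>) \<le> ennreal \<phi>"
            proof -
              have "ennreal (r k powr (?n * (\<rho> / 2 - 1))) * e k y \<le> \<Phi> y"
                unfolding \<Phi>_def
                using sum_le_suminf[of "\<lambda>k. ennreal (r k powr (?n * (\<rho> / 2 - 1))) * e k y" "{k}"] by simp
              then show ?thesis using \<epsilon> \<phi> by (simp add: ennreal_mult)
            qed
            then have "r k powr (?n * (\<rho> / 2 - 1)) * \<epsilon> \<le> \<phi>" using \<phi>(2) by simp
            then show ?thesis using \<epsilon>(2) by (intro mult_left_mono powr_mono2) auto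
          qed
          finally show ?thesis .
        qed
        finally show ?thesis by (simp add: K_def r\<theta> abs_minus_commute mult_ac)
      qed
      obtain A where A: "\<And>k. \<bar>m k - A\<bar> \<le> K * \<phi> powr (1 / ?n) * R powr (\<rho> / 2) / (1 - \<theta>) * \<theta> ^ k"
        using geometric_increments_limit[OF step \<theta>] by blast
      have "m \<longlonglongrightarrow> A"
      proof (rule LIM_zero_cancel, rule Lim_null_comparison)
        show "\<forall>\<^sub>F k in sequentially. norm (m k - A) \<le> K * \<phi> powr (1 / ?n) * R powr (\<rho> / 2) / (1 - \<theta>) * \<theta> ^ k"
          using A by (simp add: always_eventually)
        show "(\<lambda>k. K * \<phi> powr (1 / ?n) * R powr (\<rho> / 2) / (1 - \<theta>) * \<theta> ^ k) \<longlonglongrightarrow> 0"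
          using \<theta> by (intro tendsto_mult_right_zero LIMSEQ_power_zero) auto
      qed
      then have "A = u y" using lim LIMSEQ_unique unfolding m_def r_def by blast
      with A[of 0] have "\<bar>u y\<bar> \<le> \<bar>m 0\<bar> + L * \<phi> powr (1 / ?n)"
        by (simp add: L_def mult_ac)
      also have "\<bar>m 0\<bar> \<le> M"
      proof -
        have "\<bar>\<integral>w\<in>cube y R. u w \<partial>lborel\<bar> \<le> (\<integral>w. \<bar>u w\<bar> \<partial>lborel)"
        proof -
          have "integrable lborel (\<lambda>w. indicator (cube y R) w *\<^sub>R u w)"
            using u by (intro integrable_mult_indicator) auto
          then have "(\<integral>w. \<bar>indicator (cube y R) w *\<^sub>R u w\<bar> \<partial>lborel) \<le> (\<integral>w. \<bar>u w\<bar> \<partial>lborel)"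
            using u by (intro integral_mono integrable_abs) (auto split: split_indicator)
          then show ?thesis unfolding set_lebesgue_integral_def by (rule order_trans[OF integral_abs_bound])
        qed
        then show ?thesis using R by (simp add: m_def cube_avg_def M_def r_def divide_right_mono)
      qed
      finally have "\<bar>u y\<bar> ^ ?N \<le> (M + L * \<phi> powr (1 / ?n)) ^ ?N" by (intro power_mono) auto
      also have "\<dots> \<le> 2 ^ ?N * (M ^ ?N + (L * \<phi> powr (1 / ?n)) ^ ?N)"
        using M L by (intro power_add_le) auto
      also have "\<dots> = 2 ^ ?N * M ^ ?N + 2 ^ ?N * L ^ ?N * \<phi>"
      proof -
        have "(\<phi> powr (1 / ?n)) ^ ?N = \<phi>"
          using \<phi>(2) by (cases "\<phi> = 0") (auto simp: powr_realpow[symmetric] powr_powr)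
        then show ?thesis by (simp add: power_mult_distrib algebra_simps)
      qed
      finally show "ennreal (\<bar>u y\<bar> ^ ?N) \<le> ennreal (2 ^ ?N * M ^ ?N) + ennreal (2 ^ ?N * L ^ ?N) * \<Phi> y"
        using M L \<phi> by (simp add: ennreal_mult[symmetric] ennreal_plus[symmetric] ennreal_leI del: ennreal_plus)
    qed
  qed
  have "(\<integral>\<^sup>+y\<in>cube x R. ennreal (\<bar>u y\<bar> ^ ?N) \<partial>lborel) \<le>
      (\<integral>\<^sup>+y. ennreal (2 ^ ?N * M ^ ?N) * indicator (cube x R) y + ennreal (2 ^ ?N * L ^ ?N) * \<Phi> y \<partial>lborel)"
    by (rule nn_integral_mono_AE, use bound in eventually_elim) (auto split: split_indicator)
  also have "\<dots> = ennreal (2 ^ ?N * M ^ ?N) * ennreal (R ^ ?N) + ennreal (2 ^ ?N * L ^ ?N) * (\<integral>\<^sup>+y. \<Phi> y \<partial>lborel)"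
    using R by (subst nn_integral_add) (auto simp: nn_integral_cmult nn_integral_cmult_indicator emeasure_cube)
  also have "\<dots> < \<infinity>"
    using \<Phi>_fin by (simp add: ennreal_mult_less_top)
  finally show ?thesis .
qed

section \<open>Singular points of low density\<close>

lemma measurable_det [measurable]:
  fixes u :: "'n::finite \<Rightarrow> 'n \<Rightarrow> 'a \<Rightarrow> real"
  assumes [measurable]: "\<And>i j. u i j \<in> borel_measurable M"
  shows "(\<lambda>y. det (\<chi> i j. u i j y)) \<in> borel_measurable M"
  unfolding det_def by simp

lemma neg_pow_borel [measurable]: "neg_pow a \<in> borel_measurable borel"
  unfolding neg_pow_def by measurable

lemma neg_pow_ge:
  assumes "\<bar>t\<bar> \<le> s" "0 < a" shows "ennreal (s powr (- a)) \<le> neg_pow a t"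
  using assms by (cases "t = 0") (auto simp: neg_pow_def intro!: ennreal_leI powr_mono2')

text \<open>By Markov's inequality \<open>F\<close> reaches \<tau> on at most a quarter of
  \<open>Q\<close>; the other three quarters carry the lower bound on \<open>H\<close>, which may be
  infinite there.\<close>

lemma nn_integral_Markov_lower:
  assumes [measurable]: "F \<in> borel_measurable M" "H \<in> borel_measurable M" "Q \<in> sets M"
    and F: "\<And>y. 0 \<le> F y" and V: "emeasure M Q = ennreal V" "0 \<le> V" and \<tau>: "0 < \<tau>"
    and FI: "(\<integral>\<^sup>+y\<in>Q. ennreal (F y) \<partial>M) \<le> ennreal (\<tau> * V / 4)"
    and H: "\<And>y. y \<in> Q \<Longrightarrow> F y < \<tau> \<Longrightarrow> ennreal s \<le> H y" and s: "0 \<le> s"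
  shows "ennreal (s * (3 / 4 * V)) \<le> (\<integral>\<^sup>+y\<in>Q. H y \<partial>M)"
proof -
  let ?B = "{y\<in>space M. y \<in> Q \<and> \<tau> \<le> F y}" and ?G = "{y\<in>space M. y \<in> Q \<and> F y < \<tau>}"
  have m [measurable]: "?B \<in> sets M" "?G \<in> sets M" by measurable
  have Q: "Q = ?B \<union> ?G" using sets.sets_into_space[OF assms(3)] by auto
  have fin: "emeasure M S \<noteq> \<infinity>" if "S \<subseteq> Q" for S
    using emeasure_mono[OF that assms(3)] V by (auto simp: top_unique)
  have fB: "emeasure M ?B = ennreal (measure M ?B)" and fG: "emeasure M ?G = ennreal (measure M ?G)"
    using fin[of ?B] fin[of ?G] by (auto intro!: emeasure_eq_ennreal_measure)
  have "ennreal V = emeasure M ?B + emeasure M ?G"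
    unfolding V(1)[symmetric] by (subst Q, rule plus_emeasure[symmetric]) (auto simp: m)
  then have sum: "V = measure M ?B + measure M ?G"
    using V(2) unfolding fB fG by (simp add: ennreal_plus[symmetric] del: ennreal_plus)
  have "ennreal (\<tau> * measure M ?B) = (\<integral>\<^sup>+y. ennreal \<tau> * indicator ?B y \<partial>M)"
    using \<tau> by (simp add: nn_integral_cmult_indicator m fB ennreal_mult)
  also have "\<dots> \<le> (\<integral>\<^sup>+y\<in>Q. ennreal (F y) \<partial>M)"
    by (intro nn_integral_mono) (auto split: split_indicator intro!: ennreal_leI)
  also note FI
  finally have "\<tau> * measure M ?B \<le> \<tau> * (V / 4)"
    using \<tau> V(2) by (subst (asm) ennreal_le_iff) auto
  then have "measure M ?B \<le> V / 4" using \<tau> by (simp only: mult_le_cancel_left_pos)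
  then have "s * (3 / 4 * V) \<le> s * measure M ?G" using sum s by (intro mult_left_mono) auto
  then have "ennreal (s * (3 / 4 * V)) \<le> ennreal s * emeasure M ?G"
    using s by (simp add: fG ennreal_mult[symmetric] ennreal_leI)
  also have "\<dots> = (\<integral>\<^sup>+y. ennreal s * indicator ?G y \<partial>M)" by (simp add: nn_integral_cmult_indicator m)
  also have "\<dots> \<le> (\<integral>\<^sup>+y\<in>Q. H y \<partial>M)"
    by (intro nn_integral_mono) (auto split: split_indicator intro!: H)
  finally show ?thesis .
qed

text \<open>The contradiction at one point. The dyadic limits of the gradient entries form a matrix,
  singular by \<open>small\<close>; near it the determinant is of order
  \<open>r powr \<beta>\<close> on most of each cube, which refutes \<open>neg\<close> for a level
  \<open>c\<close> fixed before the radius.\<close>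

lemma no_singular_point_of_low_density:
  fixes u :: "'n::finite \<Rightarrow> 'n \<Rightarrow> real^'n \<Rightarrow> real" and g :: "'n \<Rightarrow> 'n \<Rightarrow> 'n \<Rightarrow> real^'n \<Rightarrow> real"
    and R q d a \<beta> :: real
  assumes u: "\<And>i j. integrable lborel (u i j)" and g: "\<And>i j k. integrable lborel (g i j k)"
    and weak: "\<And>i j k \<phi>. test_function (cube x R) \<phi> \<Longrightarrow>
      (\<integral>x. u i j x * partial_deriv k \<phi> x \<partial>lborel) = - (\<integral>x. g i j k x * \<phi> x \<partial>lborel)"
    and R: "0 < R" and q: "1 \<le> q" and a: "0 < a"
    and \<beta>: "\<beta> = 1 - (CARD('n) - d) / q" "0 < \<beta>" "CARD('n) - d \<le> \<beta> * a"
    and grow: "\<And>i j r. 0 < r \<Longrightarrow> r \<le> R \<Longrightarrow>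
      (\<integral>\<^sup>+y\<in>cube x r. ennreal ((\<Sum>k\<in>UNIV. \<bar>g i j k y\<bar>) powr q) \<partial>lborel) \<le> ennreal (r powr d)"
    and neg: "\<And>c. 0 < c \<Longrightarrow> \<exists>\<delta>>0. \<forall>r. 0 < r \<and> r \<le> \<delta> \<longrightarrow>
      (\<integral>\<^sup>+y\<in>cube x r. neg_pow a (det (\<chi> i j. u i j y)) \<partial>lborel) \<le> ennreal (c * r powr d)"
    and small: "\<And>c. 0 < c \<Longrightarrow> \<exists>\<delta>>0. \<forall>r. 0 < r \<and> r \<le> \<delta> \<longrightarrow>
      (\<integral>\<^sup>+y\<in>cube x r. ennreal \<bar>det (\<chi> i j. u i j y)\<bar> \<partial>lborel) \<le> ennreal (c * r ^ CARD('n))"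
  shows False
proof -
  let ?N = "CARD('n)" and ?n = "real CARD('n)"
  have [measurable]: "u i j \<in> borel_measurable borel" "g i j k \<in> borel_measurable borel" for i j k using u g by auto
  \<comment> \<open>The exponent is \<open>n - n / q + d / q\<close>, which equals
    \<open>n - 1 + \<beta>\<close> by the choice of \<beta>.\<close>
  have growth: "(\<integral>\<^sup>+y\<in>cube x r. ennreal (\<Sum>k\<in>UNIV. \<bar>g i j k y\<bar>) \<partial>lborel) \<le> ennreal (2 * r powr (?n - 1 + \<beta>))"
    if r: "0 < r" "r \<le> R" for i j r
  proof -
    have "(\<integral>\<^sup>+y\<in>cube x r. ennreal (\<Sum>k\<in>UNIV. \<bar>g i j k y\<bar>) \<partial>lborel) \<le> ennreal (2 * r ^ ?N * (r powr d / r ^ ?N) powr (1 / q))"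
      by (rule nn_integral_Holder_finite[OF _ _ _ _ _ q _ grow[OF r]]) (use r in \<open>auto simp: emeasure_cube sum_nonneg\<close>)
    also have "r powr d / r ^ ?N = r powr (d - ?n)" using r by (simp add: powr_diff powr_realpow)
    also have "2 * r ^ ?N * (r powr (d - ?n)) powr (1 / q) = 2 * (r powr ?n * r powr ((d - ?n) / q))"
      using r by (simp add: powr_powr powr_realpow)
    also have "r powr ?n * r powr ((d - ?n) / q) = r powr (?n - 1 + \<beta>)"
      by (simp add: \<beta>(1) diff_divide_distrib flip: powr_add)
    finally show ?thesis .
  qed
  define good where "good i j A C' \<longleftrightarrow> 0 \<le> C' \<and>
      (\<forall>k. (\<integral>\<^sup>+y\<in>cube x (R / 2 ^ k). ennreal \<bar>u i j y - A\<bar> \<partial>lborel) \<le> ennreal (C' * (R / 2 ^ k) powr (?N + \<beta>)))"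
    for i j A C'
  have "\<exists>A C'. good i j A C'" for i j
  proof (rule dyadic_oscillation_decay[where u = "u i j" and g = "g i j" and x = x and R = R and C = 2 and \<beta> = \<beta>])
    show "(\<integral>x. u i j x * partial_deriv k \<phi> x \<partial>lborel) = - (\<integral>x. g i j k x * \<phi> x \<partial>lborel)"
      if "test_function (cube x R) \<phi>" for k \<phi>
      using that by (rule weak)
    show "\<exists>A C'. good i j A C'"
      if "0 \<le> C'" "\<And>k. (\<integral>\<^sup>+y\<in>cube x (R / 2 ^ k). ennreal \<bar>u i j y - A\<bar> \<partial>lborel) \<le> ennreal (C' * (R / 2 ^ k) powr (?N + \<beta>))"
      for A C'
      unfolding good_def using that by (intro exI[of _ A] exI[of _ C'] conjI allI)
  qed (rule u g R \<beta>(2) growth zero_le_numeral, assumption?)+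
  then obtain A C' where good: "\<And>i j. good i j (A i j) (C' i j)" by metis
  have C': "0 \<le> C' i j"
    and A: "(\<integral>\<^sup>+y\<in>cube x (R / 2 ^ k). ennreal \<bar>u i j y - A i j\<bar> \<partial>lborel) \<le> ennreal (C' i j * (R / 2 ^ k) powr (?N + \<beta>))"
    for i j k
    using good[of i j] unfolding good_def by blast+
  \<comment> \<open>The 4 matches the quarter in \<open>nn_integral_Markov_lower\<close>; the 1
    keeps \<open>T\<close> positive when all oscillation constants vanish.\<close>
  define T where "T = 4 * ((\<Sum>i\<in>UNIV. \<Sum>j\<in>UNIV. C' i j) + 1)"
  have C'0: "0 \<le> (\<Sum>i\<in>UNIV. \<Sum>j\<in>UNIV. C' i j)" using C' by (intro sum_nonneg)
  then have T: "0 < T" by (simp add: T_def)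
  define r where "r k = R / 2 ^ k" for k :: nat
  have r: "0 < r k" "r k \<le> R" for k using R by (auto simp: r_def field_simps)
  define F where "F y = (\<Sum>i\<in>UNIV. \<Sum>j\<in>UNIV. \<bar>u i j y - A i j\<bar>)" for y
  have [measurable]: "F \<in> borel_measurable borel" unfolding F_def by measurable
  have F0: "0 \<le> F y" for y by (auto simp: F_def intro!: sum_nonneg)
  have F_ge: "\<bar>u i j y - A i j\<bar> \<le> F y" for i j y
  proof -
    have "\<bar>u i j y - A i j\<bar> \<le> (\<Sum>j\<in>UNIV. \<bar>u i j y - A i j\<bar>)" by (rule member_le_sum) auto
    also have "\<dots> \<le> F y" unfolding F_def
      by (rule member_le_sum[of i UNIV "\<lambda>i. \<Sum>j\<in>UNIV. \<bar>u i j y - A i j\<bar>"]) (auto intro: sum_nonneg)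
    finally show ?thesis .
  qed
  have FI: "(\<integral>\<^sup>+y\<in>cube x (r k). ennreal (F y) \<partial>lborel) \<le> ennreal (T * r k powr \<beta> * r k ^ ?N / 4)" for k
  proof -
    have "(\<integral>\<^sup>+y\<in>cube x (r k). ennreal (F y) \<partial>lborel) =
        (\<integral>\<^sup>+y. (\<Sum>i\<in>UNIV. \<Sum>j\<in>UNIV. ennreal \<bar>u i j y - A i j\<bar> * indicator (cube x (r k)) y) \<partial>lborel)"
      by (rule nn_integral_cong) (simp add: F_def sum_nonneg flip: sum_distrib_right)
    also have "\<dots> = (\<Sum>i\<in>UNIV. \<integral>\<^sup>+y. (\<Sum>j\<in>UNIV. ennreal \<bar>u i j y - A i j\<bar> * indicator (cube x (r k)) y) \<partial>lborel)"
      by (rule nn_integral_sum) measurable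
    also have "\<dots> = (\<Sum>i\<in>UNIV. \<Sum>j\<in>UNIV. \<integral>\<^sup>+y\<in>cube x (r k). ennreal \<bar>u i j y - A i j\<bar> \<partial>lborel)"
      by (intro sum.cong refl nn_integral_sum) measurable
    also have "\<dots> \<le> (\<Sum>i\<in>UNIV. \<Sum>j\<in>UNIV. ennreal (C' i j * r k powr (?N + \<beta>)))"
      by (intro sum_mono A[folded r_def])
    also have "\<dots> = ennreal ((\<Sum>i\<in>UNIV. \<Sum>j\<in>UNIV. C' i j) * r k powr (?N + \<beta>))"
      using C' by (simp add: sum_nonneg sum_distrib_right)
    also have "\<dots> \<le> ennreal (T * r k powr \<beta> * r k ^ ?N / 4)"
    proof (rule ennreal_leI)
      have "r k powr (?N + \<beta>) = r k powr \<beta> * r k ^ ?N"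
        using r(1)[of k] by (simp add: powr_add powr_realpow)
      moreover have "(\<Sum>i\<in>UNIV. \<Sum>j\<in>UNIV. C' i j) * (r k powr \<beta> * r k ^ ?N) \<le> T / 4 * (r k powr \<beta> * r k ^ ?N)"
        using r(1)[of k] by (intro mult_right_mono) (auto simp: T_def)
      ultimately show "(\<Sum>i\<in>UNIV. \<Sum>j\<in>UNIV. C' i j) * r k powr (?N + \<beta>) \<le> T * r k powr \<beta> * r k ^ ?N / 4"
        by simp
    qed
    finally show ?thesis .
  qed
  define Am where "Am = (\<chi> i j. A i j)"
  let ?U = "\<lambda>y. (\<chi> i j. u i j y) :: real^'n^'n"
  obtain L where L: "0 \<le> L" "\<And>B \<tau>. 0 \<le> \<tau> \<Longrightarrow> \<tau> \<le> 1 \<Longrightarrow> (\<And>i j. \<bar>B $ i $ j - Am $ i $ j\<bar> \<le> \<tau>) \<Longrightarrow> \<bar>det B - det Am\<bar> \<le> L * \<tau>"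
    using det_perturbation[of Am] by blast
  define \<tau> where "\<tau> k = T * r k powr \<beta>" for k
  have \<tau>: "0 < \<tau> k" for k using T r(1)[of k] by (simp add: \<tau>_def)
  have near: "\<bar>det (?U y) - det Am\<bar> \<le> L * \<tau> k" if "F y < \<tau> k" "\<tau> k \<le> 1" for y k
  proof (rule L(2))
    show "\<bar>?U y $ i $ j - Am $ i $ j\<bar> \<le> \<tau> k" for i j using F_ge[of i j y] that by (simp add: Am_def)
  qed (use \<tau>[of k] that in auto)
  have lower: "ennreal (s * (3 / 4 * r k ^ ?N)) \<le> (\<integral>\<^sup>+y\<in>cube x (r k). H (det (?U y)) \<partial>lborel)"
    if "H \<in> borel_measurable borel" "\<And>y. F y < \<tau> k \<Longrightarrow> ennreal s \<le> H (det (?U y))" "0 \<le> s" for H s k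
    by (rule nn_integral_Markov_lower[where F = F and \<tau> = "\<tau> k"])
       (use that FI[of k] F0 r(1)[of k] \<tau>[of k] in \<open>auto simp: emeasure_cube \<tau>_def\<close>)
  have r_lim: "r \<longlonglongrightarrow> 0"
  proof -
    have "(\<lambda>k. R * (1 / 2) ^ k) \<longlonglongrightarrow> 0" by (intro tendsto_mult_right_zero LIMSEQ_power_zero) auto
    then show ?thesis by (simp add: r_def[abs_def] power_divide)
  qed
  have r_ev: "\<forall>\<^sub>F k in sequentially. r k \<le> \<delta>" if "0 < \<delta>" for \<delta>
    using order_tendstoD(2)[OF r_lim that] by eventually_elim simp
  have \<tau>_lim: "\<tau> \<longlonglongrightarrow> 0"
  proof -
    have "(\<lambda>k. r k powr \<beta>) \<longlonglongrightarrow> 0 powr \<beta>"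
      using \<beta>(2) r(1) by (intro tendsto_powr' r_lim tendsto_const) (auto intro!: always_eventually less_imp_le)
    then show ?thesis unfolding \<tau>_def by (intro tendsto_mult_right_zero) simp
  qed
  have \<tau>_ev: "\<forall>\<^sub>F k in sequentially. \<tau> k \<le> \<delta>" if "0 < \<delta>" for \<delta>
    using order_tendstoD(2)[OF \<tau>_lim that] by eventually_elim simp
  \<comment> \<open>If \<open>det Am\<close> had modulus \<open>D > 0\<close>, the determinant would
    have modulus at least \<open>D / 2\<close> on three quarters of a small cube, so its mean would
    be at least \<open>3 / 8 * D\<close>, against the bound \<open>D / 4\<close> from
    \<open>small\<close>.\<close>
  have det0: "det Am = 0"
  proof (rule ccontr)
    assume "det Am \<noteq> 0"
    define D where "D = \<bar>det Am\<bar>"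
    have D: "0 < D" using \<open>det Am \<noteq> 0\<close> by (simp add: D_def)
    obtain \<delta> where \<delta>: "0 < \<delta>" "\<And>r. 0 < r \<Longrightarrow> r \<le> \<delta> \<Longrightarrow>
      (\<integral>\<^sup>+y\<in>cube x r. ennreal \<bar>det (?U y)\<bar> \<partial>lborel) \<le> ennreal (D / 4 * r ^ ?N)"
      using small[of "D / 4"] D by auto
    have "\<forall>\<^sub>F k in sequentially. r k \<le> \<delta> \<and> \<tau> k \<le> 1 \<and> \<tau> k \<le> D / (2 * (L + 1))"
      using D L(1) \<delta>(1) by (intro eventually_conj r_ev \<tau>_ev) auto
    then obtain k where k: "r k \<le> \<delta>" "\<tau> k \<le> 1" "\<tau> k \<le> D / (2 * (L + 1))"
      using eventually_happens'[OF sequentially_bot] by blast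
    have "L * \<tau> k \<le> D / 2"
    proof -
      have "L * \<tau> k \<le> (L + 1) * \<tau> k" using \<tau>[of k] by simp
      also have "\<dots> \<le> (L + 1) * (D / (2 * (L + 1)))" using k(3) L(1) by (intro mult_left_mono) auto
      also have "\<dots> = D / 2" using L(1) by (simp add: field_simps)
      finally show ?thesis .
    qed
    then have "ennreal (D / 2) \<le> ennreal \<bar>det (?U y)\<bar>" if "F y < \<tau> k" for y
      using near[OF that k(2)] D by (intro ennreal_leI) (auto simp: D_def)
    from lower[where H = "\<lambda>t. ennreal \<bar>t\<bar>", OF _ this, of k] D have "ennreal (D / 2 * (3 / 4 * r k ^ ?N)) \<le> (\<integral>\<^sup>+y\<in>cube x (r k). ennreal \<bar>det (?U y)\<bar> \<partial>lborel)"
      by simp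
    also note \<delta>(2)[OF r(1) k(1)]
    finally have "D / 2 * (3 / 4 * r k ^ ?N) \<le> D / 4 * r k ^ ?N"
      using D r(1)[of k] by (subst (asm) ennreal_le_iff) auto
    moreover have "0 < D * r k ^ ?N" using D r(1)[of k] by simp
    ultimately show False by simp
  qed
  \<comment> \<open>\<open>M\<close> does not depend on the radius, and the summand 1 keeps it
    positive even if \<open>L = 0\<close>. The factor 1/2 in \<open>c\<close> is chosen below the
    proportion 3/4 of good points.\<close>
  define M where "M = L * T + 1"
  have M: "0 < M" using L(1) T by (simp add: M_def add_nonneg_pos)
  define c where "c = M powr (- a) / 2"
  have c: "0 < c" using M by (simp add: c_def)
  obtain \<delta> where \<delta>: "0 < \<delta>" "\<And>r. 0 < r \<Longrightarrow> r \<le> \<delta> \<Longrightarrow>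
      (\<integral>\<^sup>+y\<in>cube x r. neg_pow a (det (?U y)) \<partial>lborel) \<le> ennreal (c * r powr d)"
    using neg[OF c] by blast
  have "\<forall>\<^sub>F k in sequentially. r k \<le> \<delta> \<and> r k \<le> 1 \<and> \<tau> k \<le> 1"
    using \<delta>(1) by (intro eventually_conj r_ev \<tau>_ev) auto
  then obtain k where k: "r k \<le> \<delta>" "r k \<le> 1" "\<tau> k \<le> 1"
    using eventually_happens'[OF sequentially_bot] by blast
  let ?s = "(M * r k powr \<beta>) powr (- a)"
  have "ennreal ?s \<le> neg_pow a (det (?U y))" if "F y < \<tau> k" for y
  proof (rule neg_pow_ge[OF _ a])
    have "\<bar>det (?U y)\<bar> \<le> L * \<tau> k" using near[OF that k(3)] det0 by simp
    also have "\<dots> \<le> M * r k powr \<beta>" by (simp add: \<tau>_def M_def distrib_right)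
    finally show "\<bar>det (?U y)\<bar> \<le> M * r k powr \<beta>" .
  qed
  from lower[where H = "neg_pow a", OF _ this, of k] have "ennreal (?s * (3 / 4 * r k ^ ?N)) \<le> (\<integral>\<^sup>+y\<in>cube x (r k). neg_pow a (det (?U y)) \<partial>lborel)"
    by simp
  also note \<delta>(2)[OF r(1) k(1)]
  finally have "?s * (3 / 4 * r k ^ ?N) \<le> c * r k powr d"
    using c by (subst (asm) ennreal_le_iff) auto
  then have "(?s * r k ^ ?N) * (3 / 4) \<le> (M powr (- a) * r k powr d) * (1 / 2)"
    by (simp add: c_def mult_ac)
  \<comment> \<open>For \<open>r k \<le> 1\<close> the inequality
    \<open>n - d \<le> \<beta> * a\<close> becomes a comparison of powers of \<open>r k\<close>;
    equality of the exponents is allowed.\<close>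
  moreover have "M powr (- a) * r k powr d \<le> ?s * r k ^ ?N"
  proof -
    have "r k powr (d - ?n) \<le> r k powr (- (\<beta> * a))"
      using r(1)[of k] k(2) \<beta>(3) by (intro powr_mono') auto
    then have "r k powr (d - ?n) * r k powr ?n \<le> r k powr (- (\<beta> * a)) * r k ^ ?N"
      using r(1)[of k] by (simp add: powr_realpow)
    then have "r k powr d \<le> r k powr (- (\<beta> * a)) * r k ^ ?N" by (simp flip: powr_add)
    then have "M powr (- a) * r k powr d \<le> M powr (- a) * (r k powr (- (\<beta> * a)) * r k ^ ?N)"
      by (intro mult_left_mono) auto
    also have "\<dots> = ?s * r k ^ ?N" using M by (simp add: powr_mult powr_powr)
    finally show ?thesis .
  qed
  moreover have "0 < M powr (- a) * r k powr d" using M r(1)[of k] by simp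
  ultimately show False by linarith
qed

section \<open>Borel representatives\<close>

text \<open>Local integrability only concerns compact subsets; measurability on all of
  \<open>\<Omega>\<close> is a limit along an exhaustion by compact sets, eventually constant at
  each point.\<close>

lemma loc_integrable_measurable:
  assumes "open \<Omega>" "loc_integrable \<Omega> u"
  shows "(\<lambda>x. indicator \<Omega> x * u x) \<in> borel_measurable lebesgue"
proof -
  obtain C where C: "\<And>n. compact (C n)" "\<And>n. C n \<subseteq> \<Omega>" "\<And>n. C n \<subseteq> interior (C (Suc n))" "\<Union> (range C) = \<Omega>"
    using open_Union_compact_subsets[OF assms(1)] by metis
  have inc: "C m \<subseteq> C n" if "m \<le> n" for m n
    using that by (rule lift_Suc_mono_le[of C, rotated]) (use C(3) interior_subset in blast)
  show ?thesis
  proof (rule borel_measurable_LIMSEQ_metric)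
    show "(\<lambda>x. indicator (C n) x * u x) \<in> borel_measurable lebesgue" for n
      using assms(2) C(1,2)[of n] unfolding loc_integrable_def set_integrable_def by (auto dest: borel_measurable_integrable)
    show "(\<lambda>n. indicator (C n) x * u x) \<longlonglongrightarrow> indicator \<Omega> x * u x" for x
    proof (cases "x \<in> \<Omega>")
      case True
      then obtain m where "x \<in> C m" using C(4) by blast
      then have "\<forall>\<^sub>F n in sequentially. indicator (C n) x * u x = indicator \<Omega> x * u x"
        using True inc by (intro eventually_sequentiallyI[of m]) (auto simp: indicator_def)
      then show ?thesis by (rule tendsto_eventually)
    next
      case False
      then have "x \<notin> C n" for n using C(2) by blast
      with False show ?thesis by simp
    qed
  qed
qed

lemma loc_integrable_borel_version:
  assumes "open \<Omega>" "loc_integrable \<Omega> u"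
  shows "\<exists>u'\<in>borel_measurable borel. AE x in lborel. x \<in> \<Omega> \<longrightarrow> u x = u' x"
proof -
  obtain u' where "u' \<in> borel_measurable lborel" "AE x in lborel. indicator \<Omega> x * u x = u' x"
    using completion_ex_borel_measurable_real[OF loc_integrable_measurable[OF assms]] by blast
  then show ?thesis by (intro bexI[of _ u']) (auto elim!: eventually_mono)
qed

lemma loc_integrable_cutoff:
  assumes u: "loc_integrable \<Omega> u" and K: "compact K" "K \<subseteq> \<Omega>"
    and u': "u' \<in> borel_measurable borel" "AE x in lborel. x \<in> \<Omega> \<longrightarrow> u x = u' x"
  shows "integrable lborel (\<lambda>x. indicator K x * u' x)"
proof -
  have [measurable]: "K \<in> sets borel" using K(1) by (simp add: borel_compact)
  note u'(1) [measurable]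
  have i: "integrable lebesgue (\<lambda>x. indicator K x * u x)"
    using u K by (auto simp: loc_integrable_def set_integrable_def)
  have "AE x in lborel. indicator K x * u x = indicator K x * u' x"
    using u'(2) K(2) by (auto elim!: eventually_mono split: split_indicator)
  then have ae: "AE x in lebesgue. indicator K x * u x = indicator K x * u' x"
    by (rule AE_completion)
  have m: "(\<lambda>x. indicator K x * u' x) \<in> borel_measurable lebesgue"
    by (rule measurable_completion) measurable
  have "integrable lebesgue (\<lambda>x. indicator K x * u' x)"
    using integrable_cong_AE[OF borel_measurable_integrable[OF i] m ae] i by blast
  then show ?thesis by (subst (asm) integrable_completion) auto
qed

text \<open>A test function supported in \<open>Q\<close> sees only values on \<open>K\<close>, so
  the cutoff changes neither side. It produces functions suited to the lemmas on cubes, which ask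
  for integrability on the whole space but for the weak derivative only inside a cube.\<close>

lemma weak_partial_cutoff:
  assumes \<Omega>: "open \<Omega>" and wp: "weak_partial \<Omega> u k g" and K: "compact K" "K \<subseteq> \<Omega>"
    and u': "u' \<in> borel_measurable borel" "AE x in lborel. x \<in> \<Omega> \<longrightarrow> u x = u' x"
    and g': "g' \<in> borel_measurable borel" "AE x in lborel. x \<in> \<Omega> \<longrightarrow> g x = g' x"
    and \<phi>: "test_function Q \<phi>" "Q \<subseteq> K"
  shows "(\<integral>x. (indicator K x * u' x) * partial_deriv k \<phi> x \<partial>lborel) = - (\<integral>x. (indicator K x * g' x) * \<phi> x \<partial>lborel)"
proof -
  have [measurable]: "K \<in> sets borel" using K(1) by (simp add: borel_compact)
  have eq: "(LINT x:\<Omega>|lebesgue. w x * \<psi> x) = (\<integral>x. (indicator K x * w' x) * \<psi> x \<partial>lborel)"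
    if w: "loc_integrable \<Omega> w" and [measurable]: "w' \<in> borel_measurable borel"
      and w': "AE x in lborel. x \<in> \<Omega> \<longrightarrow> w x = w' x" and \<psi>: "test_function Q \<psi>" for w w' \<psi>
  proof -
    have [measurable]: "\<psi> \<in> borel_measurable borel" using test_function_borel[OF \<psi>] .
    have [measurable]: "(\<lambda>x. indicator \<Omega> x * w x) \<in> borel_measurable lebesgue"
      by (rule loc_integrable_measurable[OF \<Omega> w])
    have [measurable]: "\<psi> \<in> borel_measurable lebesgue" by (simp add: measurable_completion)
    have "\<psi> x = 0" if "x \<notin> K" for x
      using that \<psi> \<phi>(2) closure_subset[of "{x. \<psi> x \<noteq> 0}"] by (auto simp: test_function_def tsupp_def)
    then have "AE x in lborel. (indicator \<Omega> x * w x) * \<psi> x = (indicator K x * w' x) * \<psi> x"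
      using w' K(2) by (auto elim!: eventually_mono split: split_indicator)
    then have ae: "AE x in lebesgue. (indicator \<Omega> x * w x) * \<psi> x = (indicator K x * w' x) * \<psi> x"
      by (rule AE_completion)
    have "(LINT x:\<Omega>|lebesgue. w x * \<psi> x) = (\<integral>x. (indicator \<Omega> x * w x) * \<psi> x \<partial>lebesgue)"
      by (simp add: set_lebesgue_integral_def mult.assoc)
    also have "\<dots> = (\<integral>x. (indicator K x * w' x) * \<psi> x \<partial>lebesgue)"
      by (rule integral_cong_AE[OF _ _ ae]) (auto intro!: borel_measurable_times measurable_completion)
    also have "\<dots> = (\<integral>x. (indicator K x * w' x) * \<psi> x \<partial>lborel)"
      by (rule integral_completion) measurable
    finally show ?thesis .
  qed
  have "test_function \<Omega> \<phi>" using test_function_mono[OF \<phi>(1)] \<phi>(2) K(2) by blast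
  then have "(LINT x:\<Omega>|lebesgue. u x * partial_deriv k \<phi> x) = - (LINT x:\<Omega>|lebesgue. g x * \<phi> x)"
    using wp by (auto simp: weak_partial_def)
  then show ?thesis
    using eq[OF _ u' test_function_partial_deriv[OF \<phi>(1)]] eq[OF _ g' \<phi>(1)] wp by (simp add: weak_partial_def)
qed

text \<open>Partial derivatives of test functions are test functions, and against those
  \<open>D\<close> and \<open>g\<close> have equal integrals, both being derivatives of
  \<open>f\<close>. So \<open>h\<close> passes from \<open>g\<close> to \<open>D\<close> without
  showing that the two agree almost everywhere.\<close>

lemma weak_partial_of_weak_partial:
  assumes fD: "weak_partial \<Omega> f i D" and fg: "weak_partial \<Omega> f i g" and gh: "weak_partial \<Omega> g k h"
  shows "weak_partial \<Omega> D k h"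
  unfolding weak_partial_def
proof (intro conjI allI impI)
  show "loc_integrable \<Omega> D" "loc_integrable \<Omega> h" using fD gh by (auto simp: weak_partial_def)
  fix \<phi> assume \<phi>: "test_function \<Omega> \<phi>"
  note \<phi>' = test_function_partial_deriv[OF \<phi>, of k]
  have "(LINT x:\<Omega>|lebesgue. D x * partial_deriv k \<phi> x) = (LINT x:\<Omega>|lebesgue. g x * partial_deriv k \<phi> x)"
    using fD fg \<phi>' unfolding weak_partial_def by (metis neg_equal_iff_equal)
  also have "\<dots> = - (LINT x:\<Omega>|lebesgue. h x * \<phi> x)" using gh \<phi> unfolding weak_partial_def by blast
  finally show "(LINT x:\<Omega>|lebesgue. D x * partial_deriv k \<phi> x) = - (LINT x:\<Omega>|lebesgue. h x * \<phi> x)" .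
qed

text \<open>The Sobolev condition supplies first derivatives of its own choice, whereas
  \<open>Df\<close> is a given weak gradient; the second derivatives have to be attached to the
  latter.\<close>

lemma W2_vec_second_partials:
  fixes f :: "real^'n::finite \<Rightarrow> real^'m::finite" and Df :: "real^'n \<Rightarrow> real^'n^'m"
  assumes f: "W2_vec q \<Omega> f" and Df: "\<And>i j. weak_partial \<Omega> (\<lambda>x. f x $ j) i (\<lambda>x. Df x $ j $ i)"
  obtains G where "\<And>j i k. weak_partial \<Omega> (\<lambda>x. Df x $ j $ i) k (G j i k)" "\<And>j i k. Lp q \<Omega> (G j i k)"
proof -
  have "\<exists>h. weak_partial \<Omega> (\<lambda>x. Df x $ j $ i) k h \<and> Lp q \<Omega> h" for j i k
  proof -
    obtain g1 g2 where "weak_partial \<Omega> (\<lambda>x. f x $ j) i (g1 i)" "weak_partial \<Omega> (g1 i) k (g2 i k)" "Lp q \<Omega> (g2 i k)"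
      using f unfolding W2_vec_def W2_def by blast
    then show ?thesis using weak_partial_of_weak_partial[OF Df] by blast
  qed
  then show ?thesis using that by metis
qed

lemma AE_eq_Borel_matrix:
  fixes Df :: "real^'n::finite \<Rightarrow> real^'n^'n"
  assumes "\<And>i j. AE x in lborel. x \<in> \<Omega> \<longrightarrow> Df x $ i $ j = U i j x"
  shows "AE x in lborel. x \<in> \<Omega> \<longrightarrow> Df x = (\<chi> i j. U i j x)"
proof -
  have "AE x in lborel. \<forall>i\<in>UNIV. \<forall>j\<in>UNIV. x \<in> \<Omega> \<longrightarrow> Df x $ i $ j = U i j x"
    using assms by (intro AE_finite_allI) auto
  then show ?thesis by eventually_elim (auto simp: vec_eq_iff)
qed

section \<open>Comparison of cubes and balls\<close>

lemma cube_subset_cbox: "r \<le> R \<Longrightarrow> cube x r \<subseteq> cbox x (\<chi> i. x $ i + R)"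
  using cube_mono[of r R x] box_subset_cbox unfolding cube_def by blast

lemma cbox_subset_cball:
  fixes x :: "real^'n::finite" and r :: real
  shows "cbox x (\<chi> i. x $ i + r) \<subseteq> cball x (CARD('n) * r)"
proof
  fix y assume y: "y \<in> cbox x (\<chi> i. x $ i + r)"
  have "dist x y \<le> (\<Sum>i\<in>UNIV. \<bar>(y - x) $ i\<bar>)" using norm_le_l1_cart[of "y - x"] by (simp add: dist_norm norm_minus_commute)
  also have "\<dots> \<le> (\<Sum>i\<in>(UNIV::'n set). r)"
  proof (rule sum_mono)
    fix i
    have "x $ i \<le> y $ i \<and> y $ i \<le> x $ i + r" using y by (simp add: mem_box_cart)
    then show "\<bar>(y - x) $ i\<bar> \<le> r" by simp
  qed
  finally show "y \<in> cball x (CARD('n) * r)" by simp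
qed

lemma cube_subset_cball:
  fixes x :: "real^'n::finite" and r :: real
  shows "cube x r \<subseteq> cball x (CARD('n) * r)"
  using cube_subset_cbox[OF order_refl] cbox_subset_cball by blast

lemma cbox_in_open:
  fixes x :: "real^'n::finite"
  assumes "open \<Omega>" "x \<in> \<Omega>"
  obtains R :: real where "0 < R" "\<And>r. r \<le> R \<Longrightarrow> cbox x (\<chi> i. x $ i + r) \<subseteq> \<Omega>"
proof -
  obtain s where s: "s > 0" "cball x s \<subseteq> \<Omega>" using assms open_contains_cball by blast
  define R where "R = s / CARD('n)"
  have R: "0 < R" "CARD('n) * R = s" using s by (auto simp: R_def)
  have "cbox x (\<chi> i. x $ i + r) \<subseteq> \<Omega>" if "r \<le> R" for r :: real
  proof -
    have "cball x (CARD('n) * r) \<subseteq> cball x s"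
      unfolding R(2)[symmetric] by (intro subset_cball mult_left_mono that) auto
    then show ?thesis using cbox_subset_cball[of x r] s(2) by blast
  qed
  then show ?thesis using that[of R] R by simp
qed

text \<open>\<open>U\<close> and \<open>G\<close> are Borel representatives of the entries of the gradient and of their
  weak derivatives; replacing Lebesgue by Borel functions makes Fubini's theorem applicable.\<close>

locale borel_second_order =
  fixes \<Omega> :: "(real^'n::finite) set" and q :: real and Df :: "real^'n \<Rightarrow> real^'n^'n"
    and G :: "'n \<Rightarrow> 'n \<Rightarrow> 'n \<Rightarrow> real^'n \<Rightarrow> real"
    and U :: "'n \<Rightarrow> 'n \<Rightarrow> real^'n \<Rightarrow> real" and G' :: "'n \<Rightarrow> 'n \<Rightarrow> 'n \<Rightarrow> real^'n \<Rightarrow> real"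
  assumes \<Omega>: "open \<Omega>" and q: "1 < q"
    and weak: "\<And>i j k. weak_partial \<Omega> (\<lambda>x. Df x $ i $ j) k (G i j k)" and Lp: "\<And>i j k. Lp q \<Omega> (G i j k)"
    and U_borel [measurable]: "\<And>i j. U i j \<in> borel_measurable borel"
    and U: "\<And>i j. AE x in lborel. x \<in> \<Omega> \<longrightarrow> Df x $ i $ j = U i j x"
    and G_borel [measurable]: "\<And>i j k. G' i j k \<in> borel_measurable borel"
    and G: "\<And>i j k. AE x in lborel. x \<in> \<Omega> \<longrightarrow> G i j k x = G' i j k x"
begin

lemma \<Omega>_borel [measurable]: "\<Omega> \<in> sets borel"
  using \<Omega> by simp

text \<open>The sum over \<open>k\<close> stays inside the power because the Poincare inequality
  controls each gradient entry by the sum of its derivatives, to which Hoelder's inequality is then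
  applied. Off \<open>\<Omega>\<close> nothing is known about \<open>G'\<close>, hence the
  indicator.\<close>

definition energy :: "real^'n \<Rightarrow> ennreal" where
  "energy x = (\<Sum>i\<in>UNIV. \<Sum>j\<in>UNIV. ennreal ((\<Sum>k\<in>UNIV. \<bar>G' i j k x\<bar>) powr q)) * indicator \<Omega> x"

lemma energy_borel [measurable]: "energy \<in> borel_measurable borel"
  unfolding energy_def by measurable

lemma energy_ge: "x \<in> \<Omega> \<Longrightarrow> ennreal ((\<Sum>k\<in>UNIV. \<bar>G' i j k x\<bar>) powr q) \<le> energy x"
proof -
  assume x: "x \<in> \<Omega>"
  have "ennreal ((\<Sum>k\<in>UNIV. \<bar>G' i j k x\<bar>) powr q) \<le> (\<Sum>j\<in>UNIV. ennreal ((\<Sum>k\<in>UNIV. \<bar>G' i j k x\<bar>) powr q))"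
    by (rule member_le_sum[of j UNIV "\<lambda>j. ennreal ((\<Sum>k\<in>UNIV. \<bar>G' i j k x\<bar>) powr q)"]) auto
  also have "\<dots> \<le> (\<Sum>i\<in>UNIV. \<Sum>j\<in>UNIV. ennreal ((\<Sum>k\<in>UNIV. \<bar>G' i j k x\<bar>) powr q))"
    by (rule member_le_sum[of i UNIV "\<lambda>i. \<Sum>j\<in>UNIV. ennreal ((\<Sum>k\<in>UNIV. \<bar>G' i j k x\<bar>) powr q)"]) auto
  finally show ?thesis using x by (simp add: energy_def)
qed

lemma nn_integral_energy_finite: "(\<integral>\<^sup>+x. energy x \<partial>lborel) < \<infinity>"
proof -
  let ?N = "CARD('n)"
  have fin: "(\<integral>\<^sup>+x. ennreal (\<bar>G' i j k x\<bar> powr q) * indicator \<Omega> x \<partial>lborel) < \<infinity>" for i j k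
  proof -
    have "(\<integral>\<^sup>+x. ennreal (\<bar>G' i j k x\<bar> powr q) * indicator \<Omega> x \<partial>lborel)
        = (\<integral>\<^sup>+x. ennreal (norm (indicator \<Omega> x *\<^sub>R \<bar>G i j k x\<bar> powr q)) \<partial>lborel)"
      by (rule nn_integral_cong_AE, use G[of i j k] in eventually_elim) (auto split: split_indicator)
    also have "\<dots> = (\<integral>\<^sup>+x. ennreal (norm (indicator \<Omega> x *\<^sub>R \<bar>G i j k x\<bar> powr q)) \<partial>lebesgue)"
      by (simp add: nn_integral_completion)
    also have "\<dots> < \<infinity>"
      using Lp[of i j k] unfolding Lp_def set_integrable_def integrable_iff_bounded by blast
    finally show ?thesis .
  qed
  have "(\<integral>\<^sup>+x. energy x \<partial>lborel) \<le>
      (\<integral>\<^sup>+x. (\<Sum>i\<in>UNIV. \<Sum>j\<in>UNIV. \<Sum>k\<in>UNIV. ennreal (?N powr q) * (ennreal (\<bar>G' i j k x\<bar> powr q) * indicator \<Omega> x)) \<partial>lborel)"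
  proof (rule nn_integral_mono)
    fix x
    have "ennreal ((\<Sum>k\<in>UNIV. \<bar>G' i j k x\<bar>) powr q) \<le> (\<Sum>k\<in>UNIV. ennreal (?N powr q) * ennreal (\<bar>G' i j k x\<bar> powr q))" for i j
    proof -
      have "ennreal ((\<Sum>k\<in>UNIV. \<bar>G' i j k x\<bar>) powr q) \<le> ennreal (?N powr q * (\<Sum>k\<in>UNIV. \<bar>G' i j k x\<bar> powr q))"
        using q by (intro ennreal_leI sum_powr_le) auto
      also have "\<dots> = (\<Sum>k\<in>UNIV. ennreal (?N powr q) * ennreal (\<bar>G' i j k x\<bar> powr q))"
        by (simp add: ennreal_mult[symmetric] sum_nonneg sum_distrib_left)
      finally show ?thesis .
    qed
    then show "energy x \<le> (\<Sum>i\<in>UNIV. \<Sum>j\<in>UNIV. \<Sum>k\<in>UNIV. ennreal (?N powr q) * (ennreal (\<bar>G' i j k x\<bar> powr q) * indicator \<Omega> x))"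
      unfolding energy_def by (cases "x \<in> \<Omega>") (simp_all del: sum_ennreal add: sum_mono)
  qed
  also have "\<dots> = (\<Sum>i\<in>UNIV. \<Sum>j\<in>UNIV. \<Sum>k\<in>UNIV. ennreal (?N powr q) * (\<integral>\<^sup>+x. ennreal (\<bar>G' i j k x\<bar> powr q) * indicator \<Omega> x \<partial>lborel))"
    by (simp add: nn_integral_sum nn_integral_cmult)
  also have "\<dots> < \<infinity>"
    using fin by (simp add: ennreal_mult_less_top)
  finally show ?thesis .
qed

lemma loc_integrable_Df: "loc_integrable \<Omega> (\<lambda>x. Df x $ i $ j)"
  and loc_integrable_G: "loc_integrable \<Omega> (G i j k)"
  using weak[of i j k] by (simp_all add: weak_partial_def)

lemma AE_Df: "AE x in lborel. x \<in> \<Omega> \<longrightarrow> Df x = (\<chi> i j. U i j x)"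
  by (rule AE_eq_Borel_matrix[OF U])

text \<open>If \<open>det (Df y)\<close> were not integrable near \<open>x\<close>, its Lebesgue integral over balls would have
  the junk value 0, and \<open>precise_value\<close> would say nothing about \<open>Df\<close>.\<close>

lemma integrable_det_near:
  assumes q2: "real CARD('n) / 2 < q" "q \<le> real CARD('n)" and x: "x \<in> \<Omega>"
  shows "\<exists>s>0. set_integrable lebesgue (ball x s) (\<lambda>y. det (Df y))"
proof -
  let ?N = "CARD('n)"
  obtain \<rho> where \<rho>: "0 < \<rho>" "cball x \<rho> \<subseteq> \<Omega>" using \<Omega> x open_contains_cball by blast
  \<comment> \<open>Points of \<open>K\<close> differ from \<open>x\<close> by at most
    \<open>2 * R\<close> in each coordinate, hence by at most \<open>2 * n * R\<close> in norm,
    which is below \<rho>.\<close>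
  define R where "R = \<rho> / (2 * real ?N + 1)"
  have R: "0 < R" "(2 * real ?N + 1) * R = \<rho>" using \<rho> by (auto simp: R_def)
  \<comment> \<open>Cubes are addressed by their corners but a ball about \<open>x\<close> has to
    fit inside, so the corner is moved to make \<open>x\<close> the centre of
    \<open>cube z R\<close>.\<close>
  define z where "z = (\<chi> i. x $ i - R / 2)"
  define K where "K = cbox z (\<chi> i. z $ i + 2 * R)"
  have K\<Omega>: "K \<subseteq> \<Omega>"
  proof
    fix y assume y: "y \<in> K"
    have "dist x y \<le> (\<Sum>i\<in>UNIV. \<bar>(y - x) $ i\<bar>)" using norm_le_l1_cart[of "y - x"] by (simp add: dist_norm norm_minus_commute)
    also have "\<dots> \<le> (\<Sum>i\<in>(UNIV::'n set). 2 * R)"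
    proof (rule sum_mono)
      fix i
      have "x $ i - R / 2 \<le> y $ i \<and> y $ i \<le> x $ i - R / 2 + 2 * R" using y by (simp add: K_def z_def mem_box_cart)
      then show "\<bar>(y - x) $ i\<bar> \<le> 2 * R" using R(1) by (auto simp: abs_le_iff)
    qed
    also have "\<dots> \<le> \<rho>" using R by (simp add: algebra_simps)
    finally show "y \<in> \<Omega>" using \<rho>(2) by auto
  qed
  have Kc: "compact K" by (simp add: K_def)
  have KQ: "cube z (2 * R) \<subseteq> K" unfolding K_def by (rule cube_subset_cbox) simp
  define u where "u i j y = indicator K y * U i j y" for i j y
  define g where "g i j k y = indicator K y * G' i j k y" for i j k y
  have u_int: "integrable lborel (u i j)" for i j
    unfolding u_def by (rule loc_integrable_cutoff[OF loc_integrable_Df Kc K\<Omega> U_borel U])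
  have g_int: "integrable lborel (g i j k)" for i j k
    unfolding g_def by (rule loc_integrable_cutoff[OF loc_integrable_G Kc K\<Omega> G_borel G])
  have wk: "(\<integral>y. u i j y * partial_deriv k \<phi> y \<partial>lborel) = - (\<integral>y. g i j k y * \<phi> y \<partial>lborel)"
    if "test_function (cube z (2 * R)) \<phi>" for i j k \<phi>
    unfolding u_def g_def
    by (rule weak_partial_cutoff[OF \<Omega> weak Kc K\<Omega> U_borel U G_borel G that KQ])
  obtain E where E: "0 < E" "(\<integral>\<^sup>+x. energy x \<partial>lborel) \<le> ennreal E"
  proof -
    have "(\<integral>\<^sup>+x. energy x \<partial>lborel) = ennreal (enn2real (\<integral>\<^sup>+x. energy x \<partial>lborel))"
      using nn_integral_energy_finite by (simp add: less_top)
    also have "\<dots> \<le> ennreal (enn2real (\<integral>\<^sup>+x. energy x \<partial>lborel) + 1)" by (intro ennreal_leI) simp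
    finally show ?thesis using that[of "enn2real (\<integral>\<^sup>+x. energy x \<partial>lborel) + 1"] by (simp add: add_nonneg_pos)
  qed
  have Ln: "(\<integral>\<^sup>+y\<in>cube z R. ennreal (\<bar>u i j y\<bar> ^ ?N) \<partial>lborel) < \<infinity>" for i j
  proof (rule W1q_imp_local_Ln[OF u_int g_int wk R(1) q q2 E(1)])
    have "(\<integral>\<^sup>+y. ennreal ((\<Sum>k\<in>UNIV. \<bar>g i j k y\<bar>) powr q) \<partial>lborel) \<le> (\<integral>\<^sup>+y. energy y \<partial>lborel)"
    proof (rule nn_integral_mono)
      fix y
      show "ennreal ((\<Sum>k\<in>UNIV. \<bar>g i j k y\<bar>) powr q) \<le> energy y"
        using energy_ge[of y i j] K\<Omega> by (cases "y \<in> K") (auto simp: g_def)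
    qed
    then show "(\<integral>\<^sup>+y. ennreal ((\<Sum>k\<in>UNIV. \<bar>g i j k y\<bar>) powr q) \<partial>lborel) \<le> ennreal E"
      using E(2) by (rule order_trans)
  qed
  define s where "s = R / 4"
  have s: "0 < s" using R by (simp add: s_def)
  have ball_sub: "ball x s \<subseteq> cube z R"
  proof
    fix y assume "y \<in> ball x s"
    then have "norm (y - x) < s" by (simp add: dist_norm norm_minus_commute)
    have "z $ i < y $ i \<and> y $ i < z $ i + R" for i
    proof -
      have "\<bar>y $ i - x $ i\<bar> < R / 4"
        using component_le_norm_cart[of "y - x" i] \<open>norm (y - x) < s\<close> by (simp add: s_def)
      then have "x $ i - R / 2 < y $ i \<and> y $ i < x $ i - R / 2 + R" using R(1) by linarith
      then show ?thesis by (simp add: z_def)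
    qed
    then show "y \<in> cube z R" by (simp add: mem_cube)
  qed
  have QK: "cube z R \<subseteq> K" using KQ cube_mono[of R "2 * R" z] R(1) by simp
  have bs\<Omega>: "ball x s \<subseteq> \<Omega>" using ball_sub QK K\<Omega> by blast
  have [measurable]: "u i j \<in> borel_measurable borel" for i j using u_int by auto
  let ?det = "\<lambda>y. det (\<chi> i j. U i j y)"
  have "?det \<in> borel_measurable borel" by (rule measurable_det) (rule U_borel)
  then have m: "(\<lambda>y. indicator (ball x s) y *\<^sub>R ?det y) \<in> borel_measurable lborel"
    unfolding measurable_lborel1 by (intro borel_measurable_scaleR borel_measurable_indicator) auto
  have "integrable lborel (\<lambda>y. indicator (ball x s) y *\<^sub>R ?det y)"
  proof (rule integrableI_bounded)
    have "(\<integral>\<^sup>+y. ennreal (norm (indicator (ball x s) y *\<^sub>R ?det y)) \<partial>lborel) \<le>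
        (\<integral>\<^sup>+y. (\<Sum>i\<in>UNIV. \<Sum>j\<in>UNIV. ennreal (fact ?N) * (ennreal (\<bar>u i j y\<bar> ^ ?N) * indicator (cube z R) y)) \<partial>lborel)"
    proof (rule nn_integral_mono)
      fix y
      show "ennreal (norm (indicator (ball x s) y *\<^sub>R ?det y)) \<le>
        (\<Sum>i\<in>UNIV. \<Sum>j\<in>UNIV. ennreal (fact ?N) * (ennreal (\<bar>u i j y\<bar> ^ ?N) * indicator (cube z R) y))"
      proof (cases "y \<in> ball x s")
        case True
        then have yQ: "y \<in> cube z R" "y \<in> K" using ball_sub QK by auto
        have "ennreal \<bar>?det y\<bar> \<le> ennreal (fact ?N * (\<Sum>i\<in>UNIV. \<Sum>j\<in>UNIV. \<bar>U i j y\<bar> ^ ?N))"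
          using abs_det_le_sum_powers[of "\<chi> i j. U i j y"] by (intro ennreal_leI) simp
        also have "\<dots> = (\<Sum>i\<in>UNIV. \<Sum>j\<in>UNIV. ennreal (fact ?N) * ennreal (\<bar>U i j y\<bar> ^ ?N))"
          by (simp add: ennreal_mult[symmetric] sum_nonneg sum_distrib_left)
        finally show ?thesis using True yQ by (simp add: u_def)
      qed simp
    qed
    also have "\<dots> = (\<Sum>i\<in>UNIV. \<Sum>j\<in>UNIV. ennreal (fact ?N) * (\<integral>\<^sup>+y\<in>cube z R. ennreal (\<bar>u i j y\<bar> ^ ?N) \<partial>lborel))"
      by (simp add: nn_integral_sum nn_integral_cmult)
    also have "\<dots> < \<infinity>" using Ln by (simp add: ennreal_mult_less_top)
    finally show "(\<integral>\<^sup>+y. ennreal (norm (indicator (ball x s) y *\<^sub>R ?det y)) \<partial>lborel) < \<infinity>" .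
  qed (rule m)
  then have i: "integrable lebesgue (\<lambda>y. indicator (ball x s) y *\<^sub>R ?det y)"
    using integrable_completion[OF m] by blast
  have "AE y in lborel. indicator (ball x s) y *\<^sub>R ?det y = indicator (ball x s) y *\<^sub>R det (Df y)"
    using AE_Df bs\<Omega> by (auto elim!: eventually_mono split: split_indicator)
  then have ae: "AE y in lebesgue. indicator (ball x s) y *\<^sub>R ?det y = indicator (ball x s) y *\<^sub>R det (Df y)"
    by (rule AE_completion)
  \<comment> \<open>The entries of \<open>Df\<close> are known to be measurable only after cutting
    off at \<open>\<Omega>\<close>; the determinant of the cut-off entries is the same on the
    ball.\<close>
  have "(\<lambda>y. indicator (ball x s) y *\<^sub>R det (Df y)) \<in> borel_measurable lebesgue"
  proof -
    note [measurable] = loc_integrable_measurable[OF \<Omega> loc_integrable_Df]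
    have b [measurable]: "(\<lambda>y. indicator (ball x s) y :: real) \<in> borel_measurable lebesgue"
      by (intro measurable_completion borel_measurable_indicator) simp
    have "(\<lambda>y. indicator (ball x s) y * det (\<chi> i j. indicator \<Omega> y * Df y $ i $ j)) \<in> borel_measurable lebesgue"
      by measurable
    also have "(\<lambda>y. indicator (ball x s) y * det (\<chi> i j. indicator \<Omega> y * Df y $ i $ j))
        = (\<lambda>y. indicator (ball x s) y *\<^sub>R det (Df y))"
      using bs\<Omega> by (auto simp: fun_eq_iff split: split_indicator)
    finally show ?thesis .
  qed
  then have "integrable lebesgue (\<lambda>y. indicator (ball x s) y *\<^sub>R det (Df y))"
    using integrable_cong_AE[OF borel_measurable_integrable[OF i] _ ae] i by blast
  then show ?thesis using s by (auto simp: set_integrable_def)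
qed

end

section \<open>The zero set of the Jacobian\<close>

context borel_second_order
begin

text \<open>Since \<open>small\<close> is all that is asked of the points of \<open>Z\<close>, the
  continuous and the precise representative are treated alike.\<close>

lemma singular_set_null:
  fixes a d :: real
  assumes d: "0 < d" "d < CARD('n)" and a: "0 < a"
    and \<beta>: "0 < 1 - (CARD('n) - d) / q" "CARD('n) - d \<le> (1 - (CARD('n) - d) / q) * a"
    and J: "(\<integral>\<^sup>+x\<in>\<Omega>. neg_pow a (det (Df x)) \<partial>lebesgue) < \<infinity>"
    and Z: "Z \<subseteq> \<Omega>"
    and small: "\<And>x c. x \<in> Z \<Longrightarrow> 0 < c \<Longrightarrow> \<exists>\<delta>>0. \<forall>r. 0 < r \<and> r \<le> \<delta> \<longrightarrow>
      (\<integral>\<^sup>+y\<in>cube x r. ennreal \<bar>det (Df y)\<bar> \<partial>lebesgue) \<le> ennreal (c * r ^ CARD('n))"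
  shows "hausdorff_measure d Z = 0"
proof -
  let ?N = "CARD('n)" and ?n = "real CARD('n)"
  let ?D = "\<lambda>y. det (\<chi> i j. U i j y)"
  \<comment> \<open>A single density, so that outside one null set the energy and the negative power
    of the Jacobian are small together.\<close>
  define h where "h y = energy y + neg_pow a (?D y) * indicator \<Omega> y" for y
  have [measurable]: "h \<in> borel_measurable borel" unfolding h_def by measurable
  have h_fin: "(\<integral>\<^sup>+y. h y \<partial>lborel) < \<infinity>"
  proof -
    have "(\<integral>\<^sup>+y. h y \<partial>lborel) = (\<integral>\<^sup>+y. energy y \<partial>lborel) + (\<integral>\<^sup>+y. neg_pow a (?D y) * indicator \<Omega> y \<partial>lborel)"
      unfolding h_def by (rule nn_integral_add) measurable
    also have "(\<integral>\<^sup>+y. neg_pow a (?D y) * indicator \<Omega> y \<partial>lborel) = (\<integral>\<^sup>+y. neg_pow a (det (Df y)) * indicator \<Omega> y \<partial>lborel)"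
      by (rule nn_integral_cong_AE, use AE_Df in eventually_elim) (auto split: split_indicator)
    also have "\<dots> = (\<integral>\<^sup>+x\<in>\<Omega>. neg_pow a (det (Df x)) \<partial>lebesgue)" by (simp add: nn_integral_completion)
    finally show ?thesis using nn_integral_energy_finite J by simp
  qed
  define \<mu> where "\<mu> = density lborel h"
  have null: "hausdorff_measure d {x. \<not> (\<forall>c>0. \<exists>\<delta>>0. \<forall>r. 0 < r \<and> r \<le> \<delta> \<longrightarrow> emeasure \<mu> (cball x r) < ennreal (c * r powr d))} = 0"
  proof (rule ae_vanishing_upper_density)
    show "sets \<mu> = sets borel" by (simp add: \<mu>_def)
    show "emeasure \<mu> (space \<mu>) \<noteq> \<infinity>" using h_fin by (simp add: \<mu>_def emeasure_density)
    show "absolutely_continuous lborel \<mu>" unfolding \<mu>_def by (rule absolutely_continuousI_density) simp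
  qed (use d in auto)
  have False if x: "x \<in> Z"
    and dens: "\<forall>c>0. \<exists>\<delta>>0. \<forall>r. 0 < r \<and> r \<le> \<delta> \<longrightarrow> emeasure \<mu> (cball x r) < ennreal (c * r powr d)" for x
  proof -
    have cubes: "\<exists>\<delta>>0. \<forall>r. 0 < r \<and> r \<le> \<delta> \<longrightarrow> (\<integral>\<^sup>+y\<in>cube x r. h y \<partial>lborel) \<le> ennreal (c * r powr d)" if c: "0 < c" for c
    proof -
      \<comment> \<open>The density is known for balls, and \<open>cube x r\<close> lies in the ball
        of radius \<open>n * r\<close>; this costs the factor \<open>n powr d\<close>.\<close>
      have "0 < c / ?n powr d" using c by simp
      then obtain \<delta> where \<delta>: "\<delta> > 0" "\<And>r. 0 < r \<Longrightarrow> r \<le> \<delta> \<Longrightarrow> emeasure \<mu> (cball x r) < ennreal (c / ?n powr d * r powr d)"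
        using dens by blast
      have "(\<integral>\<^sup>+y\<in>cube x r. h y \<partial>lborel) \<le> ennreal (c * r powr d)" if r: "0 < r" "r \<le> \<delta> / ?n" for r
      proof -
        have "(\<integral>\<^sup>+y\<in>cube x r. h y \<partial>lborel) \<le> (\<integral>\<^sup>+y\<in>cball x (?n * r). h y \<partial>lborel)"
          using cube_subset_cball[of x r] by (intro nn_integral_mono) (auto split: split_indicator)
        also have "\<dots> = emeasure \<mu> (cball x (?n * r))" by (simp add: \<mu>_def emeasure_density)
        also have "\<dots> \<le> ennreal (c / ?n powr d * (?n * r) powr d)"
          by (rule less_imp_le, rule \<delta>(2)) (use r in \<open>auto simp: field_simps\<close>)
        also have "c / ?n powr d * (?n * r) powr d = c * r powr d" using r by (simp add: powr_mult)
        finally show ?thesis .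
      qed
      then show ?thesis using \<delta>(1) by (intro exI[of _ "\<delta> / ?n"]) auto
    qed
    obtain R0 where R0: "0 < R0" "\<And>r. r \<le> R0 \<Longrightarrow> cbox x (\<chi> i. x $ i + r) \<subseteq> \<Omega>"
    proof -
      have "x \<in> \<Omega>" using x Z by blast
      from cbox_in_open[OF \<Omega> this] that show thesis by metis
    qed
    \<comment> \<open>Level 1 is enough for the energy and fixes the scale \<open>R\<close>;
      arbitrarily small levels serve the negative power.\<close>
    obtain \<delta>1 where \<delta>1: "0 < \<delta>1" "\<And>r. 0 < r \<Longrightarrow> r \<le> \<delta>1 \<Longrightarrow> (\<integral>\<^sup>+y\<in>cube x r. h y \<partial>lborel) \<le> ennreal (1 * r powr d)"
      using cubes[of 1] by auto
    define R where "R = min R0 \<delta>1"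
    have R: "0 < R" "R \<le> R0" "R \<le> \<delta>1" using R0(1) \<delta>1(1) by (auto simp: R_def)
    define K where "K = cbox x (\<chi> i. x $ i + R)"
    have K: "compact K" "K \<subseteq> \<Omega>" using R0(2)[OF R(2)] by (simp_all add: K_def)
    have QK: "cube x r \<subseteq> K" if "r \<le> R" for r unfolding K_def by (rule cube_subset_cbox[OF that])
    define u where "u i j y = indicator K y * U i j y" for i j y
    define g where "g i j k y = indicator K y * G' i j k y" for i j k y
    have uU: "u i j y = U i j y" and gG: "g i j k y = G' i j k y" if "y \<in> cube x r" "r \<le> R" for i j k y r
      using subsetD[OF QK[OF that(2)] that(1)] by (simp_all add: u_def g_def)
    show False
    proof (rule no_singular_point_of_low_density[where u = u and g = g and x = x and R = R and q = q and d = d and a = a])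
      show "integrable lborel (u i j)" for i j
        unfolding u_def by (rule loc_integrable_cutoff[OF loc_integrable_Df K U_borel U])
      show "integrable lborel (g i j k)" for i j k
        unfolding g_def by (rule loc_integrable_cutoff[OF loc_integrable_G K G_borel G])
      show "(\<integral>y. u i j y * partial_deriv k \<phi> y \<partial>lborel) = - (\<integral>y. g i j k y * \<phi> y \<partial>lborel)"
        if "test_function (cube x R) \<phi>" for i j k \<phi>
        unfolding u_def g_def
        by (rule weak_partial_cutoff[OF \<Omega> weak K U_borel U G_borel G that QK]) simp
      show "(\<integral>\<^sup>+y\<in>cube x r. ennreal ((\<Sum>k\<in>UNIV. \<bar>g i j k y\<bar>) powr q) \<partial>lborel) \<le> ennreal (r powr d)"
        if r: "0 < r" "r \<le> R" for i j r
      proof -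
        have "(\<integral>\<^sup>+y\<in>cube x r. ennreal ((\<Sum>k\<in>UNIV. \<bar>g i j k y\<bar>) powr q) \<partial>lborel) \<le> (\<integral>\<^sup>+y\<in>cube x r. h y \<partial>lborel)"
        proof (rule nn_integral_mono)
          fix y
          show "ennreal ((\<Sum>k\<in>UNIV. \<bar>g i j k y\<bar>) powr q) * indicator (cube x r) y \<le> h y * indicator (cube x r) y"
          proof (cases "y \<in> cube x r")
            case True
            then have "y \<in> \<Omega>" using QK[OF r(2)] K(2) by blast
            from energy_ge[OF this, of i j] have "ennreal ((\<Sum>k\<in>UNIV. \<bar>g i j k y\<bar>) powr q) \<le> energy y"
              using gG[OF True r(2)] by simp
            then show ?thesis using True by (simp add: h_def add_increasing2)
          qed simp
        qed
        also have "\<dots> \<le> ennreal (r powr d)" using \<delta>1(2)[of r] r R(3) by simp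
        finally show ?thesis .
      qed
      show "\<exists>\<delta>>0. \<forall>r. 0 < r \<and> r \<le> \<delta> \<longrightarrow>
          (\<integral>\<^sup>+y\<in>cube x r. neg_pow a (det (\<chi> i j. u i j y)) \<partial>lborel) \<le> ennreal (c * r powr d)" if c: "0 < c" for c
      proof -
        obtain \<delta> where \<delta>: "\<delta> > 0" "\<And>r. 0 < r \<Longrightarrow> r \<le> \<delta> \<Longrightarrow> (\<integral>\<^sup>+y\<in>cube x r. h y \<partial>lborel) \<le> ennreal (c * r powr d)"
          using cubes[OF c] by blast
        have "(\<integral>\<^sup>+y\<in>cube x r. neg_pow a (det (\<chi> i j. u i j y)) \<partial>lborel) \<le> ennreal (c * r powr d)"
          if r: "0 < r" "r \<le> min \<delta> R" for r
        proof -
          have "(\<integral>\<^sup>+y\<in>cube x r. neg_pow a (det (\<chi> i j. u i j y)) \<partial>lborel) \<le> (\<integral>\<^sup>+y\<in>cube x r. h y \<partial>lborel)"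
          proof (rule nn_integral_mono)
            fix y
            show "neg_pow a (det (\<chi> i j. u i j y)) * indicator (cube x r) y \<le> h y * indicator (cube x r) y"
            proof (cases "y \<in> cube x r")
              case True
              then have "y \<in> \<Omega>" using QK[of r] r(2) K(2) by auto
              then show ?thesis using True uU[OF True] r(2) by (simp add: h_def add_increasing)
            qed simp
          qed
          also have "\<dots> \<le> ennreal (c * r powr d)" using \<delta>(2)[of r] r by simp
          finally show ?thesis .
        qed
        then show ?thesis using \<delta>(1) R(1) by (intro exI[of _ "min \<delta> R"]) auto
      qed
      show "\<exists>\<delta>>0. \<forall>r. 0 < r \<and> r \<le> \<delta> \<longrightarrow>
          (\<integral>\<^sup>+y\<in>cube x r. ennreal \<bar>det (\<chi> i j. u i j y)\<bar> \<partial>lborel) \<le> ennreal (c * r ^ ?N)" if c: "0 < c" for c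
      proof -
        obtain \<delta> where \<delta>: "\<delta> > 0" "\<And>r. 0 < r \<Longrightarrow> r \<le> \<delta> \<Longrightarrow>
            (\<integral>\<^sup>+y\<in>cube x r. ennreal \<bar>det (Df y)\<bar> \<partial>lebesgue) \<le> ennreal (c * r ^ ?N)"
          using small[OF x c] by blast
        have "(\<integral>\<^sup>+y\<in>cube x r. ennreal \<bar>det (\<chi> i j. u i j y)\<bar> \<partial>lborel) \<le> ennreal (c * r ^ ?N)"
          if r: "0 < r" "r \<le> min \<delta> R" for r
        proof -
          have "(\<integral>\<^sup>+y\<in>cube x r. ennreal \<bar>det (\<chi> i j. u i j y)\<bar> \<partial>lborel) = (\<integral>\<^sup>+y\<in>cube x r. ennreal \<bar>det (Df y)\<bar> \<partial>lborel)"
          proof (rule nn_integral_cong_AE, use AE_Df in eventually_elim)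
            fix y assume "y \<in> \<Omega> \<longrightarrow> Df y = (\<chi> i j. U i j y)"
            then show "ennreal \<bar>det (\<chi> i j. u i j y)\<bar> * indicator (cube x r) y = ennreal \<bar>det (Df y)\<bar> * indicator (cube x r) y"
              using QK[of r] r(2) K(2) uU[of y r] by (cases "y \<in> cube x r") auto
          qed
          also have "\<dots> = (\<integral>\<^sup>+y\<in>cube x r. ennreal \<bar>det (Df y)\<bar> \<partial>lebesgue)" by (simp add: nn_integral_completion)
          also have "\<dots> \<le> ennreal (c * r ^ ?N)" using \<delta>(2)[of r] r by simp
          finally show ?thesis .
        qed
        then show ?thesis using \<delta>(1) R(1) by (intro exI[of _ "min \<delta> R"]) auto
      qed
    qed (use R(1) less_imp_le[OF q] a \<beta> in \<open>simp_all\<close>)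
  qed
  then show ?thesis by (intro hausdorff_measure_null_subset[OF null]) blast
qed

end

section \<open>Two notions of a zero of the Jacobian\<close>

lemma continuous_on_det:
  fixes D :: "'a::topological_space \<Rightarrow> real^'n::finite^'n"
  assumes "continuous_on S D" shows "continuous_on S (\<lambda>x. det (D x))"
  unfolding det_def by (intro continuous_intros assms)

text \<open>The integrals do not distinguish \<open>Df\<close> from \<open>Dc\<close>, so continuity
  of \<open>det (Dc y)\<close> at its zero bounds them although the value \<open>Df x\<close> itself
  is arbitrary.\<close>

lemma small_det_of_continuous:
  fixes Dc :: "real^'n::finite \<Rightarrow> real^'n^'n"
  assumes \<Omega>: "open \<Omega>" and cont: "continuous_on \<Omega> Dc" and eq: "AE x in lebesgue. x \<in> \<Omega> \<longrightarrow> Dc x = Df x"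
    and x: "x \<in> \<Omega>" "det (Dc x) = 0" and c: "0 < c"
  shows "\<exists>\<delta>>0. \<forall>r. 0 < r \<and> r \<le> \<delta> \<longrightarrow>
      (\<integral>\<^sup>+y\<in>cube x r. ennreal \<bar>det (Df y)\<bar> \<partial>lebesgue) \<le> ennreal (c * r ^ CARD('n))"
proof -
  have "isCont (\<lambda>y. det (Dc y)) x"
    using continuous_on_det[OF cont] \<Omega> x(1) by (simp add: continuous_on_eq_continuous_at)
  then obtain s where s: "0 < s" "\<And>y. dist y x < s \<Longrightarrow> \<bar>det (Dc y)\<bar> < c"
    using x(2) c unfolding continuous_at_eps_delta by (auto simp: dist_real_def)
  obtain t where t: "0 < t" "cball x t \<subseteq> \<Omega>" using \<Omega> x(1) open_contains_cball by blast
  define \<delta> where "\<delta> = min (s / 2) t / CARD('n)"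
  have \<delta>: "0 < \<delta>" using s t by (simp add: \<delta>_def)
  have "(\<integral>\<^sup>+y\<in>cube x r. ennreal \<bar>det (Df y)\<bar> \<partial>lebesgue) \<le> ennreal (c * r ^ CARD('n))" if r: "0 < r" "r \<le> \<delta>" for r
  proof -
    have nr: "CARD('n) * r \<le> min (s / 2) t" using r by (simp add: \<delta>_def field_simps)
    have "(\<integral>\<^sup>+y\<in>cube x r. ennreal \<bar>det (Df y)\<bar> \<partial>lebesgue) \<le> (\<integral>\<^sup>+y. ennreal c * indicator (cube x r) y \<partial>lebesgue)"
    proof (rule nn_integral_mono_AE, use eq in eventually_elim)
      fix y assume y: "y \<in> \<Omega> \<longrightarrow> Dc y = Df y"
      show "ennreal \<bar>det (Df y)\<bar> * indicator (cube x r) y \<le> ennreal c * indicator (cube x r) y"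
      proof (cases "y \<in> cube x r")
        case True
        then have d: "dist x y \<le> min (s / 2) t" using cube_subset_cball[of x r] nr by fastforce
        then have "y \<in> \<Omega>" using t(2) by auto
        moreover have "\<bar>det (Dc y)\<bar> < c" using d s(1) by (intro s(2)) (simp add: dist_commute)
        ultimately show ?thesis using y True by (simp add: ennreal_leI)
      qed simp
    qed
    also have "\<dots> = (\<integral>\<^sup>+y. ennreal c * indicator (cube x r) y \<partial>lborel)" by (simp add: nn_integral_completion)
    also have "\<dots> = ennreal (c * r ^ CARD('n))"
      using r c by (simp add: nn_integral_cmult_indicator emeasure_cube ennreal_mult)
    finally show ?thesis .
  qed
  then show ?thesis using \<delta> by blast
qed

text \<open>Integrability near \<open>x\<close> guarantees that the ball averages are genuine and
  not the default value 0. Each cube lies in a ball of comparable volume, so smallness passes from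
  balls to cubes.\<close>

lemma small_det_of_precise_value:
  fixes J :: "real^'n::finite \<Rightarrow> real"
  assumes pv: "precise_value J x 0" and int: "0 < s" "set_integrable lebesgue (ball x s) J" and c: "0 < c"
  shows "\<exists>\<delta>>0. \<forall>r. 0 < r \<and> r \<le> \<delta> \<longrightarrow>
      (\<integral>\<^sup>+y\<in>cube x r. ennreal \<bar>J y\<bar> \<partial>lebesgue) \<le> ennreal (c * r ^ CARD('n))"
proof -
  let ?N = "CARD('n)"
  let ?v = "unit_ball_vol (real ?N)"
  \<comment> \<open>The divisor is the ratio of the volume of the ball of radius
    \<open>2 * n * r\<close> to that of the cube of side \<open>r\<close>.\<close>
  define c' where "c' = c / (?v * (2 * real ?N) ^ ?N)"
  have v: "?v \<noteq> 0" using unit_ball_vol_pos[of "real ?N"] by linarith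
  have c': "0 < c'" using c by (simp add: c'_def)
  have "((\<lambda>r. ball_avg (\<lambda>y. \<bar>J y - 0\<bar>) x r) \<longlongrightarrow> 0) (at_right 0)" using pv by (simp add: precise_value_def)
  then have "\<forall>\<^sub>F r in at_right 0. ball_avg (\<lambda>y. \<bar>J y - 0\<bar>) x r < c'" using c' by (rule order_tendstoD)
  then obtain b where b: "0 < b" "\<And>r. 0 < r \<Longrightarrow> r < b \<Longrightarrow> ball_avg (\<lambda>y. \<bar>J y\<bar>) x r < c'"
    unfolding eventually_at_right_field by auto
  \<comment> \<open>With the divisor \<open>4 * n\<close>, the radius \<open>t = 2 * n * r\<close>
    satisfies \<open>2 * t \<le> min b s\<close> and so lies strictly below both bounds.\<close>
  define \<delta> where "\<delta> = min b s / (4 * real ?N)"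
  have \<delta>: "0 < \<delta>" using b(1) int(1) by (simp add: \<delta>_def)
  have "(\<integral>\<^sup>+y\<in>cube x r. ennreal \<bar>J y\<bar> \<partial>lebesgue) \<le> ennreal (c * r ^ ?N)" if r: "0 < r" "r \<le> \<delta>" for r
  proof -
    define t where "t = 2 * real ?N * r"
    have t0: "0 < t" using r by (simp add: t_def)
    have "4 * real ?N * r \<le> min b s" using r by (simp add: \<delta>_def field_simps)
    moreover have "2 * t = 4 * real ?N * r" by (simp add: t_def)
    ultimately have t: "t < b" "t < s" using t0 by linarith+
    have "real ?N * r < t" using r by (simp add: t_def)
    then have sub: "cube x r \<subseteq> ball x t" using cube_subset_cball[of x r] by (auto simp: subset_iff)
    have "set_integrable lebesgue (ball x t) J"
      by (rule set_integrable_subset[OF int(2)]) (use t in auto)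
    then have i: "integrable lebesgue (\<lambda>y. indicator (ball x t) y * \<bar>J y\<bar>)"
      using set_integrable_abs[of lebesgue "ball x t" J] by (simp add: set_integrable_def)
    have "(\<integral>\<^sup>+y\<in>cube x r. ennreal \<bar>J y\<bar> \<partial>lebesgue) \<le> (\<integral>\<^sup>+y. ennreal (indicator (ball x t) y * \<bar>J y\<bar>) \<partial>lebesgue)"
      using sub by (intro nn_integral_mono) (auto split: split_indicator)
    also have "\<dots> = ennreal (\<integral>y. indicator (ball x t) y * \<bar>J y\<bar> \<partial>lebesgue)"
      by (rule nn_integral_eq_integral[OF i]) simp
    also have "(\<integral>y. indicator (ball x t) y * \<bar>J y\<bar> \<partial>lebesgue) = ball_avg (\<lambda>y. \<bar>J y\<bar>) x t * measure lebesgue (ball x t)"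
      using content_ball_pos[OF t0, of x] by (simp add: ball_avg_def set_lebesgue_integral_def)
    also have "measure lebesgue (ball x t) = ?v * t ^ ?N" using content_ball[of t x] t0 by simp
    also have "ennreal (ball_avg (\<lambda>y. \<bar>J y\<bar>) x t * (?v * t ^ ?N)) \<le> ennreal (c' * (?v * t ^ ?N))"
      using b(2)[OF t0 t(1)] t0 by (intro ennreal_leI mult_right_mono) auto
    also have "c' * (?v * t ^ ?N) = c * r ^ ?N" using v by (simp add: c'_def t_def power_mult_distrib)
    finally show ?thesis .
  qed
  then show ?thesis using \<delta> by blast
qed

theorem mainTheorem2:
  fixes \<Omega> :: "(real^'n::finite) set"
    and f :: "real^'n \<Rightarrow> real^'n"
    and Df :: "real^'n \<Rightarrow> real^'n^'n"
    and d a q :: real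
  assumes n2: "CARD('n) \<ge> 2"
    and \<Omega>_open: "open \<Omega>"
    and d_pos: "0 < d" and d_lt: "d < real CARD('n)"
    and a_pos: "0 < a"
    and f_sob: "W2_vec q \<Omega> f"
    and Df_weak: "\<And>i j. weak_partial \<Omega> (\<lambda>x. f x $ j) i (\<lambda>x. Df x $ j $ i)"
    and J_int: "set_nn_integral lebesgue \<Omega> (\<lambda>x. neg_pow a (det (Df x))) < \<infinity>"
  shows
    "(q > real CARD('n) \<and>
        (1 - (real CARD('n) - d) / q) * a \<ge> real CARD('n) - d
      \<longrightarrow> (\<forall>Dc :: real^'n \<Rightarrow> real^'n^'n.
             continuous_on \<Omega> Dc \<and> (AE x in lebesgue. x \<in> \<Omega> \<longrightarrow> Dc x = Df x)
             \<longrightarrow> hausdorff_measure d {x \<in> \<Omega>. det (Dc x) = 0} = 0))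
   \<and> (real CARD('n) ^ 2 / (2 * real CARD('n) - 1) < q \<and> q \<le> real CARD('n) \<and>
        (real CARD('n) - d + d / real CARD('n) - real CARD('n) / q * (real CARD('n) - d)) * a
          \<ge> real CARD('n) - d
      \<longrightarrow> hausdorff_measure d {x \<in> \<Omega>. precise_value (\<lambda>y. det (Df y)) x 0} = 0)"
proof -
  let ?n = "real CARD('n)"
  have n: "2 \<le> ?n" using n2 by simp
  obtain G where G: "\<And>j i k. weak_partial \<Omega> (\<lambda>x. Df x $ j $ i) k (G j i k)" "\<And>j i k. Lp q \<Omega> (G j i k)"
    using W2_vec_second_partials[OF f_sob Df_weak] by blast
  have li: "loc_integrable \<Omega> (\<lambda>x. Df x $ j $ i)" "loc_integrable \<Omega> (G j i k)" for j i k
    using G(1)[of j i k] by (auto simp: weak_partial_def)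
  \<comment> \<open>A name for the relation lets the representatives be chosen as functions of the
    indices.\<close>
  define rep where "rep w w' \<longleftrightarrow> w' \<in> borel_measurable borel \<and> (AE x in lborel. x \<in> \<Omega> \<longrightarrow> w x = w' x)"
    for w w' :: "real^'n \<Rightarrow> real"
  have rep: "\<exists>w'. rep w w'" if "loc_integrable \<Omega> w" for w
    unfolding rep_def using loc_integrable_borel_version[OF \<Omega>_open that] by blast
  define D where "D i j x = Df x $ i $ j" for i j x
  have "\<exists>w'. rep (D i j) w'" for i j unfolding D_def by (rule rep[OF li(1)])
  then obtain U where "\<And>i j. rep (D i j) (U i j)" by metis
  then have U: "U i j \<in> borel_measurable borel" "AE x in lborel. x \<in> \<Omega> \<longrightarrow> Df x $ i $ j = U i j x" for i j
    unfolding rep_def D_def by auto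
  have "\<exists>w'. rep (G i j k) w'" for i j k by (rule rep[OF li(2)])
  then obtain G' where "\<And>i j k. rep (G i j k) (G' i j k)" by metis
  then have G': "G' i j k \<in> borel_measurable borel" "AE x in lborel. x \<in> \<Omega> \<longrightarrow> G i j k x = G' i j k x" for i j k
    unfolding rep_def by auto
  have loc: "borel_second_order \<Omega> q Df G U G'" if "1 < q"
    by unfold_locales (rule \<Omega>_open that G U G')+
  \<comment> \<open>Positivity of \<beta> is contained in the exponent inequality, because
    \<open>n - d > 0\<close> and \<open>a > 0\<close>.\<close>
  have pos: "0 < b" if "?n - d \<le> b * a" for b
    using that d_lt a_pos by (metis diff_gt_0_iff_gt less_le_trans zero_less_mult_pos2)
  show ?thesis
  proof (intro conjI impI allI; elim conjE)
    fix Dc :: "real^'n \<Rightarrow> real^'n^'n"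
    assume q: "?n < q" and \<beta>: "?n - d \<le> (1 - (?n - d) / q) * a"
      and Dc: "continuous_on \<Omega> Dc" "AE x in lebesgue. x \<in> \<Omega> \<longrightarrow> Dc x = Df x"
    interpret borel_second_order \<Omega> q Df G U G' using loc q n by simp
    show "hausdorff_measure d {x \<in> \<Omega>. det (Dc x) = 0} = 0"
      by (rule singular_set_null[OF d_pos d_lt a_pos pos[OF \<beta>] \<beta> J_int])
         (use small_det_of_continuous[OF \<Omega>_open Dc] in auto)
  next
    assume ql: "?n ^ 2 / (2 * ?n - 1) < q" "q \<le> ?n"
      and \<alpha>: "?n - d \<le> (?n - d + d / ?n - ?n / q * (?n - d)) * a"
    \<comment> \<open>This amounts to \<open>2 * n > 2 * n - 1\<close>. The resulting
      \<open>q > n / 2\<close> is the threshold for \<open>Df\<close> to be locally in L^n, and with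
      \<open>n \<ge> 2\<close> it also gives \<open>q > 1\<close>.\<close>
    have "?n / 2 < ?n ^ 2 / (2 * ?n - 1)" using n by (simp add: field_simps power2_eq_square)
    from this ql(1) have q2: "?n / 2 < q" by (rule less_trans)
    have q1: "1 < q" using q2 n by simp
    interpret borel_second_order \<Omega> q Df G U G' using loc q1 by simp
    \<comment> \<open>The exponent in (ii) is the one obtained from the integrability of the gradient of the
      Jacobian; the one for \<open>Df\<close> itself is at least as large when \<open>q \<le> n\<close>.\<close>
    have "(1 - (?n - d) / q) - (?n - d + d / ?n - ?n / q * (?n - d)) = (?n - d) * (?n - 1) * (1 / q - 1 / ?n)"
      using n q1 by (simp add: field_simps)
    moreover have "0 \<le> (?n - d) * (?n - 1) * (1 / q - 1 / ?n)"
      using d_lt n ql(2) q1 by (intro mult_nonneg_nonneg) (auto simp: field_simps)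
    ultimately have "(?n - d + d / ?n - ?n / q * (?n - d)) * a \<le> (1 - (?n - d) / q) * a"
      using a_pos by (intro mult_right_mono) auto
    with \<alpha> have \<beta>: "?n - d \<le> (1 - (?n - d) / q) * a" by linarith
    show "hausdorff_measure d {x \<in> \<Omega>. precise_value (\<lambda>y. det (Df y)) x 0} = 0"
    proof (rule singular_set_null[OF d_pos d_lt a_pos pos[OF \<beta>] \<beta> J_int])
      fix x c :: _ assume x: "x \<in> {x \<in> \<Omega>. precise_value (\<lambda>y. det (Df y)) x 0}" and c: "0 < (c :: real)"
      then obtain s where "0 < s" "set_integrable lebesgue (ball x s) (\<lambda>y. det (Df y))"
        using integrable_det_near[OF q2 ql(2)] by blast
      then show "\<exists>\<delta>>0. \<forall>r. 0 < r \<and> r \<le> \<delta> \<longrightarrow>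
          (\<integral>\<^sup>+y\<in>cube x r. ennreal \<bar>det (Df y)\<bar> \<partial>lebesgue) \<le> ennreal (c * r ^ CARD('n))"
        using x c by (intro small_det_of_precise_value) auto
    qed auto
  qed
qed

end
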